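(* Let $u\in\mathbb R^n$, and put $$W(x,y,u,v):=\{\nabla_xf(x,y)+\nabla_xg(x,y)^T\lambda_g\ :\ \lambda_g\in\Lambda(x,y)\cap\{\nabla g(x,y)(u,v)\}^\perp\}.$$ (a) Suppose that the restricted inf-compactness holds at $\bar x$ in direction $u$ with compact set $\Omega_u$, and that the feasible map $\mathcal F$ is RCR-regular at each $(\bar x,y)\in\mathrm{gph}\,S$ and satisfies RS at each $(\bar x,y)\in\mathrm{gph}\,S$ in direction $u$. Then for every choice of $v_{\tilde y}\in\Sigma(\bar x,\tilde y,u)$, made for each $\tilde y\in S(\bar x;u)\cap\Omega_u$ with $\Sigma(\bar x,\tilde y,u)\neq\emptyset$, $$\partial^cV(\bar x;u)\subseteq\mathrm{co}\bigcup_{\tilde y}W(\bar x,\tilde y,u,v_{\tilde y}),$$ the union being over all $\tilde y\in S(\bar x;u)\cap\Omega_u$ with $\Sigma(\bar x,\tilde y,u)\ne\emptyset$. (b) Suppose that there exists $\bar y\in S(\bar x)$ such that $S(x)$ is inner semi-continuous at $(\bar x,\bar y)$ in direction $u$ and $\mathcal F$ is RCR-regular at $(\bar x,\bar y)$. Then $$\partial^cV(\bar x;u)\subseteq W(\bar x,\bar y,u,v)\qquad\forall v\in\Sigma(\bar x,\bar y,u).$$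
   Context: Let $f:\mathbb R^n\times\mathbb R^m\to\mathbb R$ and $g:\mathbb R^n\times\mathbb R^m\to\mathbb R^p$ be continuously differentiable. Consider $(P_x)$: $\min_y f(x,y)$ s.t. $g(x,y)\le0$. Feasible map $\mathcal F(x)=\{y:g(x,y)\le0\}$; value function $V(x)=\inf\{f(x,y):y\in\mathcal F(x)\}$; $S(x)$ = set of optimal solutions of $(P_x)$; $\mathrm{gph}$ denotes the graph. $I_g(x,y)=\{i:g_i(x,y)=0\}$; $\Lambda(x,y)=\{\lambda\in\mathbb R^p:\nabla_yf(x,y)+\nabla_yg(x,y)^T\lambda=0,\ g(x,y)^T\lambda=0,\ \lambda\ge0\}$; $\mathbb L(x,y;u)=\{v\in\mathbb R^m:\nabla g_i(x,y)(u,v)\le0\ \forall i\in I_g(x,y)\}$; $\{w\}^\perp$ is the orthogonal complement of $w$; $\mathrm{co}$ is the convex hull. $\mathbb B$ is the open unit ball, $\mathbb B_\epsilon(\bar y)$ the open ball of radius $\epsilon$ about $\bar y$. For a direction $d$ and $\epsilon,\delta>0$: $\mathcal V_{\epsilon,\delta}(d):=\{z\in\epsilon\mathbb B : \big\|\,\|d\|z-\|z\|d\,\big\|\le\delta\|z\|\|d\|\}$. $V'(x;u)=\lim_{t\downarrow0}(V(x+tu)-V(x))/t$ is the directional derivative (which exists at $\bar x$ in direction $u$ under the hypotheses of (a) and of (b)), and $\Sigma(x,y,u):=\{v\in\mathbb L(x,y;u):V'(x;u)=\nabla f(x,y)(u,v)\}$. Regular subdifferential: $\widehat\partial V(\bar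 x)=\{\xi:V(x)\ge V(\bar x)+\langle\xi,x-\bar x\rangle+o(\|x-\bar x\|)\}$. Directional limiting subdifferential: $\partial V(\bar x;u)=\{\xi:\exists t_k\downarrow0,u^k\to u,\xi^k\to\xi\text{ with }V(\bar x+t_ku^k)\to V(\bar x),\ \xi^k\in\widehat\partial V(\bar x+t_ku^k)\}$. Directional Clarke subdifferential (for $V$ directionally Lipschitz at $\bar x$ in direction $u$, as is the case under the hypotheses): $\partial^cV(\bar x;u)=\mathrm{co}\,\partial V(\bar x;u)$. Directional solution set: $S(\bar x;u)=\{y\in S(\bar x):\exists t_k\downarrow0,u^k\to u,y^k\to y,\ y^k\in S(\bar x+t_ku^k)\}$. RCR regularity of $\mathcal F$ at $(\bar x,\bar y)\in\mathrm{gph}\,\mathcal F$: there is $\delta>0$ such that for any $K\subseteq I_g(\bar x,\bar y)$ the family $\{\nabla_yg_j(x,y)\}_{j\in K}$ has the same rank at all $(x,y)\in\mathbb B_\delta(\bar x,\bar y)$. Robinson stability (RS) of $\mathcal F$ at $(\bar x,\bar y)\in\mathrm{gph}\,\mathcal F$ in direction $u$: there are $\kappa,\epsilon,\delta>0$ with $\mathrm{dist}(y,\mathcal F(x))\le\kappa\|g_+(x,y)\|$ for all $x\in\bar x+\mathcal V_{\epsilon,\delta}(u)$, $y\in\mathbb B_\epsilon(\bar y)$, where $g_+=\max\{0,g\}$ componentwise. Restricted inf-compactness at $\bar x$ in direction $u$ with compact set $\Omega_u\subseteq\mathbb R^m$: $V(\bar x)$ is finite and there are $\epsilon,\delta>0$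 such that for all $x\in\bar x+\mathcal V_{\epsilon,\delta}(u)$ with $V(x)<V(\bar x)+\epsilon$ one has $S(x)\cap\Omega_u\ne\emptyset$. Directional inner semi-continuity: for $\bar y\in S(\bar x)$, $S$ is inner semi-continuous at $(\bar x,\bar y)$ in direction $u$ if for any sequences $t_k\downarrow0$, $u^k\to u$, there exists a sequence $y^k\in S(\bar x+t_ku^k)$ converging to $\bar y$. *)

theory Defs
  imports "HOL-Analysis.Analysis"
begin

section \<open>Derivatives\<close>

definition cont_differentiable ::
  "('a::real_normed_vector \<Rightarrow> 'b::real_normed_vector) \<Rightarrow> bool" where
  "cont_differentiable h \<longleftrightarrow>
     (\<exists>h'. (\<forall>z. (h has_derivative blinfun_apply (h' z)) (at z)) \<and> continuous_on UNIV h')"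

definition gradient :: "('a::real_inner \<Rightarrow> real) \<Rightarrow> 'a \<Rightarrow> 'a" where
  "gradient h z = (THE D. GDERIV h z :> D)"

definition grad_x :: "((real^'n) \<times> (real^'m) \<Rightarrow> real) \<Rightarrow> real^'n \<Rightarrow> real^'m \<Rightarrow> real^'n" where
  "grad_x f x y = gradient (\<lambda>x'. f (x', y)) x"

definition grad_y :: "((real^'n) \<times> (real^'m) \<Rightarrow> real) \<Rightarrow> real^'n \<Rightarrow> real^'m \<Rightarrow> real^'m" where
  "grad_y f x y = gradient (\<lambda>y'. f (x, y')) y"

definition jac_x :: "((real^'n) \<times> (real^'m) \<Rightarrow> real^'p) \<Rightarrow> real^'n \<Rightarrow> real^'m \<Rightarrow> real^'n^'p" where
  "jac_x g x y = jacobian (\<lambda>x'. g (x', y)) (at x)"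

definition jac_y :: "((real^'n) \<times> (real^'m) \<Rightarrow> real^'p) \<Rightarrow> real^'n \<Rightarrow> real^'m \<Rightarrow> real^'m^'p" where
  "jac_y g x y = jacobian (\<lambda>y'. g (x, y')) (at y)"

section \<open>The parametric program\<close>

definition feasible :: "((real^'n) \<times> (real^'m) \<Rightarrow> real^'p) \<Rightarrow> real^'n \<Rightarrow> (real^'m) set" where
  "feasible g x = {y. \<forall>i. g (x, y) $ i \<le> 0}"

text \<open>Extended-real valued: \<open>\<infinity>\<close> at parameters with no feasible point, \<open>-\<infinity>\<close> if unbounded below.\<close>

definition value_fun ::
  "((real^'n) \<times> (real^'m) \<Rightarrow> real) \<Rightarrow> ((real^'n) \<times> (real^'m) \<Rightarrow> real^'p) \<Rightarrow> real^'n \<Rightarrow> ereal" where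
  "value_fun f g x = (INF y\<in>feasible g x. ereal (f (x, y)))"

definition solutions ::
  "((real^'n) \<times> (real^'m) \<Rightarrow> real) \<Rightarrow> ((real^'n) \<times> (real^'m) \<Rightarrow> real^'p) \<Rightarrow> real^'n \<Rightarrow> (real^'m) set" where
  "solutions f g x = {y \<in> feasible g x. \<forall>y'\<in>feasible g x. f (x, y) \<le> f (x, y')}"

definition active :: "((real^'n) \<times> (real^'m) \<Rightarrow> real^'p) \<Rightarrow> real^'n \<Rightarrow> real^'m \<Rightarrow> 'p set" where
  "active g x y = {i. g (x, y) $ i = 0}"

definition multipliers ::
  "((real^'n) \<times> (real^'m) \<Rightarrow> real) \<Rightarrow> ((real^'n) \<times> (real^'m) \<Rightarrow> real^'p) \<Rightarrow>
    real^'n \<Rightarrow> real^'m \<Rightarrow> (real^'p) set" where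
  "multipliers f g x y =
     {l. grad_y f x y + transpose (jac_y g x y) *v l = 0 \<and> g (x, y) \<bullet> l = 0 \<and> (\<forall>i. 0 \<le> l $ i)}"

definition lin_cone ::
  "((real^'n) \<times> (real^'m) \<Rightarrow> real^'p) \<Rightarrow> real^'n \<Rightarrow> real^'m \<Rightarrow> real^'n \<Rightarrow> (real^'m) set" where
  "lin_cone g x y u =
     {v. \<forall>i\<in>active g x y. frechet_derivative g (at (x, y)) (u, v) $ i \<le> 0}"

section \<open>Directional notions\<close>

definition dir_nbhd :: "real \<Rightarrow> real \<Rightarrow> 'a::real_normed_vector \<Rightarrow> 'a set" where
  "dir_nbhd \<epsilon> \<delta> d =
     {z \<in> ball 0 \<epsilon>. norm (norm d *\<^sub>R z - norm z *\<^sub>R d) \<le> \<delta> * norm z * norm d}"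

text \<open>\<open>has_dir_deriv V x u d\<close> states that the directional derivative of \<open>V\<close> at \<open>x\<close> in direction \<open>u\<close>
  exists in the extended reals and equals \<open>d\<close>.\<close>

definition has_dir_deriv ::
  "('a::real_normed_vector \<Rightarrow> ereal) \<Rightarrow> 'a \<Rightarrow> 'a \<Rightarrow> ereal \<Rightarrow> bool" where
  "has_dir_deriv V x u d \<longleftrightarrow>
     ((\<lambda>t. (V (x + t *\<^sub>R u) - V x) / ereal t) \<longlongrightarrow> d) (at_right 0)"

definition Sigma_set ::
  "((real^'n) \<times> (real^'m) \<Rightarrow> real) \<Rightarrow> ((real^'n) \<times> (real^'m) \<Rightarrow> real^'p) \<Rightarrow>
    real^'n \<Rightarrow> real^'m \<Rightarrow> real^'n \<Rightarrow> (real^'m) set" where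
  "Sigma_set f g x y u =
     {v \<in> lin_cone g x y u.
        has_dir_deriv (value_fun f g) x u (ereal (frechet_derivative f (at (x, y)) (u, v)))}"

text \<open>The term \<open>o(\<parallel>x - a\<parallel>)\<close> is spelled out: for every \<open>e > 0\<close> the inequality holds near \<open>a\<close>
  with error \<open>e * \<parallel>x - a\<parallel>\<close>. As usual, there are no subgradients where \<open>V\<close> is infinite.\<close>

definition regular_subdiff :: "('a::real_inner \<Rightarrow> ereal) \<Rightarrow> 'a \<Rightarrow> 'a set" where
  "regular_subdiff V a =
     {\<xi>. \<bar>V a\<bar> \<noteq> \<infinity> \<and>
        (\<forall>e>0. \<forall>\<^sub>F x in nhds a. V x \<ge> V a + ereal (\<xi> \<bullet> (x - a) - e * norm (x - a)))}"

definition dir_limiting_subdiff :: "('a::real_inner \<Rightarrow> ereal) \<Rightarrow> 'a \<Rightarrow> 'a \<Rightarrow> 'a set" where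
  "dir_limiting_subdiff V a u =
     {\<xi>. \<exists>t u' \<xi>'. (\<forall>k. t k > 0) \<and> t \<longlonglongrightarrow> 0 \<and> u' \<longlonglongrightarrow> u \<and> \<xi>' \<longlonglongrightarrow> \<xi> \<and>
        (\<lambda>k::nat. V (a + t k *\<^sub>R u' k)) \<longlonglongrightarrow> V a \<and>
        (\<forall>k. \<xi>' k \<in> regular_subdiff V (a + t k *\<^sub>R u' k))}"

definition dir_clarke_subdiff :: "('a::real_inner \<Rightarrow> ereal) \<Rightarrow> 'a \<Rightarrow> 'a \<Rightarrow> 'a set" where
  "dir_clarke_subdiff V a u = convex hull (dir_limiting_subdiff V a u)"

definition dir_solutions ::
  "((real^'n) \<times> (real^'m) \<Rightarrow> real) \<Rightarrow> ((real^'n) \<times> (real^'m) \<Rightarrow> real^'p) \<Rightarrow>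
    real^'n \<Rightarrow> real^'n \<Rightarrow> (real^'m) set" where
  "dir_solutions f g a u =
     {y \<in> solutions f g a. \<exists>t u' y'. (\<forall>k. t k > 0) \<and> t \<longlonglongrightarrow> 0 \<and> u' \<longlonglongrightarrow> u \<and> y' \<longlonglongrightarrow> y \<and>
        (\<forall>k::nat. y' k \<in> solutions f g (a + t k *\<^sub>R u' k))}"

section \<open>Regularity conditions\<close>

definition RCR_regular ::
  "((real^'n) \<times> (real^'m) \<Rightarrow> real^'p) \<Rightarrow> real^'n \<Rightarrow> real^'m \<Rightarrow> bool" where
  "RCR_regular g a b \<longleftrightarrow> b \<in> feasible g a \<and>
     (\<exists>\<delta>>0. \<forall>K. K \<subseteq> active g a b \<longrightarrow>
        (\<exists>r. \<forall>(x, y)\<in>ball (a, b) \<delta>. dim ((\<lambda>j. grad_y (\<lambda>z. g z $ j) x y) ` K) = r))"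

text \<open>The distance to the empty set is \<open>\<infinity>\<close> in the literature, whereas \<^term>\<open>infdist y {} = 0\<close>;
  hence the explicit nonemptiness.\<close>

definition Robinson_stable ::
  "((real^'n) \<times> (real^'m) \<Rightarrow> real^'p) \<Rightarrow> real^'n \<Rightarrow> real^'m \<Rightarrow> real^'n \<Rightarrow> bool" where
  "Robinson_stable g a b u \<longleftrightarrow> b \<in> feasible g a \<and>
     (\<exists>\<kappa>>0. \<exists>\<epsilon>>0. \<exists>\<delta>>0. \<forall>x y. x - a \<in> dir_nbhd \<epsilon> \<delta> u \<longrightarrow> y \<in> ball b \<epsilon> \<longrightarrow>
        feasible g x \<noteq> {} \<and>
        infdist y (feasible g x) \<le> \<kappa> * norm (\<chi> i. max 0 (g (x, y) $ i)))"

definition restricted_inf_compact ::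
  "((real^'n) \<times> (real^'m) \<Rightarrow> real) \<Rightarrow> ((real^'n) \<times> (real^'m) \<Rightarrow> real^'p) \<Rightarrow>
    real^'n \<Rightarrow> real^'n \<Rightarrow> (real^'m) set \<Rightarrow> bool" where
  "restricted_inf_compact f g a u \<Omega> \<longleftrightarrow> compact \<Omega> \<and> \<bar>value_fun f g a\<bar> \<noteq> \<infinity> \<and>
     (\<exists>\<epsilon>>0. \<exists>\<delta>>0. \<forall>x. x - a \<in> dir_nbhd \<epsilon> \<delta> u \<longrightarrow>
        value_fun f g x < value_fun f g a + ereal \<epsilon> \<longrightarrow> solutions f g x \<inter> \<Omega> \<noteq> {})"

text \<open>Membership is required for all large \<open>k\<close> only: the initial terms of \<open>t\<close> are arbitrary, so
  requiring it for every \<open>k\<close> would make this local notion depend on parameters far from \<open>a\<close>.\<close>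

definition dir_inner_semicont ::
  "((real^'n) \<times> (real^'m) \<Rightarrow> real) \<Rightarrow> ((real^'n) \<times> (real^'m) \<Rightarrow> real^'p) \<Rightarrow>
    real^'n \<Rightarrow> real^'m \<Rightarrow> real^'n \<Rightarrow> bool" where
  "dir_inner_semicont f g a b u \<longleftrightarrow>
     (\<forall>t u'. (\<forall>k. t k > 0) \<and> t \<longlonglongrightarrow> 0 \<and> u' \<longlonglongrightarrow> u \<longrightarrow>
        (\<exists>y. (\<forall>\<^sub>F k in sequentially. y k \<in> solutions f g (a + t k *\<^sub>R u' k)) \<and> y \<longlonglongrightarrow> b))"

section \<open>The upper estimate\<close>

definition W_set ::
  "((real^'n) \<times> (real^'m) \<Rightarrow> real) \<Rightarrow> ((real^'n) \<times> (real^'m) \<Rightarrow> real^'p) \<Rightarrow>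
    real^'n \<Rightarrow> real^'m \<Rightarrow> real^'n \<Rightarrow> real^'m \<Rightarrow> (real^'n) set" where
  "W_set f g x y u v =
     {grad_x f x y + transpose (jac_x g x y) *v l | l.
        l \<in> multipliers f g x y \<inter> orthogonal_comp {frechet_derivative g (at (x, y)) (u, v)}}"

end

theory Submission
  imports Defs
begin

text \<open>A limiting subgradient \<open>\<xi>\<close> arises from regular subgradients \<open>\<xi>\<^sub>k\<close> at \<open>x\<^sub>k = a + t\<^sub>k u\<^sub>k\<close>.
  Choosing \<open>y\<^sub>k \<in> S(x\<^sub>k)\<close> with \<open>y\<^sub>k \<longlonglongrightarrow> b\<close>, the point \<open>(x\<^sub>k, y\<^sub>k)\<close> minimises, to first order, an exact penalty
  function of \<open>f - \<langle>\<xi>\<^sub>k, \<cdot>\<rangle>\<close>, since the constraints are stable. This yields bounded multipliers, and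
  a limit \<open>\<mu>\<close> of them satisfies \<open>\<nabla>f(a, b) + \<nabla>g(a, b)\<^sup>T \<mu> = (\<xi>, 0)\<close>. Since then
  \<open>\<langle>\<mu>, \<nabla>g(a, b)(u, v)\<rangle> = \<langle>\<xi>, u\<rangle> - \<nabla>f(a, b)(u, v)\<close>, orthogonality amounts to \<open>\<langle>\<xi>, u\<rangle> = V'(a; u)\<close>.

  For the latter, let \<open>J\<close> be the support of \<open>\<mu>\<close>. The constraints in \<open>J\<close> are active along \<open>(x\<^sub>k, y\<^sub>k)\<close>, and
  the constant rank condition gives a uniform error bound for the system \<open>g \<le> 0\<close>, \<open>g\<^sub>J = 0\<close>
  near every point where it is solvable. Hence there are solutions of this system at \<open>x\<^sub>k\<close> within
  \<open>O(t\<^sub>k)\<close> of \<open>b\<close>, and solutions at \<open>a\<close> within \<open>O(t\<^sub>k)\<close> of \<open>y\<^sub>k\<close>. On this system \<open>f\<close> agrees with the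
  Lagrangian, which is stationary in \<open>y\<close>, so that \<open>V(x\<^sub>k) = V(a) + t\<^sub>k \<langle>\<xi>, u\<rangle> + o(t\<^sub>k)\<close>; the first family of
  solutions also provides a \<open>v\<close> in the linearised cone with \<open>\<nabla>f(a, b)(u, v) = \<langle>\<xi>, u\<rangle>\<close>. Stability, in turn,
  bounds the directional derivative by \<open>\<nabla>f(a, b')(u, v')\<close> for all solutions \<open>b'\<close> and all \<open>v'\<close> in the
  linearised cone at \<open>b'\<close>.\<close>

section \<open>Continuously differentiable maps\<close>

text \<open>On a small ball \<open>h'\<close> oscillates by at most \<open>\<theta>\<close>, and the
  mean value inequality on the segment from \<open>q\<close> to \<open>p\<close> turns this into the
  estimate. The base point \<open>r\<close> is free, so it may be an endpoint as well as the
  centre.\<close>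

lemma C1_strict_derivative:
  fixes h :: "'a::real_normed_vector \<Rightarrow> 'b::real_normed_vector" and h' :: "'a \<Rightarrow> 'a \<Rightarrow>\<^sub>L 'b"
  assumes der: "\<And>z. (h has_derivative blinfun_apply (h' z)) (at z)"
    and cont: "continuous_on UNIV h'" and "\<theta> > 0"
  obtains \<epsilon> where "\<epsilon> > 0"
    "\<And>p q r. p \<in> ball c \<epsilon> \<Longrightarrow> q \<in> ball c \<epsilon> \<Longrightarrow> r \<in> ball c \<epsilon> \<Longrightarrow>
       norm (h p - h q - h' r (p - q)) \<le> \<theta> * norm (p - q)"
proof -
  have "continuous (at c) h'" using cont by (simp add: continuous_on_eq_continuous_at)
  then obtain \<epsilon> where \<epsilon>: "\<epsilon> > 0" "\<And>z. dist z c < \<epsilon> \<Longrightarrow> dist (h' z) (h' c) < \<theta> / 2"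
    using \<open>\<theta> > 0\<close> by (metis half_gt_zero continuous_at_eps_delta)
  have "norm (h p - h q - h' r (p - q)) \<le> \<theta> * norm (p - q)"
    if p: "p \<in> ball c \<epsilon>" and q: "q \<in> ball c \<epsilon>" and r: "r \<in> ball c \<epsilon>" for p q r
  proof -
    have seg: "q + t *\<^sub>R (p - q) \<in> ball c \<epsilon>" if "t \<in> {0..1}" for t
    proof -
      have "q + t *\<^sub>R (p - q) \<in> closed_segment q p"
        using that by (auto simp: closed_segment_def algebra_simps intro!: exI[of _ t])
      then show ?thesis using p q convex_ball[of c \<epsilon>] closed_segment_subset by blast
    qed
    have "onorm (blinfun_apply (h' x) - blinfun_apply (h' r)) \<le> \<theta>" if "x \<in> ball c \<epsilon>" for x
    proof -
      have "norm (h' x - h' r) \<le> \<theta>"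
        using \<epsilon>(2)[of x] \<epsilon>(2)[of r] that r dist_triangle2[of "h' x" "h' r" "h' c"]
        by (simp add: dist_norm[symmetric] dist_commute)
      moreover have "blinfun_apply (h' x) - blinfun_apply (h' r) = blinfun_apply (h' x - h' r)"
        by (simp add: fun_eq_iff blinfun.diff_left)
      then have "onorm (blinfun_apply (h' x) - blinfun_apply (h' r)) = norm (h' x - h' r)"
        by (simp add: norm_blinfun.rep_eq)
      ultimately show ?thesis by simp
    qed
    then show ?thesis
      using differentiable_bound_linearization[of q p "ball c \<epsilon>" h "\<lambda>x. blinfun_apply (h' x)" r \<theta>] seg r
      by (auto simp: mult.commute intro: has_derivative_at_withinI[OF der])
  qed
  with \<epsilon>(1) show thesis by (rule that)
qed

text \<open>Both points move here, as is needed to compare a perturbed solution with a moving point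
  at the unperturbed parameter.\<close>

lemma C1_strict_derivative_seq:
  fixes h :: "'a::real_normed_vector \<Rightarrow> 'b::real_normed_vector" and h' :: "'a \<Rightarrow> 'a \<Rightarrow>\<^sub>L 'b"
  assumes der: "\<And>z. (h has_derivative blinfun_apply (h' z)) (at z)"
    and cont: "continuous_on UNIV h'"
    and p: "p \<longlonglongrightarrow> c" and q: "q \<longlonglongrightarrow> c" and t: "\<And>k. t k > 0"
    and C: "\<forall>\<^sub>F k in sequentially. norm (p k - q k) \<le> C * t k"
  shows "(\<lambda>k. (h (p k) - h (q k) - h' c (p k - q k)) /\<^sub>R t k) \<longlonglongrightarrow> 0"
proof (rule tendstoI)
  fix e :: real assume "e > 0"
  define \<theta> where "\<theta> = e / (2 * (\<bar>C\<bar> + 1))"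
  have "\<theta> > 0" using \<open>e > 0\<close> by (simp add: \<theta>_def)
  obtain \<epsilon> where \<epsilon>: "\<epsilon> > 0" "\<And>p q r. p \<in> ball c \<epsilon> \<Longrightarrow> q \<in> ball c \<epsilon> \<Longrightarrow> r \<in> ball c \<epsilon> \<Longrightarrow>
       norm (h p - h q - h' r (p - q)) \<le> \<theta> * norm (p - q)"
    using C1_strict_derivative[OF der cont \<open>\<theta> > 0\<close>] by metis
  have "\<forall>\<^sub>F k in sequentially. p k \<in> ball c \<epsilon>" "\<forall>\<^sub>F k in sequentially. q k \<in> ball c \<epsilon>"
    using tendstoD[OF p \<epsilon>(1)] tendstoD[OF q \<epsilon>(1)] by (simp_all add: dist_commute)
  then show "\<forall>\<^sub>F k in sequentially. dist ((h (p k) - h (q k) - h' c (p k - q k)) /\<^sub>R t k) 0 < e"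
    using C
  proof eventually_elim
    case (elim k)
    have "norm (h (p k) - h (q k) - h' c (p k - q k)) \<le> \<theta> * norm (p k - q k)"
      using \<epsilon> elim by simp
    also have "\<dots> \<le> \<theta> * (C * t k)" using elim \<open>\<theta> > 0\<close> by (simp add: mult_left_mono)
    also have "\<dots> \<le> \<theta> * ((\<bar>C\<bar> + 1) * t k)"
      using t[of k] \<open>\<theta> > 0\<close> by (intro mult_left_mono mult_right_mono) auto
    also have "\<dots> = \<theta> * (\<bar>C\<bar> + 1) * t k" by simp
    also have "\<theta> * (\<bar>C\<bar> + 1) = e / 2" by (simp add: \<theta>_def divide_simps)
    finally have "norm (h (p k) - h (q k) - h' c (p k - q k)) \<le> e / 2 * t k" .
    also have "\<dots> < e * t k" using t[of k] \<open>e > 0\<close> by simp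
    finally show ?case using t[of k] by (simp add: divide_inverse_commute[symmetric] pos_divide_less_eq)
  qed
qed

text \<open>Hadamard differentiability: the direction may vary with \<open>k\<close> because the
  steps \<open>t k *\<^sub>R d k\<close> are of order \<open>t k\<close>.\<close>

lemma directional_quotient_tendsto:
  fixes h :: "'a::real_normed_vector \<Rightarrow> 'b::real_normed_vector" and h' :: "'a \<Rightarrow> 'a \<Rightarrow>\<^sub>L 'b"
  assumes der: "\<And>z. (h has_derivative blinfun_apply (h' z)) (at z)"
    and cont: "continuous_on UNIV h'"
    and t: "\<And>k. t k > 0" "t \<longlonglongrightarrow> 0" and d: "d \<longlonglongrightarrow> d0"
  shows "(\<lambda>k. (h (c + t k *\<^sub>R d k) - h c) /\<^sub>R t k) \<longlonglongrightarrow> h' c d0"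
proof -
  have "(\<lambda>k. norm (d k)) \<longlonglongrightarrow> norm d0" using d by (rule tendsto_norm)
  then have "\<forall>\<^sub>F k in sequentially. norm (d k) < norm d0 + 1"
    by (rule order_tendstoD) simp
  then have "\<forall>\<^sub>F k in sequentially. norm (c + t k *\<^sub>R d k - c) \<le> (norm d0 + 1) * t k"
    by eventually_elim (use t in \<open>simp add: less_imp_le mult.commute\<close>)
  moreover have "(\<lambda>k. c + t k *\<^sub>R d k) \<longlonglongrightarrow> c + 0 *\<^sub>R d0"
    by (intro tendsto_intros t d)
  ultimately have "(\<lambda>k. (h (c + t k *\<^sub>R d k) - h c - h' c (c + t k *\<^sub>R d k - c)) /\<^sub>R t k) \<longlonglongrightarrow> 0"
    by (intro C1_strict_derivative_seq[OF der cont _ tendsto_const t(1)]) auto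
  moreover have "(\<lambda>k. h' c (d k)) \<longlonglongrightarrow> h' c d0" by (intro tendsto_intros d)
  ultimately have "(\<lambda>k. (h (c + t k *\<^sub>R d k) - h c - h' c (c + t k *\<^sub>R d k - c)) /\<^sub>R t k + h' c (d k)) \<longlonglongrightarrow> 0 + h' c d0"
    by (intro tendsto_add)
  moreover have "(h (c + t k *\<^sub>R d k) - h c - h' c (c + t k *\<^sub>R d k - c)) /\<^sub>R t k + h' c (d k)
      = (h (c + t k *\<^sub>R d k) - h c) /\<^sub>R t k" for k
    using t(1)[of k] by (simp add: blinfun.scaleR_right scaleR_diff_right)
  ultimately show ?thesis by simp
qed

lemma C1_locally_lipschitz:
  fixes h :: "'a::real_normed_vector \<Rightarrow> 'b::real_normed_vector" and h' :: "'a \<Rightarrow> 'a \<Rightarrow>\<^sub>L 'b"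
  assumes der: "\<And>z. (h has_derivative blinfun_apply (h' z)) (at z)"
    and cont: "continuous_on UNIV h'"
  obtains L \<epsilon> where "L > 0" "\<epsilon> > 0"
    "\<And>p q. p \<in> ball c \<epsilon> \<Longrightarrow> q \<in> ball c \<epsilon> \<Longrightarrow> norm (h p - h q) \<le> L * norm (p - q)"
proof -
  obtain \<epsilon> where \<epsilon>: "\<epsilon> > 0" "\<And>p q r. p \<in> ball c \<epsilon> \<Longrightarrow> q \<in> ball c \<epsilon> \<Longrightarrow> r \<in> ball c \<epsilon> \<Longrightarrow>
       norm (h p - h q - h' r (p - q)) \<le> 1 * norm (p - q)"
    by (rule C1_strict_derivative[OF der cont zero_less_one]) (rule that)
  show thesis
  proof (rule that[of "norm (h' c) + 1" \<epsilon>])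
    fix p q assume "p \<in> ball c \<epsilon>" "q \<in> ball c \<epsilon>"
    then have "norm (h p - h q - h' c (p - q)) \<le> norm (p - q)" using \<epsilon>(2)[of p q c] \<epsilon>(1) by simp
    moreover have "norm (h' c (p - q)) \<le> norm (h' c) * norm (p - q)" by (rule norm_blinfun)
    moreover have "norm (h p - h q) \<le> norm (h p - h q - h' c (p - q)) + norm (h' c (p - q))"
      by (metis diff_add_cancel norm_triangle_ineq)
    ultimately show "norm (h p - h q) \<le> (norm (h' c) + 1) * norm (p - q)" by (simp add: algebra_simps)
  qed (use \<epsilon>(1) in \<open>simp_all add: add_nonneg_pos\<close>)
qed

text \<open>Squaring removes the kink of the positive part at zero. Hence the quadratic penalty in
  the error bound is differentiable and its minimisers are stationary.\<close>

lemma has_derivative_max0_power2: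
  fixes h :: "'a::real_normed_vector \<Rightarrow> real"
  assumes "(h has_derivative h') (at w)"
  shows "((\<lambda>w. (max 0 (h w))\<^sup>2) has_derivative (\<lambda>d. 2 * max 0 (h w) * h' d)) (at w)"
proof -
  have "((\<lambda>r::real. (max 0 r)\<^sup>2) has_field_derivative 2 * max 0 r) (at r)" for r
  proof -
    consider "r > 0" | "r < 0" | "r = 0" by linarith
    then show ?thesis
    proof cases
      case 1
      have "((\<lambda>r::real. r\<^sup>2) has_field_derivative 2 * max 0 r) (at r)"
        using 1 by (auto intro!: derivative_eq_intros)
      then show ?thesis
        by (rule has_field_derivative_transform_within_open[where S="{0<..}"]) (use 1 in auto)
    next
      case 2
      have "((\<lambda>r::real. 0) has_field_derivative 2 * max 0 r) (at r)"
        using 2 by (auto intro!: derivative_eq_intros)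
      then show ?thesis
        by (rule has_field_derivative_transform_within_open[where S="{..<0}"]) (use 2 in auto)
    next
      case 3
      have "((\<lambda>h::real. (max 0 h)\<^sup>2 / h) \<longlongrightarrow> 0) (at 0)"
      proof (rule Lim_null_comparison)
        show "\<forall>\<^sub>F h in at (0::real). norm ((max 0 h)\<^sup>2 / h) \<le> \<bar>h\<bar>"
          by (rule always_eventually) (auto simp: max_def power2_eq_square)
        show "((\<lambda>h::real. \<bar>h\<bar>) \<longlongrightarrow> 0) (at 0)" by (rule tendsto_rabs_zero) simp
      qed
      then have "((\<lambda>r::real. (max 0 r)\<^sup>2) has_field_derivative 0) (at 0)" by (simp add: DERIV_def)
      then show ?thesis using 3 by simp
    qed
  qed
  then have "((\<lambda>r::real. (max 0 r)\<^sup>2) has_derivative (\<lambda>d. 2 * max 0 (h w) * d)) (at (h w))"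
    by (simp add: has_field_derivative_def)
  from diff_chain_at[OF assms this] show ?thesis by (simp add: o_def)
qed

text \<open>The Riesz representer \<open>adjoint h' 1\<close> satisfies \<open>GDERIV\<close> and is
  the only vector to do so, so the definite description in \<open>gradient\<close> denotes
  it.\<close>

lemma gradient_inner:
  fixes h :: "'a::euclidean_space \<Rightarrow> real"
  assumes "(h has_derivative h') (at z)"
  shows "d \<bullet> gradient h z = h' d"
proof -
  have lin: "linear h'" using assms has_derivative_linear by blast
  have eq: "h' = (\<lambda>d. d \<bullet> adjoint h' 1)"
    using adjoint_works[OF lin, of _ 1] by (simp add: fun_eq_iff)
  then have *: "GDERIV h z :> adjoint h' 1" using assms by (simp add: gderiv_def)
  moreover have "D = adjoint h' 1" if "GDERIV h z :> D" for D
    using has_derivative_unique[OF that[unfolded gderiv_def] *[unfolded gderiv_def]]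
    by (metis vector_eq_ldot)
  ultimately have "gradient h z = adjoint h' 1" unfolding gradient_def by (intro the_equality)
  then show ?thesis using fun_cong[OF eq, of d] by simp
qed

lemma linear_functional_representation:
  fixes h :: "'a::euclidean_space \<Rightarrow> real"
  assumes "linear h"
  shows "\<exists>c. \<forall>w. h w = c \<bullet> w"
  using adjoint_works[OF assms, of _ 1] by (intro exI[of _ "adjoint h 1"]) (simp add: inner_commute)

section \<open>Multipliers\<close>

text \<open>If \<open>- c\<close> were outside the compact convex set of combinations with
  coefficients in the box, a separating vector would violate the inequality. The box delivers
  existence of a multiplier and its bound \<open>M\<close> at once.\<close>

lemma multiplier_of_penalty_inequality:
  fixes c :: "'a::euclidean_space" and G :: "'i::finite \<Rightarrow> 'a"
  assumes "M \<ge> 0"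
    and pen: "\<And>d. 0 \<le> c \<bullet> d + M * (\<Sum>i\<in>I. max 0 (G i \<bullet> d))"
  obtains l :: "real^'i" where "\<And>i. 0 \<le> l $ i" "\<And>i. l $ i \<le> M" "\<And>i. i \<notin> I \<Longrightarrow> l $ i = 0"
    "c + (\<Sum>i\<in>UNIV. (l $ i) *\<^sub>R G i) = 0"
proof -
  define B :: "(real^'i) set" where "B = cbox 0 (\<chi> i. if i \<in> I then M else 0)"
  define T where "T l = (\<Sum>i\<in>UNIV. (l $ i) *\<^sub>R G i)" for l :: "real^'i"
  have lin: "linear T"
    by (rule linearI) (simp_all add: T_def scaleR_add_left sum.distrib scaleR_sum_right)
  have conv: "convex (T ` B)" using lin by (simp add: B_def convex_linear_image)
  have comp: "compact (T ` B)"
    using lin by (simp add: B_def compact_continuous_image linear_continuous_on linear_conv_bounded_linear)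
  have "- c \<in> T ` B"
  proof (rule ccontr)
    assume "- c \<notin> T ` B"
    then obtain d \<beta> where d: "d \<bullet> (- c) < \<beta>" "\<And>x. x \<in> T ` B \<Longrightarrow> \<beta> < d \<bullet> x"
      using separating_hyperplane_closed_point[OF conv compact_imp_closed[OF comp]] by metis
    \<comment> \<open>This vertex of the box minimises \<open>d \<bullet> T l\<close>; the minimum
      is minus the penalty term at \<open>- d\<close>.\<close>
    define l :: "real^'i" where "l = (\<chi> i. if i \<in> I \<and> G i \<bullet> d < 0 then M else 0)"
    have "l \<in> B" using \<open>M \<ge> 0\<close> by (simp add: l_def B_def mem_box_cart)
    then have "- (d \<bullet> c) < d \<bullet> T l" using d by fastforce
    moreover have "d \<bullet> T l = (\<Sum>i\<in>UNIV. l $ i * (G i \<bullet> d))"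
      by (simp add: T_def inner_sum_right inner_commute)
    moreover have "\<dots> = (\<Sum>i\<in>I. - M * max 0 (G i \<bullet> (- d)))"
      by (rule sum.mono_neutral_cong_right) (auto simp: l_def)
    moreover have "\<dots> = - M * (\<Sum>i\<in>I. max 0 (G i \<bullet> (- d)))" by (simp add: sum_distrib_left)
    ultimately show False using pen[of "- d"] by (simp add: inner_commute)
  qed
  then obtain l where l: "l \<in> B" "T l = - c" by auto
  have "0 \<le> l $ i" "l $ i \<le> (if i \<in> I then M else 0)" for i
    using l(1) by (simp_all add: B_def mem_box_cart split: if_splits)
  then have "0 \<le> l $ i" "l $ i \<le> M" "i \<notin> I \<Longrightarrow> l $ i = 0" for i
    using \<open>M \<ge> 0\<close> by (smt (verit))+
  with l(2) show thesis by (intro that[of l]) (simp_all add: T_def)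
qed

section \<open>Linear independence of indexed families\<close>

lemma sum_vec_support:
  fixes m :: "real^'i" and A :: "'i \<Rightarrow> 'a::real_vector"
  assumes "\<And>i. i \<notin> K \<Longrightarrow> m $ i = 0"
  shows "(\<Sum>i\<in>UNIV. (m $ i) *\<^sub>R A i) = (\<Sum>i\<in>K. (m $ i) *\<^sub>R A i)"
  by (rule sum.mono_neutral_right) (simp_all add: assms)

text \<open>Independence is meant for the indexed family: two indices with the same vector make it
  dependent. Coefficients live on the whole index type, so they can serve directly as
  multipliers.\<close>

definition family_indep :: "('i::finite \<Rightarrow> 'a::real_vector) \<Rightarrow> 'i set \<Rightarrow> bool" where
  "family_indep A K \<longleftrightarrow>
     (\<forall>m::real^'i. (\<forall>i. i \<notin> K \<longrightarrow> m $ i = 0) \<longrightarrow> (\<Sum>i\<in>UNIV. (m $ i) *\<^sub>R A i) = 0 \<longrightarrow> m = 0)"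

lemma family_indep_inj_on:
  assumes "family_indep A K"
  shows "inj_on A K"
proof (rule inj_onI, rule ccontr)
  fix i j assume ij: "i \<in> K" "j \<in> K" "A i = A j" "i \<noteq> j"
  define m :: "real^'a" where "m = axis i 1 - axis j 1"
  have "(\<Sum>k\<in>UNIV. (m $ k) *\<^sub>R A k) = (\<Sum>k\<in>UNIV. (if k = i then A k else 0) - (if k = j then A k else 0))"
    using ij by (intro sum.cong) (auto simp: m_def axis_def)
  also have "\<dots> = 0" using ij by (simp add: sum_subtractf)
  finally have "(\<Sum>k\<in>UNIV. (m $ k) *\<^sub>R A k) = 0" .
  moreover have "m $ k = 0" if "k \<notin> K" for k using that ij by (auto simp: m_def axis_def)
  ultimately have "m = 0" using assms unfolding family_indep_def by blast
  then have "m $ i = 0" by simp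
  then show False using ij by (simp add: m_def axis_def)
qed

text \<open>Links independence of a family to the rank \<open>dim\<close> that
  \<open>RCR_regular\<close> keeps constant.\<close>

lemma family_indep_iff_dim:
  fixes A :: "'i::finite \<Rightarrow> 'a::euclidean_space"
  shows "family_indep A K \<longleftrightarrow> dim (A ` K) = card K"
proof -
  have *: "family_indep A K \<longleftrightarrow> inj_on A K \<and> independent (A ` K)"
  proof (intro iffI conjI)
    assume fi: "family_indep A K"
    show inj: "inj_on A K" using fi by (rule family_indep_inj_on)
    show "independent (A ` K)"
    proof
      assume "dependent (A ` K)"
      then obtain c x where c: "(\<Sum>v\<in>A ` K. c v *\<^sub>R v) = 0" "x \<in> A ` K" "c x \<noteq> 0"
        using real_vector.dependent_finite[of "A ` K"] by auto
      define m :: "real^'i" where "m = (\<chi> i. if i \<in> K then c (A i) else 0)"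
      have m: "m $ i = 0" if "i \<notin> K" for i using that by (simp add: m_def)
      have "(\<Sum>i\<in>UNIV. (m $ i) *\<^sub>R A i) = (\<Sum>i\<in>K. (m $ i) *\<^sub>R A i)"
        by (rule sum_vec_support) (rule m)
      also have "\<dots> = (\<Sum>i\<in>K. c (A i) *\<^sub>R A i)"
        by (rule sum.cong) (auto simp: m_def)
      also have "\<dots> = (\<Sum>v\<in>A ` K. c v *\<^sub>R v)"
        using inj by (simp add: sum.reindex)
      finally have "m = 0" using fi c m unfolding family_indep_def by metis
      moreover obtain i where "i \<in> K" "x = A i" using c by auto
      then have "m $ i \<noteq> 0" using c by (simp add: m_def)
      ultimately show False by simp
    qed
  next
    assume as: "inj_on A K \<and> independent (A ` K)"
    show "family_indep A K"
      unfolding family_indep_def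
    proof (intro allI impI)
      fix m :: "real^'i" assume m: "\<forall>i. i \<notin> K \<longrightarrow> m $ i = 0" "(\<Sum>i\<in>UNIV. (m $ i) *\<^sub>R A i) = 0"
      have "(\<Sum>v\<in>A ` K. m $ (inv_into K A v) *\<^sub>R v) = (\<Sum>i\<in>K. (m $ i) *\<^sub>R A i)"
        using as by (subst sum.reindex) (auto intro!: sum.cong)
      also have "\<dots> = 0" using m sum_vec_support[of K m A] by simp
      finally have "\<forall>v\<in>A ` K. m $ (inv_into K A v) = 0"
        using as real_vector.independentD[of "A ` K" "A ` K" "\<lambda>v. m $ (inv_into K A v)"] by auto
      then have "m $ i = 0" if "i \<in> K" for i using as that by (metis imageI inv_into_f_f)
      then show "m = 0" using m by (metis vec_eq_iff zero_index)
    qed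
  qed
  show ?thesis
  proof
    assume "family_indep A K"
    then show "dim (A ` K) = card K" using * by (simp add: card_image dim_eq_card_independent)
  next
    assume d: "dim (A ` K) = card K"
    \<comment> \<open>The dimension is at most the number of distinct vectors, which is at most
      \<open>card K\<close>. Equality throughout forces injectivity as well as independence.\<close>
    have "card K \<le> card (A ` K)" using d dim_le_card[of "A ` K" "A ` K"] by (simp add: span_superset)
    then have c: "card (A ` K) = card K" using card_image_le[of K A] by simp
    then have "inj_on A K" by (simp add: eq_card_imp_inj_on)
    moreover have "independent (A ` K)"
      using card_eq_dim[of "A ` K" "A ` K"] c d by (simp add: span_superset)
    ultimately show "family_indep A K" using * by simp
  qed
qed

text \<open>As long as the support is dependent, a multiple of a linear relation is subtracted until
  a coefficient vanishes, with the first vanishing coefficient stopping the step so that no sign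
  flips. Induction on the size of the support.\<close>

lemma sign_preserving_caratheodory:
  fixes A :: "'i::finite \<Rightarrow> 'a::real_vector" and l :: "real^'i"
  obtains l' :: "real^'i" where "\<And>i. 0 \<le> l $ i * l' $ i" "\<And>i. l $ i = 0 \<Longrightarrow> l' $ i = 0"
    "(\<Sum>i\<in>UNIV. (l' $ i) *\<^sub>R A i) = (\<Sum>i\<in>UNIV. (l $ i) *\<^sub>R A i)"
    "family_indep A {i. l' $ i \<noteq> 0}"
proof -
  have "\<exists>l'::real^'i. (\<forall>i. 0 \<le> l $ i * l' $ i) \<and> (\<forall>i. l $ i = 0 \<longrightarrow> l' $ i = 0) \<and>
      (\<Sum>i\<in>UNIV. (l' $ i) *\<^sub>R A i) = (\<Sum>i\<in>UNIV. (l $ i) *\<^sub>R A i) \<and> family_indep A {i. l' $ i \<noteq> 0}"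
  proof (induction "card {i. l $ i \<noteq> 0}" arbitrary: l rule: less_induct)
    case less
    show ?case
    proof (cases "family_indep A {i. l $ i \<noteq> 0}")
      case True
      then show ?thesis by (intro exI[of _ l]) auto
    next
      case False
      then obtain m0 :: "real^'i" where m0: "\<And>i. l $ i = 0 \<Longrightarrow> m0 $ i = 0"
        "(\<Sum>i\<in>UNIV. (m0 $ i) *\<^sub>R A i) = 0" "m0 \<noteq> 0" by (auto simp: family_indep_def)
      obtain j where j: "m0 $ j \<noteq> 0" using m0(3) by (auto simp: vec_eq_iff)
      \<comment> \<open>The sign of the relation is chosen so that \<open>m\<close> and
        \<open>l\<close> agree in sign at some index; subtracting a positive multiple then drives a
        coefficient to zero.\<close>
      define m where "m = (if m0 $ j * l $ j > 0 then m0 else - m0)"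
      have "m0 $ j * l $ j \<noteq> 0" using m0(1)[of j] j by auto
      then have mj: "m $ j * l $ j > 0" by (auto simp: m_def not_less order.order_iff_strict)
      have m: "\<And>i. l $ i = 0 \<Longrightarrow> m $ i = 0" "(\<Sum>i\<in>UNIV. (m $ i) *\<^sub>R A i) = 0"
        using m0 by (auto simp: m_def sum_negf)
      define P where "P = {i. m $ i * l $ i > 0}"
      define \<alpha> where "\<alpha> = Min ((\<lambda>i. l $ i / m $ i) ` P)"
      \<comment> \<open>The smallest ratio is the largest step without a sign change: outside
        \<open>P\<close> the coefficients keep their value or move away from zero, and at the
        minimising index the coefficient vanishes.\<close>
      have "\<alpha> \<in> (\<lambda>i. l $ i / m $ i) ` P" unfolding \<alpha>_def using mj by (intro Min_in) (auto simp: P_def)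
      then obtain i0 where i0: "i0 \<in> P" "\<alpha> = l $ i0 / m $ i0" by auto
      have \<alpha>0: "\<alpha> > 0" using i0 by (auto simp: P_def zero_less_mult_iff zero_less_divide_iff)
      have \<alpha>le: "\<alpha> \<le> l $ i / m $ i" if "i \<in> P" for i using that by (simp add: \<alpha>_def)
      define n where "n = l - \<alpha> *\<^sub>R m"
      have sgn: "0 \<le> l $ i * n $ i" for i
      proof -
        have eq: "l $ i * n $ i = l $ i * l $ i - \<alpha> * (m $ i * l $ i)" by (simp add: n_def algebra_simps)
        show ?thesis
        proof (cases "i \<in> P")
          case True
          then have "\<alpha> * (m $ i * l $ i) \<le> l $ i / m $ i * (m $ i * l $ i)"
            using \<alpha>le by (intro mult_right_mono) (auto simp: P_def)
          also have "\<dots> = l $ i * l $ i" using True by (auto simp: P_def)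
          finally show ?thesis using eq by simp
        next
          case False
          then have "m $ i * l $ i \<le> 0" by (simp add: P_def)
          then have "\<alpha> * (m $ i * l $ i) \<le> 0" using \<alpha>0 by (simp only: mult_nonneg_nonpos order.strict_implies_order)
          then show ?thesis unfolding eq using zero_le_square[of "l $ i"] by linarith
        qed
      qed
      have zero: "l $ i = 0 \<Longrightarrow> n $ i = 0" for i using m by (simp add: n_def)
      have "n $ i0 = 0" "l $ i0 \<noteq> 0" using i0 by (auto simp: n_def P_def)
      then have "{i. n $ i \<noteq> 0} \<subset> {i. l $ i \<noteq> 0}" using zero by auto
      then have "card {i. n $ i \<noteq> 0} < card {i. l $ i \<noteq> 0}" by (simp add: psubset_card_mono)
      from less[OF this] obtain l' :: "real^'i" where l': "\<forall>i. 0 \<le> n $ i * l' $ i"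
        "\<forall>i. n $ i = 0 \<longrightarrow> l' $ i = 0" "(\<Sum>i\<in>UNIV. (l' $ i) *\<^sub>R A i) = (\<Sum>i\<in>UNIV. (n $ i) *\<^sub>R A i)"
        "family_indep A {i. l' $ i \<noteq> 0}" by auto
      have "(\<Sum>i\<in>UNIV. (n $ i) *\<^sub>R A i) = (\<Sum>i\<in>UNIV. (l $ i) *\<^sub>R A i)"
        using m(2) by (simp add: n_def scaleR_diff_left sum_subtractf scaleR_sum_right[symmetric] scaleR_scaleR[symmetric] del: scaleR_scaleR)
      moreover have "0 \<le> l $ i * l' $ i" for i
      proof (cases "n $ i = 0")
        case False
        have "0 \<le> (l $ i * n $ i) * (n $ i * l' $ i)" using sgn l'(1) by simp
        also have "\<dots> = (l $ i * l' $ i) * (n $ i)\<^sup>2" by (simp add: power2_eq_square)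
        finally show ?thesis using False by (simp add: zero_le_mult_iff)
      qed (use l'(2) in simp)
      ultimately show ?thesis using l' zero by (intro exI[of _ l']) auto
    qed
  qed
  with that show thesis by blast
qed

text \<open>The coefficient map at \<open>c\<close> is injective, hence bounded below by some
  \<open>B\<close>. Near \<open>c\<close> the vectors move so little that the sum changes by at most
  \<open>B / 2\<close> times the norm of the coefficients.\<close>

lemma multiplier_bound_indep:
  fixes A :: "'q::metric_space \<Rightarrow> 'i::finite \<Rightarrow> 'a::euclidean_space"
  assumes cont: "\<And>i. isCont (\<lambda>p. A p i) c" and ind: "family_indep (A c) K"
  obtains M \<epsilon> where "M > 0" "\<epsilon> > 0"
    "\<And>p m. p \<in> ball c \<epsilon> \<Longrightarrow> (\<And>i. i \<notin> K \<Longrightarrow> m $ i = 0) \<Longrightarrow>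
       norm (m :: real^'i) \<le> M * norm (\<Sum>i\<in>UNIV. (m $ i) *\<^sub>R A p i)"
proof -
  \<comment> \<open>The second component records the coefficients off \<open>K\<close>, which makes
    \<open>T\<close> injective on the whole space and not only on the subspace supported on
    \<open>K\<close>.\<close>
  define T :: "real^'i \<Rightarrow> 'a \<times> (real^'i)"
    where "T m = ((\<Sum>i\<in>K. (m $ i) *\<^sub>R A c i), (\<chi> i. if i \<in> K then 0 else m $ i))" for m
  have lin: "linear T"
    by (rule linearI) (auto simp: T_def scaleR_add_left sum.distrib scaleR_sum_right vec_eq_iff)
  have "inj T"
  proof (subst linear_injective_0[OF lin], intro allI impI)
    fix m assume "T m = 0"
    then have 1: "(\<Sum>i\<in>K. (m $ i) *\<^sub>R A c i) = 0" and 2: "\<And>i. i \<notin> K \<Longrightarrow> m $ i = 0"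
      by (auto simp: T_def zero_prod_def vec_eq_iff split: if_splits)
    then show "m = 0" using ind sum_vec_support[of K m "A c"] by (auto simp: family_indep_def)
  qed
  then obtain B where B: "B > 0" "\<And>m. B * norm m \<le> norm (T m)"
    using linear_inj_bounded_below_pos[OF lin] by blast
  have low: "B * norm m \<le> norm (\<Sum>i\<in>UNIV. (m $ i) *\<^sub>R A c i)" if "\<And>i. i \<notin> K \<Longrightarrow> m $ i = 0" for m
  proof -
    have "T m = ((\<Sum>i\<in>UNIV. (m $ i) *\<^sub>R A c i), 0)"
      using that sum_vec_support[of K m "A c"] by (auto simp: T_def vec_eq_iff)
    then show ?thesis using B(2)[of m] by (simp add: norm_Pair)
  qed
  have "isCont (\<lambda>p. \<Sum>i\<in>UNIV. norm (A p i - A c i)) c"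
    using cont by (intro continuous_intros) auto
  moreover have "0 < B / 2" using B by simp
  ultimately obtain \<epsilon> where \<epsilon>: "\<epsilon> > 0"
    "\<And>p. dist p c < \<epsilon> \<Longrightarrow> dist (\<Sum>i\<in>UNIV. norm (A p i - A c i)) (\<Sum>i\<in>UNIV. norm (A c i - A c i)) < B / 2"
    unfolding continuous_at_eps_delta by blast
  have \<epsilon>': "(\<Sum>i\<in>UNIV. norm (A p i - A c i)) < B / 2" if "dist p c < \<epsilon>" for p
    using \<epsilon>(2)[OF that] by (simp add: dist_real_def)
  have "norm m \<le> 2 / B * norm (\<Sum>i\<in>UNIV. (m $ i) *\<^sub>R A p i)"
    if p: "p \<in> ball c \<epsilon>" and m: "\<And>i. i \<notin> K \<Longrightarrow> m $ i = 0" for p and m :: "real^'i"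
  proof -
    have "norm (\<Sum>i\<in>UNIV. (m $ i) *\<^sub>R (A p i - A c i)) \<le> (\<Sum>i\<in>UNIV. norm m * norm (A p i - A c i))"
      by (rule order_trans[OF norm_sum]) (auto intro!: sum_mono mult_right_mono component_le_norm_cart)
    also have "\<dots> = norm m * (\<Sum>i\<in>UNIV. norm (A p i - A c i))" by (simp add: sum_distrib_left)
    also have "\<dots> \<le> norm m * (B / 2)"
      using \<epsilon>'[of p] p by (intro mult_left_mono) (auto simp: dist_commute)
    finally have 1: "norm (\<Sum>i\<in>UNIV. (m $ i) *\<^sub>R (A p i - A c i)) \<le> norm m * (B / 2)" .
    have "(\<Sum>i\<in>UNIV. (m $ i) *\<^sub>R A c i) = (\<Sum>i\<in>UNIV. (m $ i) *\<^sub>R A p i) - (\<Sum>i\<in>UNIV. (m $ i) *\<^sub>R (A p i - A c i))"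
      by (simp add: scaleR_diff_right sum_subtractf)
    then have "B * norm m \<le> norm (\<Sum>i\<in>UNIV. (m $ i) *\<^sub>R A p i) + norm m * (B / 2)"
      using low[OF m] 1 norm_triangle_ineq4[of "\<Sum>i\<in>UNIV. (m $ i) *\<^sub>R A p i" "\<Sum>i\<in>UNIV. (m $ i) *\<^sub>R (A p i - A c i)"]
      by simp
    then show ?thesis using B(1) by (simp add: field_simps)
  qed
  then show thesis using that[of "2 / B" \<epsilon>] B(1) \<epsilon>(1) by simp
qed

text \<open>Constancy of the ranks makes every subfamily that is independent near \<open>c\<close> independent at
  \<open>c\<close>, so the coefficients of an independent subfamily stay uniformly bounded.\<close>

lemma bounded_multipliers_constant_rank:
  fixes A :: "'q::metric_space \<Rightarrow> 'i::finite \<Rightarrow> 'a::euclidean_space"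
  assumes cont: "\<And>i. isCont (\<lambda>p. A p i) c" and "\<delta> > 0"
    and rank: "\<forall>K. K \<subseteq> I \<longrightarrow> (\<exists>r. \<forall>p\<in>ball c \<delta>. dim (A p ` K) = r)"
  obtains M \<epsilon> where "M > 0" "\<epsilon> > 0"
    "\<forall>p\<in>ball c \<epsilon>. \<forall>l. (\<forall>i. i \<notin> I \<longrightarrow> l $ i = 0) \<longrightarrow>
       (\<exists>l'::real^'i. (\<forall>i. 0 \<le> l $ i * l' $ i) \<and> (\<forall>i. l $ i = 0 \<longrightarrow> l' $ i = 0) \<and>
         (\<Sum>i\<in>UNIV. (l' $ i) *\<^sub>R A p i) = (\<Sum>i\<in>UNIV. (l $ i) *\<^sub>R A p i) \<and>
         norm l' \<le> M * norm (\<Sum>i\<in>UNIV. (l $ i) *\<^sub>R A p i))"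
proof -
  define Q where "Q K M \<epsilon> \<longleftrightarrow> M > 0 \<and> \<epsilon> > 0 \<and>
      (\<forall>p m. p \<in> ball c \<epsilon> \<longrightarrow> family_indep (A p) K \<longrightarrow> (\<forall>i. i \<notin> K \<longrightarrow> m $ i = 0) \<longrightarrow>
        norm (m :: real^'i) \<le> M * norm (\<Sum>i\<in>UNIV. (m $ i) *\<^sub>R A p i))" for K M \<epsilon>
  have "\<exists>M \<epsilon>. Q K M \<epsilon>" if "K \<subseteq> I" for K
  proof (cases "family_indep (A c) K")
    case True
    then obtain M \<epsilon> where "M > 0" "\<epsilon> > 0"
      "\<And>p m. p \<in> ball c \<epsilon> \<Longrightarrow> (\<And>i. i \<notin> K \<Longrightarrow> m $ i = 0) \<Longrightarrow>
       norm (m :: real^'i) \<le> M * norm (\<Sum>i\<in>UNIV. (m $ i) *\<^sub>R A p i)"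
      using multiplier_bound_indep[where A=A and c=c and K=K, OF cont] by metis
    then show ?thesis unfolding Q_def by blast
  next
    case False
    \<comment> \<open>Dependence at \<open>c\<close> means that the constant rank \<open>r\<close>
      differs from \<open>card K\<close>, so \<open>K\<close> is dependent on the whole ball. The
      bound is then vacuous and any constant serves.\<close>
    obtain r where r: "\<And>p. p \<in> ball c \<delta> \<Longrightarrow> dim (A p ` K) = r" using rank \<open>K \<subseteq> I\<close> by blast
    then have "\<not> family_indep (A p) K" if "p \<in> ball c \<delta>" for p
      using False that \<open>\<delta> > 0\<close> r[of c] by (simp add: family_indep_iff_dim)
    then show ?thesis unfolding Q_def using \<open>\<delta> > 0\<close> zero_less_one by blast
  qed
  then have "\<forall>K. \<exists>M \<epsilon>. K \<subseteq> I \<longrightarrow> Q K M \<epsilon>" by blast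
  then obtain M \<epsilon> where Q: "\<And>K. K \<subseteq> I \<Longrightarrow> Q K (M K) (\<epsilon> K)" by metis
  have M: "\<And>K. K \<subseteq> I \<Longrightarrow> M K > 0" "\<And>K. K \<subseteq> I \<Longrightarrow> \<epsilon> K > 0"
    "\<And>K p m. K \<subseteq> I \<Longrightarrow> p \<in> ball c (\<epsilon> K) \<Longrightarrow> family_indep (A p) K \<Longrightarrow> (\<And>i. i \<notin> K \<Longrightarrow> m $ i = 0) \<Longrightarrow>
       norm (m :: real^'i) \<le> M K * norm (\<Sum>i\<in>UNIV. (m $ i) *\<^sub>R A p i)"
    using Q unfolding Q_def by blast+
  \<comment> \<open>There are only finitely many subfamilies, so the largest constant and the
    smallest radius serve all of them.\<close>
  define M0 where "M0 = Max (M ` Pow I)"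
  define \<epsilon>0 where "\<epsilon>0 = Min (\<epsilon> ` Pow I)"
  have fin: "finite (Pow I)" by simp
  have "\<epsilon>0 \<in> \<epsilon> ` Pow I" unfolding \<epsilon>0_def by (rule Min_in) (use fin in auto)
  then have "\<epsilon>0 > 0" using M(2) by auto
  have Mle: "M K \<le> M0" if "K \<subseteq> I" for K using that fin by (simp add: M0_def)
  have \<epsilon>le: "\<epsilon>0 \<le> \<epsilon> K" if "K \<subseteq> I" for K using that fin by (simp add: \<epsilon>0_def)
  have "M0 > 0" using M(1)[of "{}"] Mle[of "{}"] by simp
  show thesis
  proof (rule that[OF \<open>M0 > 0\<close> \<open>\<epsilon>0 > 0\<close>], intro ballI allI impI)
    fix p and l :: "real^'i" assume p: "p \<in> ball c \<epsilon>0" and l: "\<forall>i. i \<notin> I \<longrightarrow> l $ i = 0"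
    obtain l' :: "real^'i" where l': "\<And>i. 0 \<le> l $ i * l' $ i" "\<And>i. l $ i = 0 \<Longrightarrow> l' $ i = 0"
      "(\<Sum>i\<in>UNIV. (l' $ i) *\<^sub>R A p i) = (\<Sum>i\<in>UNIV. (l $ i) *\<^sub>R A p i)"
      "family_indep (A p) {i. l' $ i \<noteq> 0}"
      using sign_preserving_caratheodory[of l "A p"] by blast
    define K where "K = {i. l' $ i \<noteq> 0}"
    have K: "K \<subseteq> I" using l l'(2) by (auto simp: K_def)
    have "norm l' \<le> M K * norm (\<Sum>i\<in>UNIV. (l' $ i) *\<^sub>R A p i)"
    proof (rule M(3)[OF K])
      show "p \<in> ball c (\<epsilon> K)" using \<epsilon>le[OF K] p by simp
      show "family_indep (A p) K" unfolding K_def by (rule l'(4))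
    qed (simp add: K_def)
    also have "\<dots> \<le> M0 * norm (\<Sum>i\<in>UNIV. (l' $ i) *\<^sub>R A p i)"
      using Mle[OF K] by (simp add: mult_right_mono)
    finally show "\<exists>l'::real^'i. (\<forall>i. 0 \<le> l $ i * l' $ i) \<and> (\<forall>i. l $ i = 0 \<longrightarrow> l' $ i = 0) \<and>
         (\<Sum>i\<in>UNIV. (l' $ i) *\<^sub>R A p i) = (\<Sum>i\<in>UNIV. (l $ i) *\<^sub>R A p i) \<and>
         norm l' \<le> M0 * norm (\<Sum>i\<in>UNIV. (l $ i) *\<^sub>R A p i)"
      using l'(1,2,3) by (intro exI[of _ l']) simp
  qed
qed

section \<open>Sequences and directional neighbourhoods\<close>

lemma eventually_bounded_convergent_subsequence:
  fixes s :: "nat \<Rightarrow> 'a::euclidean_space"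
  assumes "\<forall>\<^sub>F k in sequentially. norm (s k) \<le> C"
  obtains r l where "strict_mono (r :: nat \<Rightarrow> nat)" "(\<lambda>k. s (r k)) \<longlonglongrightarrow> l"
proof -
  obtain N where N: "\<And>k. k \<ge> N \<Longrightarrow> norm (s k) \<le> C"
    using assms by (auto simp: eventually_sequentially)
  have "seq_compact (cball (0::'a) C)" using compact_imp_seq_compact compact_cball by blast
  then obtain l r where lr: "strict_mono r" "((\<lambda>k. s (k + N)) \<circ> r) \<longlonglongrightarrow> l"
    unfolding seq_compact_def using N by (metis le_add2 mem_cball_0)
  then have "strict_mono (\<lambda>k. r k + N)" by (simp add: strict_mono_def)
  with lr(2) show thesis by (intro that[of "\<lambda>k. r k + N" l]) (simp_all add: o_def)
qed

lemma subsequence_direction: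
  assumes "\<And>k. t k > 0" "t \<longlonglongrightarrow> 0" "w \<longlonglongrightarrow> u" "strict_mono (r :: nat \<Rightarrow> nat)"
  shows "\<And>k. t (r k) > (0::real)" "(\<lambda>k. t (r k)) \<longlonglongrightarrow> 0" "(\<lambda>k. w (r k)) \<longlonglongrightarrow> u"
  using assms(1) LIMSEQ_subseq_LIMSEQ[OF assms(2,4)] LIMSEQ_subseq_LIMSEQ[OF assms(3,4)]
  by (simp_all add: o_def)

text \<open>Unlike \<^const>\<open>dir_nbhd\<close>, this set is open, so that stability in direction \<open>d\<close> covers full
  neighbourhoods of the perturbed parameters.\<close>

definition cone_nbhd :: "real \<Rightarrow> 'a::real_normed_vector \<Rightarrow> 'a set" where
  "cone_nbhd \<eta> d = {t *\<^sub>R w |t w. 0 < t \<and> t < \<eta> \<and> dist w d < \<eta>}"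

lemma open_cone_nbhd: "open (cone_nbhd \<eta> d)"
proof -
  have "cone_nbhd \<eta> d = (\<Union>t\<in>{0<..<\<eta>}. (*\<^sub>R) t ` ball d \<eta>)"
    by (auto simp: cone_nbhd_def dist_commute image_iff) blast
  then show ?thesis by (auto intro!: open_scaling)
qed

lemma cone_nbhd_mono: "\<eta> \<le> \<eta>' \<Longrightarrow> cone_nbhd \<eta> d \<subseteq> cone_nbhd \<eta>' d"
  unfolding cone_nbhd_def using less_le_trans by blast

lemma eventually_in_cone_nbhd:
  assumes "\<And>k. t k > 0" "t \<longlonglongrightarrow> 0" "w \<longlonglongrightarrow> d" "\<eta> > 0"
  shows "\<forall>\<^sub>F k in sequentially. t k *\<^sub>R w k \<in> cone_nbhd \<eta> d"
  using order_tendstoD(2)[OF assms(2,4)] tendstoD[OF assms(3,4)]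
  by eventually_elim (unfold cone_nbhd_def mem_Collect_eq, use assms(1) in blast)

text \<open>Turns statements about sequences approaching in direction \<open>d\<close> into one
  uniform neighbourhood: counterexamples in the neighbourhoods of size
  \<open>1 / real (Suc k)\<close> would form such a sequence.\<close>

lemma cone_nbhd_sequentially:
  assumes "\<And>t w. (\<And>k. t k > 0) \<Longrightarrow> t \<longlonglongrightarrow> 0 \<Longrightarrow> w \<longlonglongrightarrow> d \<Longrightarrow> \<exists>k::nat. P (t k *\<^sub>R w k)"
  shows "\<exists>\<eta>>0. \<forall>z\<in>cone_nbhd \<eta> d. P z"
proof (rule ccontr)
  assume *: "\<not> (\<exists>\<eta>>0. \<forall>z\<in>cone_nbhd \<eta> d. P z)"
  have "\<exists>t w. 0 < t \<and> t < 1 / real (Suc k) \<and> dist w d < 1 / real (Suc k) \<and> \<not> P (t *\<^sub>R w)" for k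
  proof -
    have "\<exists>z\<in>cone_nbhd (1 / real (Suc k)) d. \<not> P z" using * by (metis of_nat_0_less_iff zero_less_Suc zero_less_divide_1_iff)
    then show ?thesis by (auto simp: cone_nbhd_def)
  qed
  then obtain t w where tw: "\<And>k. 0 < t k" "\<And>k. t k < 1 / real (Suc k)"
    "\<And>k. dist (w k) d < 1 / real (Suc k)" "\<And>k. \<not> P (t k *\<^sub>R w k)" by metis
  have lim: "(\<lambda>k. 1 / real (Suc k)) \<longlonglongrightarrow> 0" using LIMSEQ_inverse_real_of_nat by (simp add: inverse_eq_divide)
  have "t \<longlonglongrightarrow> 0"
    by (rule tendsto_sandwich[OF _ _ tendsto_const lim]) (use tw in \<open>auto intro!: always_eventually less_imp_le simp del: of_nat_Suc\<close>)
  moreover have "(\<lambda>k. dist (w k) d) \<longlonglongrightarrow> 0"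
    by (rule tendsto_sandwich[OF _ _ tendsto_const lim]) (use tw in \<open>auto intro!: always_eventually less_imp_le simp del: of_nat_Suc\<close>)
  then have "w \<longlonglongrightarrow> d" by (subst tendsto_dist_iff)
  ultimately show False using assms[of t w] tw(1,4) by blast
qed

text \<open>The angular condition is homogeneous, so the factor \<open>t k\<close> cancels. For
  \<open>w k\<close> alone it holds eventually because it is strict at the limit
  \<open>d\<close>.\<close>

lemma eventually_in_dir_nbhd:
  assumes t: "\<And>k. t k > 0" "t \<longlonglongrightarrow> 0" and w: "w \<longlonglongrightarrow> d" and "\<epsilon> > 0" "\<delta> > 0"
  shows "\<forall>\<^sub>F k in sequentially. t k *\<^sub>R w k \<in> dir_nbhd \<epsilon> \<delta> d"
proof -
  have "(\<lambda>k. t k *\<^sub>R w k) \<longlonglongrightarrow> 0 *\<^sub>R d" by (intro tendsto_intros t w)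
  then have ev1: "\<forall>\<^sub>F k in sequentially. norm (t k *\<^sub>R w k) < \<epsilon>"
    using tendstoD[OF _ \<open>\<epsilon> > 0\<close>, of "\<lambda>k. t k *\<^sub>R w k" 0] by simp
  have ev2: "\<forall>\<^sub>F k in sequentially. norm (norm d *\<^sub>R w k - norm (w k) *\<^sub>R d) \<le> \<delta> * norm (w k) * norm d"
  \<comment> \<open>For \<open>d = 0\<close> both sides vanish, and there is no strict inequality to
    pass on from the limit.\<close>
  proof (cases "d = 0")
    case False
    have "(\<lambda>k. norm (norm d *\<^sub>R w k - norm (w k) *\<^sub>R d) - \<delta> * norm (w k) * norm d)
        \<longlonglongrightarrow> norm (norm d *\<^sub>R d - norm d *\<^sub>R d) - \<delta> * norm d * norm d"
      by (intro tendsto_intros w)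
    moreover have "norm (norm d *\<^sub>R d - norm d *\<^sub>R d) - \<delta> * norm d * norm d < 0"
      using False \<open>\<delta> > 0\<close> by simp
    ultimately have "\<forall>\<^sub>F k in sequentially.
        norm (norm d *\<^sub>R w k - norm (w k) *\<^sub>R d) - \<delta> * norm (w k) * norm d < 0"
      by (rule order_tendstoD)
    then show ?thesis by eventually_elim simp
  qed simp
  from ev1 ev2 show ?thesis
  proof eventually_elim
    case (elim k)
    have "norm d *\<^sub>R t k *\<^sub>R w k - norm (t k *\<^sub>R w k) *\<^sub>R d = t k *\<^sub>R (norm d *\<^sub>R w k - norm (w k) *\<^sub>R d)"
      using t(1)[of k] by (simp add: scaleR_diff_right mult.commute)
    then have "norm (norm d *\<^sub>R t k *\<^sub>R w k - norm (t k *\<^sub>R w k) *\<^sub>R d) \<le> t k * (\<delta> * norm (w k) * norm d)"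
      using elim t(1)[of k] by simp
    then show ?case using elim t(1)[of k] by (simp add: dir_nbhd_def mult_ac)
  qed
qed

text \<open>Minimisers of distance plus growing penalty cluster at a zero of \<open>P\<close>
  nearest to \<open>z\<close>. The additional square of the distance to \<open>z'\<close> singles
  out \<open>z'\<close> should there be several nearest zeros.\<close>

lemma penalty_minimizers_tendsto:
  fixes P :: "'a::euclidean_space \<Rightarrow> real"
  assumes cont: "continuous_on (cball z' \<rho>) P" and "\<rho> > 0"
    and nonneg: "\<And>w. 0 \<le> P w" and "P z' = 0"
    and nearest: "\<forall>w\<in>cball z' \<rho>. P w = 0 \<longrightarrow> dist z z' \<le> dist z w"
  obtains w s where "w \<longlonglongrightarrow> z'" "\<And>n::nat. w n \<in> ball z' \<rho>" "\<And>n. (0::real) \<le> s n"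
    "\<And>n v. v \<in> ball z' \<rho> \<Longrightarrow>
       (w n - z) \<bullet> (w n - z) + (w n - z') \<bullet> (w n - z') + s n * P (w n)
       \<le> (v - z) \<bullet> (v - z) + (v - z') \<bullet> (v - z') + s n * P v"
proof -
  define \<phi> where "\<phi> n v = (v - z) \<bullet> (v - z) + (v - z') \<bullet> (v - z') + real n * P v" for n :: nat and v
  have "\<exists>w\<in>cball z' \<rho>. \<forall>v\<in>cball z' \<rho>. \<phi> n w \<le> \<phi> n v" for n
    unfolding \<phi>_def by (rule continuous_attains_inf) (use \<open>\<rho> > 0\<close> in \<open>auto intro!: continuous_intros cont\<close>)
  then obtain w0 where w0: "\<And>n. w0 n \<in> cball z' \<rho>" "\<And>n v. v \<in> cball z' \<rho> \<Longrightarrow> \<phi> n (w0 n) \<le> \<phi> n v"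
    by metis
  have "seq_compact (cball z' \<rho>)" using compact_imp_seq_compact compact_cball by blast
  then obtain w1 r where w1: "w1 \<in> cball z' \<rho>" "strict_mono r" "(w0 \<circ> r) \<longlonglongrightarrow> w1"
    using w0(1) unfolding seq_compact_def by metis
  have z'in: "z' \<in> cball z' \<rho>" using \<open>\<rho> > 0\<close> by simp
  \<comment> \<open>\<open>D\<close> is the objective at \<open>z'\<close>, where penalty and
    additional square vanish; it bounds all the minimal values.\<close>
  define D where "D = (z' - z) \<bullet> (z' - z)"
  have le: "\<phi> n (w0 n) \<le> D" for n
    using w0(2)[OF z'in, of n] \<open>P z' = 0\<close> by (simp add: \<phi>_def D_def)
  have Plim: "(\<lambda>n. P (w0 (r n))) \<longlonglongrightarrow> P w1"
    using continuous_on_tendsto_compose[OF cont w1(3) w1(1)] w0(1) by (simp add: o_def)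
  have le2: "(w0 (r n) - z) \<bullet> (w0 (r n) - z) + (w0 (r n) - z') \<bullet> (w0 (r n) - z') \<le> D" for n
    using le[of "r n"] nonneg[of "w0 (r n)"] mult_nonneg_nonneg[of "real (r n)" "P (w0 (r n))"]
    unfolding \<phi>_def by linarith
  have "P (w0 (r n)) \<le> D / real n" if "n \<ge> 1" for n
  proof -
    have "real n * P (w0 (r n)) \<le> real (r n) * P (w0 (r n))"
      using seq_suble[OF w1(2)] nonneg by (intro mult_right_mono) auto
    also have "\<dots> \<le> D" using le[of "r n"] unfolding \<phi>_def
      using inner_ge_zero[of "w0 (r n) - z"] inner_ge_zero[of "w0 (r n) - z'"] by linarith
    finally show ?thesis using that by (simp add: field_simps)
  qed
  then have "P w1 \<le> 0"
    by (intro LIMSEQ_le[OF Plim lim_const_over_n[of D]]) blast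
  then have "P w1 = 0" using nonneg[of w1] by simp
  have "(w1 - z) \<bullet> (w1 - z) + (w1 - z') \<bullet> (w1 - z') \<le> D"
  proof (rule LIMSEQ_le_const2)
    show "(\<lambda>n. (w0 (r n) - z) \<bullet> (w0 (r n) - z) + (w0 (r n) - z') \<bullet> (w0 (r n) - z'))
       \<longlonglongrightarrow> (w1 - z) \<bullet> (w1 - z) + (w1 - z') \<bullet> (w1 - z')"
      using w1(3) by (intro tendsto_intros) (simp_all add: o_def)
  qed (use le2 in blast)
  \<comment> \<open>As a zero of \<open>P\<close>, the limit \<open>w1\<close> is no closer to
    \<open>z\<close> than \<open>z'\<close> is. The first square thus already uses up the bound
    \<open>D\<close>, and nothing is left for the distance to \<open>z'\<close>.\<close>
  moreover have "D \<le> (w1 - z) \<bullet> (w1 - z)"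
    using nearest[rule_format, OF w1(1) \<open>P w1 = 0\<close>] by (simp add: D_def dist_norm norm_minus_commute dot_square_norm)
  ultimately have "(w1 - z') \<bullet> (w1 - z') \<le> 0" by simp
  then have "w1 = z'" by (metis antisym inner_eq_zero_iff inner_ge_zero right_minus_eq)
  with w1 have lim: "(\<lambda>n. w0 (r n)) \<longlonglongrightarrow> z'" by (simp add: o_def)
  \<comment> \<open>Dropping the first \<open>N\<close> terms puts all minimisers inside the open
    ball, where stationarity can be exploited.\<close>
  obtain N where N: "\<And>n. n \<ge> N \<Longrightarrow> dist (w0 (r n)) z' < \<rho>"
    using tendstoD[OF lim \<open>\<rho> > 0\<close>] by (auto simp: eventually_sequentially)
  show thesis
  proof (rule that[of "\<lambda>n. w0 (r (n + N))" "\<lambda>n. real (r (n + N))"])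
    show "(\<lambda>n. w0 (r (n + N))) \<longlonglongrightarrow> z'" using lim by (rule LIMSEQ_ignore_initial_segment)
    show "w0 (r (n + N)) \<in> ball z' \<rho>" for n using N[of "n + N"] by (simp add: dist_commute)
  qed (use w0(2) in \<open>auto simp: \<phi>_def\<close>)
qed

section \<open>The error bound under constant rank\<close>

text \<open>Fixes the joint derivatives as bounded linear maps, so that continuity is in operator
  norm and partial derivatives are evaluations at \<open>(d, 0)\<close> and
  \<open>(0, e)\<close>.\<close>

locale c1_program =
  fixes f :: "(real^'n) \<times> (real^'m) \<Rightarrow> real" and g :: "(real^'n) \<times> (real^'m) \<Rightarrow> real^'p"
    and f' :: "(real^'n) \<times> (real^'m) \<Rightarrow> ((real^'n) \<times> (real^'m)) \<Rightarrow>\<^sub>L real"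
    and g' :: "(real^'n) \<times> (real^'m) \<Rightarrow> ((real^'n) \<times> (real^'m)) \<Rightarrow>\<^sub>L (real^'p)"
  assumes f_der: "(f has_derivative blinfun_apply (f' z)) (at z)"
    and f'_cont: "continuous_on UNIV f'"
    and g_der: "(g has_derivative blinfun_apply (g' z)) (at z)"
    and g'_cont: "continuous_on UNIV g'"
begin

section \<open>Partial gradients and Jacobians in terms of the joint derivatives\<close>

lemma continuous_f: "isCont f z" and continuous_g: "isCont g z"
  using f_der g_der has_derivative_continuous by blast+

lemma tendsto_f: "(F \<longlongrightarrow> z) net \<Longrightarrow> ((\<lambda>k. f (F k)) \<longlongrightarrow> f z) net"
  and tendsto_g: "(F \<longlongrightarrow> z) net \<Longrightarrow> ((\<lambda>k. g (F k)) \<longlongrightarrow> g z) net"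
  using isCont_tendsto_compose[OF continuous_f] isCont_tendsto_compose[OF continuous_g] by blast+

lemma tendsto_g_nth: "(F \<longlongrightarrow> z) net \<Longrightarrow> ((\<lambda>k. g (F k) $ i) \<longlongrightarrow> g z $ i) net"
  by (intro tendsto_vec_nth tendsto_g)

lemma frechet_derivative_g: "frechet_derivative g (at z) = g' z"
  and frechet_derivative_f: "frechet_derivative f (at z) = f' z"
  using frechet_derivative_at[OF g_der] frechet_derivative_at[OF f_der] by simp_all

lemma y_derivative:
  "((\<lambda>y'. f (x, y')) has_derivative (\<lambda>e. f' (x, y) (0, e))) (at y)"
  "((\<lambda>y'. g (x, y')) has_derivative (\<lambda>e. g' (x, y) (0, e))) (at y)"
proof -
  have *: "((\<lambda>y'. (x, y')) has_derivative (\<lambda>e. (0, e))) (at y)"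
    by (auto intro!: derivative_eq_intros)
  show "((\<lambda>y'. f (x, y')) has_derivative (\<lambda>e. f' (x, y) (0, e))) (at y)"
    "((\<lambda>y'. g (x, y')) has_derivative (\<lambda>e. g' (x, y) (0, e))) (at y)"
    using diff_chain_at[OF * f_der] diff_chain_at[OF * g_der] by (simp_all add: o_def)
qed

lemma x_derivative:
  "((\<lambda>x'. f (x', y)) has_derivative (\<lambda>d. f' (x, y) (d, 0))) (at x)"
  "((\<lambda>x'. g (x', y)) has_derivative (\<lambda>d. g' (x, y) (d, 0))) (at x)"
proof -
  have *: "((\<lambda>x'. (x', y)) has_derivative (\<lambda>d. (d, 0))) (at x)"
    by (auto intro!: derivative_eq_intros)
  show "((\<lambda>x'. f (x', y)) has_derivative (\<lambda>d. f' (x, y) (d, 0))) (at x)"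
    "((\<lambda>x'. g (x', y)) has_derivative (\<lambda>d. g' (x, y) (d, 0))) (at x)"
    using diff_chain_at[OF * f_der] diff_chain_at[OF * g_der] by (simp_all add: o_def)
qed

text \<open>Gradients, and below the transposed Jacobians, are handled only through pairings with
  test vectors, which determine them.\<close>

lemma grad_y_g_inner: "v \<bullet> grad_y (\<lambda>z. g z $ i) x y = g' (x, y) (0, v) $ i"
  unfolding grad_y_def
  by (rule gradient_inner) (rule bounded_linear.has_derivative[OF bounded_linear_vec_nth y_derivative(2)])

lemma grad_y_f_inner: "v \<bullet> grad_y f x y = f' (x, y) (0, v)"
  unfolding grad_y_def by (rule gradient_inner) (rule y_derivative)

lemma grad_x_f_inner: "d \<bullet> grad_x f x y = f' (x, y) (d, 0)"
  unfolding grad_x_def by (rule gradient_inner) (rule x_derivative)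

lemma jac_y_inner: "v \<bullet> (transpose (jac_y g x y) *v l) = l \<bullet> g' (x, y) (0, v)"
proof -
  have "jac_y g x y *v v = g' (x, y) (0, v)"
    unfolding jac_y_def jacobian_def frechet_derivative_at[OF y_derivative(2), symmetric]
    using matrix_vector_mul(2)[OF has_derivative_linear[OF y_derivative(2), of x y]] by metis
  then show ?thesis by (metis dot_lmul_matrix inner_commute vector_transpose_matrix transpose_transpose)
qed

lemma jac_x_inner: "d \<bullet> (transpose (jac_x g x y) *v l) = l \<bullet> g' (x, y) (d, 0)"
proof -
  have "jac_x g x y *v d = g' (x, y) (d, 0)"
    unfolding jac_x_def jacobian_def frechet_derivative_at[OF x_derivative(2), symmetric]
    using matrix_vector_mul(2)[OF has_derivative_linear[OF x_derivative(2), of x y]] by metis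
  then show ?thesis by (metis dot_lmul_matrix inner_commute vector_transpose_matrix transpose_transpose)
qed

text \<open>Coordinate \<open>j\<close> of the gradient is the joint derivative at
  \<open>(0, axis j 1)\<close>, so continuity is inherited from \<open>g'\<close>.\<close>

lemma isCont_grad_y_g: "isCont (\<lambda>p. grad_y (\<lambda>z. g z $ i) (fst p) (snd p)) c"
proof -
  have "(\<lambda>p. grad_y (\<lambda>z. g z $ i) (fst p) (snd p)) = (\<lambda>p. \<chi> j. g' p (0, axis j 1) $ i)"
  proof (intro ext, simp add: vec_eq_iff, intro allI)
    fix p j
    show "grad_y (\<lambda>z. g z $ i) (fst p) (snd p) $ j = g' p (0, axis j 1) $ i"
      using grad_y_g_inner[of "axis j 1" i "fst p" "snd p"] by (simp add: inner_axis' )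
  qed
  moreover have "isCont g' c" using g'_cont continuous_on_eq_continuous_at[OF open_UNIV] by blast
  then have "isCont (\<lambda>p. \<chi> j. g' p (0, axis j 1) $ i) c"
    unfolding isCont_def by (intro tendsto_intros)
  ultimately show ?thesis by simp
qed

section \<open>Feasible sets, values and the error bound\<close>

lemma closed_feasible: "closed (feasible g x)"
proof -
  have "isCont (\<lambda>y. g (x, y) $ i) y" for i y
    using has_derivative_continuous[OF y_derivative(2)] unfolding isCont_def by (rule tendsto_vec_nth)
  then have "continuous_on UNIV (\<lambda>y. g (x, y) $ i)" for i
    by (simp add: continuous_at_imp_continuous_on)
  then show ?thesis
    unfolding feasible_def by (intro closed_Collect_all closed_Collect_le continuous_on_const)
qed

lemma value_le: "y \<in> feasible g x \<Longrightarrow> value_fun f g x \<le> ereal (f (x, y))"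
  unfolding value_fun_def by (rule INF_lower)

lemma value_eq: "y \<in> solutions f g x \<Longrightarrow> value_fun f g x = ereal (f (x, y))"
  unfolding value_fun_def solutions_def
  by (intro antisym INF_lower INF_greatest) auto

text \<open>The projection \<open>z'\<close> of \<open>z\<close> is approached by minimisers \<open>w\<close> of the distance plus a quadratic
  penalty. At \<open>w\<close> the residual \<open>c = z + z' - 2w\<close> is a combination of constraint gradients, whose
  coefficients can be chosen of size \<open>O(|c|)\<close>; pairing \<open>c\<close> with \<open>z - w\<close> gives the bound in the limit.
  No constraint qualification at \<open>z'\<close> is needed.\<close>

lemma error_bound:
  assumes rcr: "RCR_regular g a b" and J: "J \<subseteq> active g a b"
  obtains \<kappa> \<epsilon> where "\<kappa> > 0" "\<epsilon> > 0"
    "\<And>x y z. x \<in> ball a \<epsilon> \<Longrightarrow> y \<in> ball b \<epsilon> \<Longrightarrow> z \<in> ball b \<epsilon> \<Longrightarrow>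
       y \<in> feasible g x \<Longrightarrow> (\<And>i. i \<in> J \<Longrightarrow> g (x, y) $ i = 0) \<Longrightarrow>
       \<exists>z'\<in>feasible g x. (\<forall>i\<in>J. g (x, z') $ i = 0) \<and>
         norm (z' - z) \<le> \<kappa> * ((\<Sum>i\<in>UNIV. max 0 (g (x, z) $ i)) + (\<Sum>i\<in>J. \<bar>g (x, z) $ i\<bar>))"
proof -
  define I where "I = active g a b"
  define A where "A p i = grad_y (\<lambda>z. g z $ i) (fst p) (snd p)" for p i
  have A_inner: "A (x, w) i \<bullet> v = g' (x, w) (0, v) $ i" for x w v i
    using grad_y_g_inner[of v i x w] by (simp add: A_def inner_commute)
  obtain \<delta> where "\<delta> > 0" and \<delta>: "\<forall>K. K \<subseteq> I \<longrightarrow> (\<exists>r. \<forall>p\<in>ball (a, b) \<delta>. dim (A p ` K) = r)"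
    using rcr by (auto simp: RCR_regular_def I_def A_def case_prod_beta)
  have contA: "isCont (\<lambda>p. A p i) (a, b)" for i unfolding A_def by (rule isCont_grad_y_g)
  obtain M \<epsilon>1 where "M > 0" "\<epsilon>1 > 0" and rep:
    "\<forall>p\<in>ball (a, b) \<epsilon>1. \<forall>l. (\<forall>i. i \<notin> I \<longrightarrow> l $ i = 0) \<longrightarrow>
       (\<exists>l'::real^'p. (\<forall>i. 0 \<le> l $ i * l' $ i) \<and> (\<forall>i. l $ i = 0 \<longrightarrow> l' $ i = 0) \<and>
         (\<Sum>i\<in>UNIV. (l' $ i) *\<^sub>R A p i) = (\<Sum>i\<in>UNIV. (l $ i) *\<^sub>R A p i) \<and>
         norm l' \<le> M * norm (\<Sum>i\<in>UNIV. (l $ i) *\<^sub>R A p i))"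
    by (rule bounded_multipliers_constant_rank[where A=A, OF contA \<open>\<delta> > 0\<close> \<delta>]) (rule that)
  \<comment> \<open>With this tolerance the linearisation error costs at most half of
    \<open>norm (z - z')\<close> and can be absorbed on the left, which gives the final constant
    \<open>2 * M\<close>.\<close>
  define \<theta> where "\<theta> = 1 / (2 * M)"
  have "\<theta> > 0" using \<open>M > 0\<close> by (simp add: \<theta>_def)
  obtain \<epsilon>2 where "\<epsilon>2 > 0" and strict: "\<And>p q r. p \<in> ball (a, b) \<epsilon>2 \<Longrightarrow> q \<in> ball (a, b) \<epsilon>2 \<Longrightarrow>
      r \<in> ball (a, b) \<epsilon>2 \<Longrightarrow> norm (g p - g q - g' r (p - q)) \<le> \<theta> * norm (p - q)"
    by (rule C1_strict_derivative[OF g_der g'_cont \<open>\<theta> > 0\<close>]) (rule that)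
  \<comment> \<open>Constraints inactive at \<open>(a, b)\<close> stay strictly negative nearby, so
    the penalty need only involve those in \<open>I\<close>, where the rank condition is
    available.\<close>
  have "\<forall>i\<in>- I. \<forall>\<^sub>F p in nhds (a, b). g p $ i < 0"
  proof
    fix i assume "i \<in> - I"
    then have "g (a, b) $ i < 0"
      using rcr by (auto simp: RCR_regular_def feasible_def I_def active_def less_le)
    then show "\<forall>\<^sub>F p in nhds (a, b). g p $ i < 0"
      by (intro order_tendstoD(2)[OF tendsto_g_nth[OF filterlim_ident]])
  qed
  then have "\<forall>\<^sub>F p in nhds (a, b). \<forall>i\<in>- I. g p $ i < 0" by (simp add: eventually_ball_finite)
  then obtain \<epsilon>3 where "\<epsilon>3 > 0" and inactive: "\<And>p i. dist p (a, b) < \<epsilon>3 \<Longrightarrow> i \<notin> I \<Longrightarrow> g p $ i < 0"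
    by (auto simp: eventually_nhds_metric)
  define \<epsilon>0 where "\<epsilon>0 = Min {\<epsilon>1, \<epsilon>2, \<epsilon>3}"
  have "\<epsilon>0 > 0" "\<epsilon>0 \<le> \<epsilon>1" "\<epsilon>0 \<le> \<epsilon>2" "\<epsilon>0 \<le> \<epsilon>3"
    using \<open>\<epsilon>1 > 0\<close> \<open>\<epsilon>2 > 0\<close> \<open>\<epsilon>3 > 0\<close> by (auto simp: \<epsilon>0_def)
  \<comment> \<open>The projection \<open>z'\<close> will lie within three of these radii of
    \<open>b\<close>, the points of its ball within four, and the parameter adds the fifth.\<close>
  define \<epsilon> where "\<epsilon> = \<epsilon>0 / 5"
  have "\<epsilon> > 0" using \<open>\<epsilon>0 > 0\<close> by (simp add: \<epsilon>_def)
  have near: "(x, w) \<in> ball (a, b) \<epsilon>0" if "x \<in> ball a \<epsilon>" "dist b w \<le> 4 * \<epsilon>" for x w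
  proof -
    have "dist (a, b) (x, w) \<le> dist a x + dist b w"
      by (simp add: dist_Pair_Pair sqrt_sum_squares_le_sum)
    then show ?thesis using that by (simp add: \<epsilon>_def)
  qed
  show thesis
  proof (rule that)
    show "2 * M > 0" using \<open>M > 0\<close> by simp
    show "\<epsilon> > 0" by fact
    fix x y z assume x: "x \<in> ball a \<epsilon>" and y: "y \<in> ball b \<epsilon>" and z: "z \<in> ball b \<epsilon>"
      and yf: "y \<in> feasible g x" "\<And>i. i \<in> J \<Longrightarrow> g (x, y) $ i = 0"
    define R where "R = (\<Sum>i\<in>UNIV. max 0 (g (x, z) $ i)) + (\<Sum>i\<in>J. \<bar>g (x, z) $ i\<bar>)"
    define C where "C = {w \<in> feasible g x. \<forall>i\<in>J. g (x, w) $ i = 0}"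
    have cont_g: "continuous_on S (\<lambda>w. g (x, w) $ i)" for S i
      using has_derivative_continuous[OF y_derivative(2)]
      by (intro continuous_at_imp_continuous_on ballI) (auto simp: isCont_def intro: tendsto_vec_nth)
    have "C = feasible g x \<inter> (\<Inter>i\<in>J. {w. g (x, w) $ i = 0})" by (auto simp: C_def)
    then have "closed C"
      by (auto intro!: closed_Int closed_INT closed_feasible closed_Collect_eq cont_g continuous_on_const)
    have "y \<in> C" using yf by (simp add: C_def)
    \<comment> \<open>The point \<open>y\<close> shows that \<open>C\<close> is nonempty; since
      \<open>z'\<close> is no farther from \<open>z\<close> than \<open>y\<close> is, it stays near
      \<open>b\<close>.\<close>
    define z' where "z' = closest_point C z"
    have z'C: "z' \<in> C" and nearest: "\<And>w. w \<in> C \<Longrightarrow> dist z z' \<le> dist z w"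
      using \<open>closed C\<close> \<open>y \<in> C\<close> closest_point_in_set[of C z] closest_point_le[of C _ z]
      by (auto simp: z'_def)
    have z'b: "dist b z' < 3 * \<epsilon>"
      using nearest[OF \<open>y \<in> C\<close>] y z dist_triangle[of b z' z] dist_triangle[of z y b]
      by (simp add: dist_commute)
    \<comment> \<open>Residuals: signed for the equality constraints in \<open>J\<close>, positive
      parts for the others.\<close>
    define c where "c w i = (if i \<in> J then g (x, w) $ i else max 0 (g (x, w) $ i))" for w i
    define P where "P w = (\<Sum>i\<in>I. (c w i)\<^sup>2)" for w
    have wnear: "(x, w) \<in> ball (a, b) \<epsilon>0" if "w \<in> cball z' \<epsilon>" for w
      using near[OF x, of w] that z'b dist_triangle[of b w z'] by simp
    have P0: "w \<in> C" if "w \<in> cball z' \<epsilon>" "P w = 0" for w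
    proof -
      have "c w i = 0" if "i \<in> I" for i
        using \<open>P w = 0\<close> that by (simp add: P_def sum_nonneg_eq_0_iff)
      moreover have "g (x, w) $ i < 0" if "i \<notin> I" for i
        using inactive[OF _ that] wnear[OF \<open>w \<in> cball z' \<epsilon>\<close>] \<open>\<epsilon>0 \<le> \<epsilon>3\<close> by (simp add: dist_commute)
      ultimately have "g (x, w) $ i \<le> 0 \<and> (i \<in> J \<longrightarrow> g (x, w) $ i = 0)" for i
        using J by (cases "i \<in> I") (fastforce simp: c_def I_def max_def split: if_splits)+
      then show ?thesis by (simp add: C_def feasible_def)
    qed
    have "c z' i = 0" for i using z'C by (simp add: c_def C_def feasible_def)
    then have "P z' = 0" by (simp add: P_def)
    have P_nonneg: "0 \<le> P w" for w by (simp add: P_def sum_nonneg)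
    have P_nearest: "\<forall>w\<in>cball z' \<epsilon>. P w = 0 \<longrightarrow> dist z z' \<le> dist z w" using nearest P0 by blast
    have P_cont: "continuous_on (cball z' \<epsilon>) P"
    proof -
      have "continuous_on (cball z' \<epsilon>) (\<lambda>w. c w i)" for i
        unfolding c_def by (cases "i \<in> J") (auto intro!: continuous_intros cont_g)
      then show ?thesis unfolding P_def by (intro continuous_intros)
    qed
    obtain w s where w: "w \<longlonglongrightarrow> z'" "\<And>n::nat. w n \<in> ball z' \<epsilon>" "\<And>n. (0::real) \<le> s n"
      "\<And>n v. v \<in> ball z' \<epsilon> \<Longrightarrow>
       (w n - z) \<bullet> (w n - z) + (w n - z') \<bullet> (w n - z') + s n * P (w n)
       \<le> (v - z) \<bullet> (v - z) + (v - z') \<bullet> (v - z') + s n * P v"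
      by (rule penalty_minimizers_tendsto[OF P_cont \<open>\<epsilon> > 0\<close> P_nonneg \<open>P z' = 0\<close> P_nearest]) (rule that)
    have step: "(z + z' - 2 *\<^sub>R w n) \<bullet> (z - w n)
        \<le> M * norm (z + z' - 2 *\<^sub>R w n) * (R + \<theta> * norm (z - w n))" for n
    proof -
      \<comment> \<open>Half the derivative of the penalty \<open>s n * P\<close> has these
        coefficients on the constraint gradients; stationarity of \<open>w n\<close> equates that
        combination with \<open>z + z' - 2 *\<^sub>R w n\<close>.\<close>
      define l :: "real^'p" where "l = (\<chi> i. if i \<in> I then s n * c (w n) i else 0)"
      have P_der: "(P has_derivative (\<lambda>d. \<Sum>i\<in>I. 2 * c (w n) i * g' (x, w n) (0, d) $ i)) (at (w n))"
        unfolding P_def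
      proof (rule has_derivative_sum)
        fix i
        have gi: "((\<lambda>w. g (x, w) $ i) has_derivative (\<lambda>d. g' (x, w n) (0, d) $ i)) (at (w n))"
          by (rule bounded_linear.has_derivative[OF bounded_linear_vec_nth y_derivative(2)])
        show "((\<lambda>w. (c w i)\<^sup>2) has_derivative (\<lambda>d. 2 * c (w n) i * g' (x, w n) (0, d) $ i)) (at (w n))"
        proof (cases "i \<in> J")
          case True
          then show ?thesis
            unfolding c_def by (auto intro!: derivative_eq_intros gi)
        next
          case False
          then show ?thesis using has_derivative_max0_power2[OF gi] by (simp add: c_def)
        qed
      qed
      have "(\<lambda>d. 2 * ((w n - z) \<bullet> d) + 2 * ((w n - z') \<bullet> d)
           + s n * (\<Sum>i\<in>I. 2 * c (w n) i * g' (x, w n) (0, d) $ i)) = (\<lambda>d. 0)"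
      proof (rule differential_zero_maxmin[OF w(2)[of n] open_ball])
        show "((\<lambda>v. (v - z) \<bullet> (v - z) + (v - z') \<bullet> (v - z') + s n * P v) has_derivative
            (\<lambda>d. 2 * ((w n - z) \<bullet> d) + 2 * ((w n - z') \<bullet> d)
           + s n * (\<Sum>i\<in>I. 2 * c (w n) i * g' (x, w n) (0, d) $ i))) (at (w n))"
          by (auto intro!: derivative_eq_intros P_der simp: inner_commute)
      qed (use w(4) in blast)
      then have zero: "2 * ((w n - z) \<bullet> d) + 2 * ((w n - z') \<bullet> d)
           + s n * (\<Sum>i\<in>I. 2 * c (w n) i * g' (x, w n) (0, d) $ i) = 0" for d by metis
      have lA: "(\<Sum>i\<in>UNIV. (l $ i) *\<^sub>R A (x, w n) i) \<bullet> d = l \<bullet> g' (x, w n) (0, d)" for l :: "real^'p" and d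
        unfolding inner_sum_left by (subst (2) inner_vec_def) (simp add: A_inner)
      have "(z + z' - 2 *\<^sub>R w n) \<bullet> d = (\<Sum>i\<in>UNIV. (l $ i) *\<^sub>R A (x, w n) i) \<bullet> d" for d
      proof -
        have "l \<bullet> g' (x, w n) (0, d) = (\<Sum>i\<in>I. l $ i * g' (x, w n) (0, d) $ i)"
          unfolding inner_vec_def by (rule sum.mono_neutral_cong_right) (auto simp: l_def)
        also have "\<dots> = s n * (\<Sum>i\<in>I. c (w n) i * g' (x, w n) (0, d) $ i)"
          by (simp add: l_def sum_distrib_left mult.assoc)
        finally have "2 * (l \<bullet> g' (x, w n) (0, d)) = s n * (\<Sum>i\<in>I. 2 * c (w n) i * g' (x, w n) (0, d) $ i)"
          by (simp add: sum_distrib_left mult_ac)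
        moreover have "(z + z' - 2 *\<^sub>R w n) \<bullet> d = - ((w n - z) \<bullet> d + (w n - z') \<bullet> d)"
          by (simp add: inner_diff_left inner_add_left)
        ultimately show ?thesis using zero[of d] unfolding lA by linarith
      qed
      then have eq: "z + z' - 2 *\<^sub>R w n = (\<Sum>i\<in>UNIV. (l $ i) *\<^sub>R A (x, w n) i)"
        by (metis vector_eq_rdot)
      have wn: "(x, w n) \<in> ball (a, b) \<epsilon>0" using wnear w(2)[of n] by simp
      have zn: "(x, z) \<in> ball (a, b) \<epsilon>0" using near[OF x, of z] z \<open>\<epsilon> > 0\<close> by simp
      have "(x, w n) \<in> ball (a, b) \<epsilon>1" using wn \<open>\<epsilon>0 \<le> \<epsilon>1\<close> by simp
      from rep[rule_format, OF this, of l] obtain l' :: "real^'p" where l': "\<And>i. 0 \<le> l $ i * l' $ i"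
        "\<And>i. l $ i = 0 \<Longrightarrow> l' $ i = 0"
        "(\<Sum>i\<in>UNIV. (l' $ i) *\<^sub>R A (x, w n) i) = (\<Sum>i\<in>UNIV. (l $ i) *\<^sub>R A (x, w n) i)"
        "norm l' \<le> M * norm (\<Sum>i\<in>UNIV. (l $ i) *\<^sub>R A (x, w n) i)"
        by (auto simp: l_def)
      \<comment> \<open>Where \<open>l'\<close> is nonzero, the constraint value equals its
        residual, whose sign \<open>l\<close> and hence \<open>l'\<close> share.\<close>
      have gw: "0 \<le> l' \<bullet> g (x, w n)"
        unfolding inner_vec_def
      proof (rule sum_nonneg)
        fix i
        show "0 \<le> l' $ i \<bullet> g (x, w n) $ i"
        proof (cases "l' $ i = 0")
          case False
          then have "l $ i \<noteq> 0" using l'(2) by blast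
          then have li: "l $ i = s n * c (w n) i" and "s n > 0" and "c (w n) i \<noteq> 0"
            using w(3)[of n] by (auto simp: l_def less_le split: if_splits)
          then have "0 \<le> c (w n) i * l' $ i"
            using l'(1)[of i] by (simp add: mult.assoc zero_le_mult_iff)
          moreover have "g (x, w n) $ i = c (w n) i"
            using \<open>c (w n) i \<noteq> 0\<close> by (auto simp: c_def max_def split: if_splits)
          ultimately show ?thesis by (simp add: mult.commute)
        qed simp
      qed
      \<comment> \<open>Outside \<open>J\<close> the residuals are positive parts, so
        \<open>l'\<close> is nonnegative there and only violations count; on \<open>J\<close>
        absolute values are counted.\<close>
      have gz: "l' \<bullet> g (x, z) \<le> norm l' * R"
      proof -
        have "l' $ i * g (x, z) $ i \<le> norm l' * (max 0 (g (x, z) $ i) + (if i \<in> J then \<bar>g (x, z) $ i\<bar> else 0))" for i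
        proof -
          have li: "\<bar>l' $ i\<bar> \<le> norm l'" by (rule component_le_norm_cart)
          show ?thesis
          proof (cases "i \<in> J")
            case True
            have "l' $ i * g (x, z) $ i \<le> \<bar>l' $ i\<bar> * \<bar>g (x, z) $ i\<bar>" by (simp add: abs_mult[symmetric])
            also have "\<dots> \<le> norm l' * (max 0 (g (x, z) $ i) + \<bar>g (x, z) $ i\<bar>)"
              using li by (intro mult_mono) auto
            finally show ?thesis using True by simp
          next
            case False
            have "0 \<le> l' $ i"
            proof (cases "l $ i = 0")
              case False
              then have "l $ i > 0"
                using \<open>i \<notin> J\<close> w(3)[of n] by (auto simp: l_def c_def less_le split: if_splits)
              then show ?thesis using l'(1)[of i] by (simp add: zero_le_mult_iff)
            qed (use l'(2) in simp)
            then have "l' $ i * g (x, z) $ i \<le> l' $ i * max 0 (g (x, z) $ i)"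
              by (intro mult_left_mono) auto
            also have "\<dots> \<le> norm l' * max 0 (g (x, z) $ i)"
              using li by (intro mult_right_mono) auto
            finally show ?thesis using False by simp
          qed
        qed
        then have "l' \<bullet> g (x, z) \<le> (\<Sum>i\<in>UNIV. norm l' * (max 0 (g (x, z) $ i) + (if i \<in> J then \<bar>g (x, z) $ i\<bar> else 0)))"
          unfolding inner_vec_def by (intro sum_mono) simp
        also have "\<dots> = norm l' * R"
          by (simp add: R_def sum_distrib_left[symmetric] sum.distrib sum.If_cases)
        finally show ?thesis .
      qed
      have "norm (g (x, z) - g (x, w n) - g' (x, w n) ((x, z) - (x, w n))) \<le> \<theta> * norm ((x, z) - (x, w n))"
        using wn zn \<open>\<epsilon>0 \<le> \<epsilon>2\<close> by (intro strict) auto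
      then have st: "norm (g (x, z) - g (x, w n) - g' (x, w n) (0, z - w n)) \<le> \<theta> * norm (z - w n)"
        by (simp add: norm_Pair)
      have "(z + z' - 2 *\<^sub>R w n) \<bullet> (z - w n) = l' \<bullet> g' (x, w n) (0, z - w n)"
        unfolding eq l'(3)[symmetric] by (rule lA)
      also have "\<dots> = l' \<bullet> g (x, z) - l' \<bullet> g (x, w n) - l' \<bullet> (g (x, z) - g (x, w n) - g' (x, w n) (0, z - w n))"
        by (simp add: inner_diff_right)
      also have "\<dots> \<le> norm l' * R + norm l' * (\<theta> * norm (z - w n))"
      proof -
        have "\<bar>l' \<bullet> (g (x, z) - g (x, w n) - g' (x, w n) (0, z - w n))\<bar> \<le> norm l' * (\<theta> * norm (z - w n))"
          by (rule order_trans[OF Cauchy_Schwarz_ineq2]) (intro mult_left_mono st norm_ge_zero)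
        then show ?thesis using gw gz by linarith
      qed
      also have "\<dots> = norm l' * (R + \<theta> * norm (z - w n))" by (simp add: algebra_simps)
      also have "\<dots> \<le> M * norm (z + z' - 2 *\<^sub>R w n) * (R + \<theta> * norm (z - w n))"
        using l'(4) \<open>\<theta> > 0\<close> unfolding eq
        by (intro mult_right_mono add_nonneg_nonneg) (auto simp: R_def sum_nonneg)
      finally show ?thesis by simp
    qed
    \<comment> \<open>In the limit \<open>w n\<close> becomes \<open>z'\<close>, the residual vector
      becomes \<open>z - z'\<close>, and the left-hand side the squared distance; one factor then
      cancels.\<close>
    have "(\<lambda>n. (z + z' - 2 *\<^sub>R w n) \<bullet> (z - w n)) \<longlonglongrightarrow> (z + z' - 2 *\<^sub>R z') \<bullet> (z - z')"
      by (intro tendsto_intros w(1))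
    moreover have "(\<lambda>n. M * norm (z + z' - 2 *\<^sub>R w n) * (R + \<theta> * norm (z - w n)))
        \<longlonglongrightarrow> M * norm (z + z' - 2 *\<^sub>R z') * (R + \<theta> * norm (z - z'))"
      by (intro tendsto_intros w(1))
    ultimately have "(z + z' - 2 *\<^sub>R z') \<bullet> (z - z') \<le> M * norm (z + z' - 2 *\<^sub>R z') * (R + \<theta> * norm (z - z'))"
      by (rule LIMSEQ_le) (use step in simp)
    moreover have "z + z' - 2 *\<^sub>R z' = z - z'" by (simp add: scaleR_2)
    ultimately have "norm (z - z') * norm (z - z') \<le> norm (z - z') * (M * (R + \<theta> * norm (z - z')))"
      by (simp add: norm_eq_sqrt_inner mult_ac)
    moreover have "R \<ge> 0" by (simp add: R_def sum_nonneg)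
    ultimately have "norm (z - z') \<le> M * (R + \<theta> * norm (z - z'))"
      using \<open>M > 0\<close> \<open>\<theta> > 0\<close> by (cases "z = z'") simp_all
    then have "norm (z' - z) \<le> 2 * M * R"
      using \<open>M > 0\<close> by (simp add: \<theta>_def algebra_simps norm_minus_commute)
    then show "\<exists>z'\<in>feasible g x. (\<forall>i\<in>J. g (x, z') $ i = 0) \<and>
         norm (z' - z) \<le> 2 * M * ((\<Sum>i\<in>UNIV. max 0 (g (x, z) $ i)) + (\<Sum>i\<in>J. \<bar>g (x, z) $ i\<bar>))"
      using z'C by (auto simp: C_def R_def)
  qed
qed

section \<open>Stability and multipliers of perturbed problems\<close>

text \<open>The form of stability that both hypotheses, Robinson stability and inner semicontinuity
  with constant rank, lead to. Asking for a point \<open>z\<close> builds in that the perturbed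
  feasible sets are nonempty.\<close>

definition dir_stable :: "real^'n \<Rightarrow> real^'m \<Rightarrow> real^'n \<Rightarrow> bool" where
  "dir_stable a b u \<longleftrightarrow> (\<exists>\<kappa>>0. \<exists>\<eta>>0. \<exists>\<epsilon>>0. \<forall>d\<in>cone_nbhd \<eta> u. \<forall>y\<in>ball b \<epsilon>.
     \<exists>z\<in>feasible g (a + d). norm (z - y) \<le> \<kappa> * (\<Sum>i\<in>UNIV. max 0 (g (a + d, y) $ i)))"

text \<open>Closedness of the feasible set lets the distance be attained, and the Euclidean norm of
  the violation is at most its sum.\<close>

lemma Robinson_stable_imp_dir_stable:
  assumes "Robinson_stable g a b u"
  shows "dir_stable a b u"
proof -
  obtain \<kappa> \<epsilon> \<delta> where pos: "\<kappa> > 0" "\<epsilon> > 0" "\<delta> > 0" and rs: "\<And>x y. x - a \<in> dir_nbhd \<epsilon> \<delta> u \<Longrightarrow> y \<in> ball b \<epsilon> \<Longrightarrow>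
        feasible g x \<noteq> {} \<and> infdist y (feasible g x) \<le> \<kappa> * norm (\<chi> i. max 0 (g (x, y) $ i))"
    using assms by (auto simp: Robinson_stable_def)
  have "\<exists>k. t k *\<^sub>R w k \<in> dir_nbhd \<epsilon> \<delta> u"
    if "\<And>k. t k > 0" "t \<longlonglongrightarrow> 0" "w \<longlonglongrightarrow> u" for t :: "nat \<Rightarrow> real" and w
    using eventually_happens'[OF sequentially_bot eventually_in_dir_nbhd[OF that pos(2,3)]] .
  then obtain \<eta> where \<eta>: "\<eta> > 0" "\<And>z. z \<in> cone_nbhd \<eta> u \<Longrightarrow> z \<in> dir_nbhd \<epsilon> \<delta> u"
    using cone_nbhd_sequentially[where P = "\<lambda>z. z \<in> dir_nbhd \<epsilon> \<delta> u"] by blast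
  have "\<exists>z\<in>feasible g (a + d). norm (z - y) \<le> \<kappa> * (\<Sum>i\<in>UNIV. max 0 (g (a + d, y) $ i))"
    if "d \<in> cone_nbhd \<eta> u" "y \<in> ball b \<epsilon>" for d y
  proof -
    have *: "feasible g (a + d) \<noteq> {}"
      "infdist y (feasible g (a + d)) \<le> \<kappa> * norm (\<chi> i. max 0 (g (a + d, y) $ i))"
      using rs[of "a + d" y] \<eta>(2) that by auto
    obtain z where z: "z \<in> feasible g (a + d)" "infdist y (feasible g (a + d)) = dist y z"
      using infdist_attains_inf[OF closed_feasible *(1)] by metis
    have "norm (\<chi> i. max 0 (g (a + d, y) $ i)) \<le> (\<Sum>i\<in>UNIV. max 0 (g (a + d, y) $ i))"
      by (rule order_trans[OF norm_le_l1_cart]) simp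
    then have "\<kappa> * norm (\<chi> i. max 0 (g (a + d, y) $ i)) \<le> \<kappa> * (\<Sum>i\<in>UNIV. max 0 (g (a + d, y) $ i))"
      using pos(1) by simp
    then show ?thesis using z * by (intro bexI[of _ z]) (simp_all add: dist_norm norm_minus_commute)
  qed
  then show ?thesis unfolding dir_stable_def using pos \<eta>(1) by blast
qed

text \<open>Inner semicontinuity supplies feasible points near \<open>b\<close> at all parameters in
  some cone neighbourhood. That is the solvability asked for in \<open>error_bound\<close>, applied
  with no equality constraints.\<close>

lemma dir_inner_semicont_imp_dir_stable:
  assumes isc: "dir_inner_semicont f g a b u" and rcr: "RCR_regular g a b"
  shows "dir_stable a b u"
proof -
  obtain \<kappa> \<epsilon> where pos: "\<kappa> > 0" "\<epsilon> > 0"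
    and eb: "\<And>x y z. x \<in> ball a \<epsilon> \<Longrightarrow> y \<in> ball b \<epsilon> \<Longrightarrow> z \<in> ball b \<epsilon> \<Longrightarrow>
       y \<in> feasible g x \<Longrightarrow> (\<And>i. i \<in> {} \<Longrightarrow> g (x, y) $ i = 0) \<Longrightarrow>
       \<exists>z'\<in>feasible g x. (\<forall>i\<in>{}. g (x, z') $ i = 0) \<and>
         norm (z' - z) \<le> \<kappa> * ((\<Sum>i\<in>UNIV. max 0 (g (x, z) $ i)) + (\<Sum>i\<in>{}. \<bar>g (x, z) $ i\<bar>))"
    using error_bound[OF rcr empty_subsetI] by blast
  have "\<exists>k. a + t k *\<^sub>R w k \<in> ball a \<epsilon> \<and> (\<exists>y\<in>feasible g (a + t k *\<^sub>R w k). y \<in> ball b \<epsilon>)"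
    if tw: "\<And>k. t k > 0" "t \<longlonglongrightarrow> 0" "w \<longlonglongrightarrow> u" for t :: "nat \<Rightarrow> real" and w
  proof -
    obtain y where y: "\<forall>\<^sub>F k in sequentially. y k \<in> solutions f g (a + t k *\<^sub>R w k)" "y \<longlonglongrightarrow> b"
      using isc tw unfolding dir_inner_semicont_def by blast
    have "(\<lambda>k. a + t k *\<^sub>R w k) \<longlonglongrightarrow> a + 0 *\<^sub>R u" by (intro tendsto_intros tw)
    then have "\<forall>\<^sub>F k in sequentially. dist (a + t k *\<^sub>R w k) a < \<epsilon>"
      using tendstoD[OF _ pos(2)] by fastforce
    with y(1) tendstoD[OF y(2) pos(2)]
    have "\<forall>\<^sub>F k in sequentially. a + t k *\<^sub>R w k \<in> ball a \<epsilon> \<and> (\<exists>y\<in>feasible g (a + t k *\<^sub>R w k). y \<in> ball b \<epsilon>)"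
      by eventually_elim (auto simp: dist_commute solutions_def)
    then show ?thesis by (rule eventually_happens'[OF sequentially_bot])
  qed
  then obtain \<eta> where \<eta>: "\<eta> > 0"
    "\<And>d. d \<in> cone_nbhd \<eta> u \<Longrightarrow> a + d \<in> ball a \<epsilon> \<and> (\<exists>y\<in>feasible g (a + d). y \<in> ball b \<epsilon>)"
    using cone_nbhd_sequentially[where P = "\<lambda>d. a + d \<in> ball a \<epsilon> \<and> (\<exists>y\<in>feasible g (a + d). y \<in> ball b \<epsilon>)"] by blast
  have "\<exists>z\<in>feasible g (a + d). norm (z - y) \<le> \<kappa> * (\<Sum>i\<in>UNIV. max 0 (g (a + d, y) $ i))"
    if d: "d \<in> cone_nbhd \<eta> u" and y: "y \<in> ball b \<epsilon>" for d y
  proof -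
    obtain y0 where "y0 \<in> feasible g (a + d)" "y0 \<in> ball b \<epsilon>" using \<eta>(2)[OF d] by blast
    with eb[of "a + d" y0 y] \<eta>(2)[OF d] y show ?thesis by auto
  qed
  then show ?thesis unfolding dir_stable_def using pos \<eta>(1) by blast
qed

text \<open>Stability makes \<open>f + M \<Sum> max 0 g\<^sub>i\<close> an exact penalty function; the inequality below is its first-order
  condition. The constant \<open>M\<close>, which later bounds the multipliers, is uniform near \<open>(a, b)\<close>.\<close>

lemma exact_penalty_inequality:
  assumes "dir_stable a b u"
  obtains M \<eta> \<epsilon> where "M > 0" "\<eta> > 0" "\<epsilon> > 0"
    "\<And>x y d e \<rho>. x - a \<in> cone_nbhd \<eta> u \<Longrightarrow> y \<in> ball b \<epsilon> \<Longrightarrow> y \<in> solutions f g x \<Longrightarrow>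
      (\<And>\<theta>. \<theta> > 0 \<Longrightarrow> \<forall>\<^sub>F s in at_right 0. value_fun f g x + ereal (s * (\<rho> - \<theta>)) \<le> value_fun f g (x + s *\<^sub>R d)) \<Longrightarrow>
      \<rho> \<le> f' (x, y) (d, e) + M * (\<Sum>i\<in>active g x y. max 0 (g' (x, y) (d, e) $ i))"
proof -
  obtain \<kappa> \<eta>1 \<epsilon>1 where pos1: "\<kappa> > 0" "\<eta>1 > 0" "\<epsilon>1 > 0" and rs: "\<And>d y. d \<in> cone_nbhd \<eta>1 u \<Longrightarrow> y \<in> ball b \<epsilon>1 \<Longrightarrow>
     \<exists>z\<in>feasible g (a + d). norm (z - y) \<le> \<kappa> * (\<Sum>i\<in>UNIV. max 0 (g (a + d, y) $ i))"
    using assms by (auto simp: dir_stable_def)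
  obtain L \<epsilon>2 where pos2: "L > 0" "\<epsilon>2 > 0" and lip:
    "\<And>p q. p \<in> ball (a, b) \<epsilon>2 \<Longrightarrow> q \<in> ball (a, b) \<epsilon>2 \<Longrightarrow> norm (f p - f q) \<le> L * norm (p - q)"
    by (rule C1_locally_lipschitz[OF f_der f'_cont]) (rule that)
  \<comment> \<open>The cone is shrunk so that the parameter uses up at most half of the radius on
    which \<open>f\<close> is Lipschitz; the other half is left for \<open>y\<close>.\<close>
  have "\<exists>k. t k *\<^sub>R w k \<in> ball 0 (\<epsilon>2 / 2)"
    if tw: "\<And>k. t k > 0" "t \<longlonglongrightarrow> 0" "w \<longlonglongrightarrow> u" for t :: "nat \<Rightarrow> real" and w
  proof -
    have "(\<lambda>k. t k *\<^sub>R w k) \<longlonglongrightarrow> 0 *\<^sub>R u" by (intro tendsto_intros tw)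
    then have "\<forall>\<^sub>F k in sequentially. dist (t k *\<^sub>R w k) (0 *\<^sub>R u) < \<epsilon>2 / 2"
      by (rule tendstoD) (use pos2 in simp)
    then have "\<forall>\<^sub>F k in sequentially. t k *\<^sub>R w k \<in> ball 0 (\<epsilon>2 / 2)" by simp
    then show ?thesis by (rule eventually_happens'[OF sequentially_bot])
  qed
  then obtain \<eta>2 where \<eta>2: "\<eta>2 > 0" "\<And>z. z \<in> cone_nbhd \<eta>2 u \<Longrightarrow> z \<in> ball 0 (\<epsilon>2 / 2)"
    using cone_nbhd_sequentially[where P = "\<lambda>z. z \<in> ball 0 (\<epsilon>2 / 2)"] by blast
  define \<eta> where "\<eta> = min \<eta>1 \<eta>2"
  define \<epsilon> where "\<epsilon> = min \<epsilon>1 (\<epsilon>2 / 2)"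
  \<comment> \<open>Repairing infeasibility moves a point by at most \<open>\<kappa>\<close> times
    the violation, which changes \<open>f\<close> by at most \<open>L\<close> times that
    distance.\<close>
  show thesis
  proof (rule that[of "L * \<kappa>" \<eta> \<epsilon>])
    show "L * \<kappa> > 0" "\<eta> > 0" "\<epsilon> > 0" using pos1 pos2 \<eta>2(1) by (simp_all add: \<eta>_def \<epsilon>_def)
    fix x d :: "real^'n" and y e :: "real^'m" and \<rho> :: real
    assume x: "x - a \<in> cone_nbhd \<eta> u" and y: "y \<in> ball b \<epsilon>" and sol: "y \<in> solutions f g x"
      and V: "\<And>\<theta>. \<theta> > 0 \<Longrightarrow> \<forall>\<^sub>F s in at_right 0.
          value_fun f g x + ereal (s * (\<rho> - \<theta>)) \<le> value_fun f g (x + s *\<^sub>R d)"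
    have yF: "g (x, y) $ i \<le> 0" for i using sol by (auto simp: solutions_def feasible_def)
    define s where "s n = inverse (real (Suc n))" for n
    have s: "s n > 0" "s \<longlonglongrightarrow> 0" for n
      using LIMSEQ_inverse_real_of_nat unfolding s_def by simp_all
    have s_right: "filterlim s (at_right 0) sequentially"
      using s by (simp add: filterlim_at order.strict_implies_not_eq[symmetric])
    define X where "X n = x + s n *\<^sub>R d" for n
    define Y where "Y n = y + s n *\<^sub>R e" for n
    have XY: "(X n, Y n) = (x, y) + s n *\<^sub>R (d, e)" for n by (simp add: X_def Y_def)
    have Xlim: "X \<longlonglongrightarrow> x" unfolding X_def
      using tendsto_add[OF tendsto_const tendsto_scaleR[OF s(2) tendsto_const], of x d] by simp
    have Ylim: "Y \<longlonglongrightarrow> y" unfolding Y_def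
      using tendsto_add[OF tendsto_const tendsto_scaleR[OF s(2) tendsto_const], of y e] by simp
    have gi: "(\<lambda>n. g (X n, Y n) $ i) \<longlonglongrightarrow> g (x, y) $ i" for i
      by (intro tendsto_g_nth tendsto_Pair Xlim Ylim)
    define R where "R n = (\<Sum>i\<in>UNIV. max 0 (g (X n, Y n) $ i))" for n
    have "R \<longlonglongrightarrow> (\<Sum>i\<in>UNIV. max 0 (g (x, y) $ i))"
      unfolding R_def by (intro tendsto_intros gi)
    then have Rlim: "R \<longlonglongrightarrow> 0" using yF by (simp add: max_absorb1)
    \<comment> \<open>Openness is what keeps \<open>x + s n *\<^sub>R d\<close> in the cone for an
      arbitrary direction \<open>d\<close>, not only for directions close to
      \<open>u\<close>.\<close>
    have "open ((+) a ` cone_nbhd \<eta> u)" by (intro open_translation open_cone_nbhd)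
    moreover have "x \<in> (+) a ` cone_nbhd \<eta> u" using x by (force simp: image_iff)
    ultimately have "\<forall>\<^sub>F n in sequentially. X n \<in> (+) a ` cone_nbhd \<eta> u"
      by (rule topological_tendstoD[OF Xlim])
    then have Xcone: "\<forall>\<^sub>F n in sequentially. X n - a \<in> cone_nbhd \<eta> u"
      by eventually_elim auto
    have Yball: "\<forall>\<^sub>F n in sequentially. Y n \<in> ball b \<epsilon>"
      by (rule topological_tendstoD[OF Ylim open_ball y])
    have "(\<lambda>n. dist b (Y n) + \<kappa> * R n) \<longlonglongrightarrow> dist b y + \<kappa> * 0" by (intro tendsto_intros Ylim Rlim)
    then have Zball: "\<forall>\<^sub>F n in sequentially. dist b (Y n) + \<kappa> * R n < \<epsilon>2 / 2"
      by (rule order_tendstoD) (use y in \<open>simp add: \<epsilon>_def\<close>)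
    have near: "(x', y') \<in> ball (a, b) \<epsilon>2" if "x' - a \<in> cone_nbhd \<eta> u" "dist b y' < \<epsilon>2 / 2" for x' y'
    proof -
      have "x' - a \<in> ball 0 (\<epsilon>2 / 2)" using \<eta>2(2) cone_nbhd_mono[of \<eta> \<eta>2 u] that(1) by (auto simp: \<eta>_def)
      moreover have "dist (a, b) (x', y') \<le> dist a x' + dist b y'"
        by (simp add: dist_Pair_Pair sqrt_sum_squares_le_sum)
      ultimately show ?thesis using that(2) by (simp add: dist_norm norm_minus_commute)
    qed
    have fq: "(\<lambda>n. (f (X n, Y n) - f (x, y)) /\<^sub>R s n) \<longlonglongrightarrow> f' (x, y) (d, e)"
      unfolding XY by (rule directional_quotient_tendsto[OF f_der f'_cont s tendsto_const])
    have gq: "(\<lambda>n. (g (X n, Y n) - g (x, y)) /\<^sub>R s n) \<longlonglongrightarrow> g' (x, y) (d, e)"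
      unfolding XY by (rule directional_quotient_tendsto[OF g_der g'_cont s tendsto_const])
    have "(\<lambda>n. max 0 (g (X n, Y n) $ i) / s n) \<longlonglongrightarrow> (if i \<in> active g x y then max 0 (g' (x, y) (d, e) $ i) else 0)" for i
    proof (cases "i \<in> active g x y")
      case True
      have "(\<lambda>n. max 0 (((g (X n, Y n) - g (x, y)) /\<^sub>R s n) $ i)) \<longlonglongrightarrow> max 0 (g' (x, y) (d, e) $ i)"
        by (intro tendsto_intros gq)
      moreover have "max 0 (((g (X n, Y n) - g (x, y)) /\<^sub>R s n) $ i) = max 0 (g (X n, Y n) $ i) / s n" for n
        using True s(1)[of n] by (auto simp: active_def max_def field_simps zero_le_mult_iff mult_le_0_iff)
      ultimately show ?thesis using True by simp
    next
      case False
      then have "g (x, y) $ i < 0" using yF[of i] by (simp add: active_def less_le)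
      then have "\<forall>\<^sub>F n in sequentially. g (X n, Y n) $ i < 0" by (rule order_tendstoD[OF gi])
      then have "\<forall>\<^sub>F n in sequentially. max 0 (g (X n, Y n) $ i) / s n = 0"
        by eventually_elim simp
      then show ?thesis using False by (simp add: tendsto_eventually)
    qed
    then have "(\<lambda>n. \<Sum>i\<in>UNIV. max 0 (g (X n, Y n) $ i) / s n)
        \<longlonglongrightarrow> (\<Sum>i\<in>UNIV. if i \<in> active g x y then max 0 (g' (x, y) (d, e) $ i) else 0)"
      by (rule tendsto_sum)
    then have Rq: "(\<lambda>n. R n / s n) \<longlonglongrightarrow> (\<Sum>i\<in>active g x y. max 0 (g' (x, y) (d, e) $ i))"
      by (simp add: R_def sum_divide_distrib sum.If_cases)
    have lim: "(\<lambda>n. (f (X n, Y n) - f (x, y)) /\<^sub>R s n + L * \<kappa> * (R n / s n))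
        \<longlonglongrightarrow> f' (x, y) (d, e) + L * \<kappa> * (\<Sum>i\<in>active g x y. max 0 (g' (x, y) (d, e) $ i))"
      by (intro tendsto_intros fq Rq)
    \<comment> \<open>The rate \<open>\<rho>\<close> is a lower bound for the growth of the value
      along \<open>d\<close> only up to every slack \<open>\<theta>\<close>, which is removed
      first.\<close>
    show "\<rho> \<le> f' (x, y) (d, e) + L * \<kappa> * (\<Sum>i\<in>active g x y. max 0 (g' (x, y) (d, e) $ i))"
    proof (rule field_le_epsilon)
      fix \<theta> :: real assume "\<theta> > 0"
      have "\<forall>\<^sub>F n in sequentially. value_fun f g x + ereal (s n * (\<rho> - \<theta>)) \<le> value_fun f g (x + s n *\<^sub>R d)"
        using V[OF \<open>\<theta> > 0\<close>] s_right unfolding filterlim_iff by blast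
      then have "\<forall>\<^sub>F n in sequentially. \<rho> - \<theta> \<le> (f (X n, Y n) - f (x, y)) /\<^sub>R s n + L * \<kappa> * (R n / s n)"
        using Xcone Yball Zball
      proof eventually_elim
        case (elim n)
        have "X n - a \<in> cone_nbhd \<eta>1 u" using elim cone_nbhd_mono[of \<eta> \<eta>1 u] by (auto simp: \<eta>_def)
        moreover have "Y n \<in> ball b \<epsilon>1" using elim by (simp add: \<epsilon>_def)
        ultimately obtain z where z: "z \<in> feasible g (X n)" "norm (z - Y n) \<le> \<kappa> * R n"
          using rs[of "X n - a" "Y n"] by (auto simp: R_def)
        have "dist b z < \<epsilon>2 / 2"
          using z(2) elim dist_triangle[of b z "Y n"] by (simp add: dist_norm norm_minus_commute)
        moreover have "dist b (Y n) < \<epsilon>2 / 2"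
          using elim y by (simp add: \<epsilon>_def)
        ultimately have "norm (f (X n, z) - f (X n, Y n)) \<le> L * norm ((X n, z) - (X n, Y n))"
          using elim by (intro lip near)
        also have "\<dots> \<le> L * (\<kappa> * R n)" using z(2) pos2 by (simp add: norm_Pair)
        finally have fz: "f (X n, z) \<le> f (X n, Y n) + L * (\<kappa> * R n)" by simp
        \<comment> \<open>The growth of the value is compared with \<open>f\<close> at the repaired
          point \<open>z\<close>, which is feasible for the parameter \<open>X n\<close>.\<close>
        have "ereal (f (x, y) + s n * (\<rho> - \<theta>)) \<le> value_fun f g (X n)"
          using elim(1) by (simp add: value_eq[OF sol] X_def[symmetric])
        also have "\<dots> \<le> ereal (f (X n, z))" by (rule value_le[OF z(1)])
        finally have "s n * (\<rho> - \<theta>) \<le> f (X n, Y n) - f (x, y) + L * \<kappa> * R n" using fz by simp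
        then show ?case using s(1)[of n] by (simp add: field_simps)
      qed
      then have "\<rho> - \<theta> \<le> f' (x, y) (d, e) + L * \<kappa> * (\<Sum>i\<in>active g x y. max 0 (g' (x, y) (d, e) $ i))"
        using tendsto_lowerbound[OF lim] by simp
      then show "\<rho> \<le> f' (x, y) (d, e) + L * \<kappa> * (\<Sum>i\<in>active g x y. max 0 (g' (x, y) (d, e) $ i)) + \<theta>" by simp
    qed
  qed
qed

text \<open>A regular subgradient bounds the growth of the value along \<open>d\<close> below by
  \<open>\<xi> \<bullet> d\<close>. The penalty inequality then holds in all joint directions for
  the gradient of \<open>f\<close> minus \<open>(\<xi>, 0)\<close>, and separation yields a
  multiplier with a uniform bound.\<close>

lemma KKT_multiplier_of_subgradient:
  assumes "dir_stable a b u"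
  obtains M \<eta> \<epsilon> where "M > 0" "\<eta> > 0" "\<epsilon> > 0"
    "\<And>x y \<xi>. x - a \<in> cone_nbhd \<eta> u \<Longrightarrow> y \<in> ball b \<epsilon> \<Longrightarrow> y \<in> solutions f g x \<Longrightarrow>
      \<xi> \<in> regular_subdiff (value_fun f g) x \<Longrightarrow>
      \<exists>l::real^'p. (\<forall>i. 0 \<le> l $ i \<and> l $ i \<le> M) \<and> (\<forall>i. i \<notin> active g x y \<longrightarrow> l $ i = 0) \<and>
        (\<forall>d e. f' (x, y) (d, e) + l \<bullet> g' (x, y) (d, e) = \<xi> \<bullet> d)"
proof -
  obtain M \<eta> \<epsilon> where pos: "M > 0" "\<eta> > 0" "\<epsilon> > 0"
    and pen: "\<And>x y d e \<rho>. x - a \<in> cone_nbhd \<eta> u \<Longrightarrow> y \<in> ball b \<epsilon> \<Longrightarrow> y \<in> solutions f g x \<Longrightarrow>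
      (\<And>\<theta>. \<theta> > 0 \<Longrightarrow> \<forall>\<^sub>F s in at_right 0. value_fun f g x + ereal (s * (\<rho> - \<theta>)) \<le> value_fun f g (x + s *\<^sub>R d)) \<Longrightarrow>
      \<rho> \<le> f' (x, y) (d, e) + M * (\<Sum>i\<in>active g x y. max 0 (g' (x, y) (d, e) $ i))"
    using exact_penalty_inequality[OF assms] by blast
  show thesis
  proof (rule that[OF pos])
    fix x y \<xi> assume xy: "x - a \<in> cone_nbhd \<eta> u" "y \<in> ball b \<epsilon>" "y \<in> solutions f g x"
      and \<xi>: "\<xi> \<in> regular_subdiff (value_fun f g) x"
    obtain c where c: "\<And>w. f' (x, y) w = c \<bullet> w"
      using linear_functional_representation[of "f' (x, y)"] blinfun.bounded_linear_right bounded_linear.linear by blast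
    have "\<exists>G. \<forall>w. g' (x, y) w $ i = G \<bullet> w" for i
    proof -
      have "linear (\<lambda>w. g' (x, y) w $ i)"
        by (rule linearI) (simp_all add: blinfun.add_right blinfun.scaleR_right)
      then show ?thesis by (rule linear_functional_representation)
    qed
    then obtain G where G: "\<And>i w. g' (x, y) w $ i = G i \<bullet> w" by metis
    have ineq: "0 \<le> (c - (\<xi>, 0)) \<bullet> w + M * (\<Sum>i\<in>active g x y. max 0 (G i \<bullet> w))" for w
    proof -
      obtain d e where w: "w = (d, e)" by (cases w)
      have "\<forall>\<^sub>F s in at_right 0. value_fun f g x + ereal (s * (\<xi> \<bullet> d - \<theta>)) \<le> value_fun f g (x + s *\<^sub>R d)"
        if "\<theta> > 0" for \<theta>
      proof -
        \<comment> \<open>The summand \<open>1\<close> keeps the quotient meaningful when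
          \<open>d = 0\<close>.\<close>
        define e where "e = \<theta> / (norm d + 1)"
        have "e > 0" using \<open>\<theta> > 0\<close> by (simp add: e_def add_nonneg_pos)
        have ele: "e * norm d \<le> \<theta>"
        proof -
          have "e * norm d \<le> e * (norm d + 1)" using \<open>e > 0\<close> by simp
          also have "\<dots> = \<theta>" unfolding e_def using add_nonneg_pos[OF norm_ge_zero zero_less_one, of d] by simp
          finally show ?thesis .
        qed
        have "((\<lambda>s. x + s *\<^sub>R d) \<longlongrightarrow> x + 0 *\<^sub>R d) (at_right 0)" by (intro tendsto_intros)
        then have "filterlim (\<lambda>s. x + s *\<^sub>R d) (nhds x) (at_right 0)" by simp
        moreover have "\<forall>\<^sub>F x' in nhds x. value_fun f g x' \<ge> value_fun f g x + ereal (\<xi> \<bullet> (x' - x) - e * norm (x' - x))"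
          using \<xi> \<open>e > 0\<close> by (simp add: regular_subdiff_def)
        ultimately have "\<forall>\<^sub>F s in at_right 0. value_fun f g (x + s *\<^sub>R d) \<ge>
            value_fun f g x + ereal (\<xi> \<bullet> (x + s *\<^sub>R d - x) - e * norm (x + s *\<^sub>R d - x))"
          unfolding filterlim_iff by blast
        moreover have "\<forall>\<^sub>F s in at_right 0. (0::real) < s" by (simp add: eventually_at_right_less)
        ultimately show ?thesis
        proof eventually_elim
          case (elim s)
          have "s * (e * norm d) \<le> s * \<theta>" using ele elim(2) by (intro mult_left_mono) auto
          then have "s * (\<xi> \<bullet> d - \<theta>) \<le> \<xi> \<bullet> (x + s *\<^sub>R d - x) - e * norm (x + s *\<^sub>R d - x)"
            using elim(2) by (simp add: algebra_simps)
          then have "value_fun f g x + ereal (s * (\<xi> \<bullet> d - \<theta>))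
              \<le> value_fun f g x + ereal (\<xi> \<bullet> (x + s *\<^sub>R d - x) - e * norm (x + s *\<^sub>R d - x))"
            by (intro add_left_mono) simp
          with elim(1) show ?case by (rule order_trans[rotated])
        qed
      qed
      from pen[OF xy this, of e]
      have "\<xi> \<bullet> d \<le> c \<bullet> w + M * (\<Sum>i\<in>active g x y. max 0 (G i \<bullet> w))"
        unfolding w[symmetric] c G by simp
      then show ?thesis by (simp add: w inner_diff_left)
    qed
    obtain l :: "real^'p" where l: "\<And>i. 0 \<le> l $ i" "\<And>i. l $ i \<le> M" "\<And>i. i \<notin> active g x y \<Longrightarrow> l $ i = 0"
      "c - (\<xi>, 0) + (\<Sum>i\<in>UNIV. (l $ i) *\<^sub>R G i) = 0"
      by (rule multiplier_of_penalty_inequality[OF less_imp_le[OF pos(1)] ineq]) (rule that)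
    have "f' (x, y) (d, e) + l \<bullet> g' (x, y) (d, e) = \<xi> \<bullet> d" for d e
    proof -
      have "0 = (c - (\<xi>, 0) + (\<Sum>i\<in>UNIV. (l $ i) *\<^sub>R G i)) \<bullet> (d, e)" by (simp add: l(4))
      also have "\<dots> = c \<bullet> (d, e) - \<xi> \<bullet> d + (\<Sum>i\<in>UNIV. l $ i * (G i \<bullet> (d, e)))"
        by (simp add: inner_add_left inner_diff_left inner_sum_left)
      also have "(\<Sum>i\<in>UNIV. l $ i * (G i \<bullet> (d, e))) = l \<bullet> g' (x, y) (d, e)"
        by (simp add: inner_vec_def G)
      finally show ?thesis by (simp add: c)
    qed
    with l show "\<exists>l::real^'p. (\<forall>i. 0 \<le> l $ i \<and> l $ i \<le> M) \<and> (\<forall>i. i \<notin> active g x y \<longrightarrow> l $ i = 0) \<and>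
        (\<forall>d e. f' (x, y) (d, e) + l \<bullet> g' (x, y) (d, e) = \<xi> \<bullet> d)" by blast
  qed
qed

text \<open>The same argument with \<open>d = 0\<close> and rate \<open>0\<close>, for use where no
  subgradient is at hand; it gives stationarity in \<open>y\<close> only.\<close>

lemma KKT_multiplier:
  assumes "dir_stable a b u"
  obtains M \<eta> \<epsilon> where "M > 0" "\<eta> > 0" "\<epsilon> > 0"
    "\<And>x y. x - a \<in> cone_nbhd \<eta> u \<Longrightarrow> y \<in> ball b \<epsilon> \<Longrightarrow> y \<in> solutions f g x \<Longrightarrow>
      \<exists>l::real^'p. (\<forall>i. 0 \<le> l $ i \<and> l $ i \<le> M) \<and> (\<forall>i. i \<notin> active g x y \<longrightarrow> l $ i = 0) \<and>
        (\<forall>e. f' (x, y) (0, e) + l \<bullet> g' (x, y) (0, e) = 0)"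
proof -
  obtain M \<eta> \<epsilon> where pos: "M > 0" "\<eta> > 0" "\<epsilon> > 0"
    and pen: "\<And>x y d e \<rho>. x - a \<in> cone_nbhd \<eta> u \<Longrightarrow> y \<in> ball b \<epsilon> \<Longrightarrow> y \<in> solutions f g x \<Longrightarrow>
      (\<And>\<theta>. \<theta> > 0 \<Longrightarrow> \<forall>\<^sub>F s in at_right 0. value_fun f g x + ereal (s * (\<rho> - \<theta>)) \<le> value_fun f g (x + s *\<^sub>R d)) \<Longrightarrow>
      \<rho> \<le> f' (x, y) (d, e) + M * (\<Sum>i\<in>active g x y. max 0 (g' (x, y) (d, e) $ i))"
    using exact_penalty_inequality[OF assms] by blast
  show thesis
  proof (rule that[OF pos])
    fix x y assume xy: "x - a \<in> cone_nbhd \<eta> u" "y \<in> ball b \<epsilon>" "y \<in> solutions f g x"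
    have lin: "linear (\<lambda>e. f' (x, y) (0, e))" "linear (\<lambda>e. g' (x, y) (0, e) $ i)" for i
      using has_derivative_linear[OF y_derivative(1)] has_derivative_linear[OF y_derivative(2)]
      by (simp_all add: linear_iff)
    obtain c where c: "\<And>e. f' (x, y) (0, e) = c \<bullet> e"
      using linear_functional_representation[OF lin(1)] by blast
    have "\<exists>G. \<forall>e. g' (x, y) (0, e) $ i = G \<bullet> e" for i
      using linear_functional_representation[OF lin(2)] .
    then obtain G where G: "\<And>i e. g' (x, y) (0, e) $ i = G i \<bullet> e" by metis
    have ineq: "0 \<le> c \<bullet> e + M * (\<Sum>i\<in>active g x y. max 0 (G i \<bullet> e))" for e
    proof -
      have "\<forall>\<^sub>F s in at_right 0. value_fun f g x + ereal (s * (0 - \<theta>)) \<le> value_fun f g (x + s *\<^sub>R 0)"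
        if "\<theta> > 0" for \<theta> :: real
      proof -
        have "\<forall>\<^sub>F s in at_right 0. (0::real) < s" by (simp add: eventually_at_right_less)
        then show ?thesis
          by eventually_elim (use \<open>\<theta> > 0\<close> in \<open>simp add: value_eq[OF xy(3)]\<close>)
      qed
      from pen[OF xy this, of e] show ?thesis unfolding c G .
    qed
    obtain l :: "real^'p" where l: "\<And>i. 0 \<le> l $ i" "\<And>i. l $ i \<le> M" "\<And>i. i \<notin> active g x y \<Longrightarrow> l $ i = 0"
      "c + (\<Sum>i\<in>UNIV. (l $ i) *\<^sub>R G i) = 0"
      by (rule multiplier_of_penalty_inequality[OF less_imp_le[OF pos(1)] ineq]) (rule that)
    have "f' (x, y) (0, e) + l \<bullet> g' (x, y) (0, e) = 0" for e
    proof -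
      have "0 = (c + (\<Sum>i\<in>UNIV. (l $ i) *\<^sub>R G i)) \<bullet> e" by (simp add: l(4))
      also have "\<dots> = c \<bullet> e + (\<Sum>i\<in>UNIV. l $ i * (G i \<bullet> e))"
        by (simp add: inner_add_left inner_sum_left)
      also have "(\<Sum>i\<in>UNIV. l $ i * (G i \<bullet> e)) = l \<bullet> g' (x, y) (0, e)"
        by (simp add: inner_vec_def G)
      finally show ?thesis by (simp add: c)
    qed
    with l show "\<exists>l::real^'p. (\<forall>i. 0 \<le> l $ i \<and> l $ i \<le> M) \<and> (\<forall>i. i \<notin> active g x y \<longrightarrow> l $ i = 0) \<and>
        (\<forall>e. f' (x, y) (0, e) + l \<bullet> g' (x, y) (0, e) = 0)" by blast
  qed
qed

text \<open>A step from \<open>b\<close> along the linearised direction \<open>v\<close> violates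
  the constraints by \<open>o(t k)\<close> only. Stability repairs this at the same order, so
  \<open>f\<close> at the repaired point still has slope \<open>f' (a, b) (u, v)\<close>.\<close>

lemma value_upper_estimate:
  assumes stable: "dir_stable a b u" and b: "b \<in> feasible g a" and v: "v \<in> lin_cone g a b u"
    and t: "\<And>k. t k > 0" "t \<longlonglongrightarrow> 0" and w: "w \<longlonglongrightarrow> u"
  obtains s where "s \<longlonglongrightarrow> f' (a, b) (u, v)"
    "\<forall>\<^sub>F k in sequentially. value_fun f g (a + t k *\<^sub>R w k) \<le> ereal (f (a, b) + t k * s k)"
proof -
  obtain \<kappa> \<eta> \<epsilon> where pos: "\<kappa> > 0" "\<eta> > 0" "\<epsilon> > 0" and rs: "\<And>d y. d \<in> cone_nbhd \<eta> u \<Longrightarrow> y \<in> ball b \<epsilon> \<Longrightarrow>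
     \<exists>z\<in>feasible g (a + d). norm (z - y) \<le> \<kappa> * (\<Sum>i\<in>UNIV. max 0 (g (a + d, y) $ i))"
    using stable by (auto simp: dir_stable_def)
  define x where "x k = a + t k *\<^sub>R w k" for k
  define y where "y k = b + t k *\<^sub>R v" for k
  define R where "R k = (\<Sum>i\<in>UNIV. max 0 (g (x k, y k) $ i))" for k
  have xy: "(x k, y k) = (a, b) + t k *\<^sub>R (w k, v)" for k by (simp add: x_def y_def)
  have dlim: "(\<lambda>k. (w k, v)) \<longlonglongrightarrow> (u, v)" by (intro tendsto_intros w)
  have gq: "(\<lambda>k. (g (x k, y k) - g (a, b)) /\<^sub>R t k) \<longlonglongrightarrow> g' (a, b) (u, v)"
    unfolding xy by (rule directional_quotient_tendsto[OF g_der g'_cont t dlim])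
  have "(\<lambda>k. a + t k *\<^sub>R w k) \<longlonglongrightarrow> a + 0 *\<^sub>R u" by (intro tendsto_intros t w)
  then have xlim: "x \<longlonglongrightarrow> a" by (simp add: x_def[abs_def])
  have "(\<lambda>k. b + t k *\<^sub>R v) \<longlonglongrightarrow> b + 0 *\<^sub>R v" by (intro tendsto_intros t)
  then have ylim: "y \<longlonglongrightarrow> b" by (simp add: y_def[abs_def])
  have "(\<lambda>k. max 0 (g (x k, y k) $ i) / t k) \<longlonglongrightarrow> 0" for i
  proof (cases "i \<in> active g a b")
    case True
    have "(\<lambda>k. max 0 (((g (x k, y k) - g (a, b)) /\<^sub>R t k) $ i)) \<longlonglongrightarrow> max 0 (g' (a, b) (u, v) $ i)"
      by (intro tendsto_intros gq)
    moreover have "max 0 (((g (x k, y k) - g (a, b)) /\<^sub>R t k) $ i) = max 0 (g (x k, y k) $ i) / t k" for k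
      using True t(1)[of k] by (auto simp: active_def max_def field_simps zero_le_mult_iff mult_le_0_iff)
    moreover have "max 0 (g' (a, b) (u, v) $ i) = 0"
      using v True by (simp add: lin_cone_def frechet_derivative_g)
    ultimately show ?thesis by simp
  next
    case False
    then have "g (a, b) $ i < 0" using b by (simp add: active_def less_le feasible_def)
    then have "\<forall>\<^sub>F k in sequentially. g (x k, y k) $ i < 0"
      by (rule order_tendstoD[OF tendsto_g_nth[OF tendsto_Pair[OF xlim ylim]]])
    then have "\<forall>\<^sub>F k in sequentially. max 0 (g (x k, y k) $ i) / t k = 0"
      by eventually_elim simp
    then show ?thesis by (simp add: tendsto_eventually)
  qed
  then have "(\<lambda>k. \<Sum>i\<in>UNIV. max 0 (g (x k, y k) $ i) / t k) \<longlonglongrightarrow> (\<Sum>i\<in>(UNIV :: 'p set). 0)"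
    by (rule tendsto_sum)
  then have Rq: "(\<lambda>k. R k / t k) \<longlonglongrightarrow> 0" by (simp add: R_def sum_divide_distrib)
  define good where "good k z \<longleftrightarrow> z \<in> feasible g (x k) \<and> norm (z - y k) \<le> \<kappa> * R k" for k z
  \<comment> \<open>The choice is meaningful only for large \<open>k\<close>; earlier terms are
    arbitrary.\<close>
  define z where "z k = (SOME z. good k z)" for k
  have "\<forall>\<^sub>F k in sequentially. y k \<in> ball b \<epsilon>"
    by (rule topological_tendstoD[OF ylim open_ball]) (use pos in simp)
  with eventually_in_cone_nbhd[OF t w pos(2)]
  have good: "\<forall>\<^sub>F k in sequentially. good k (z k)"
  proof eventually_elim
    case (elim k)
    then have "\<exists>z. good k z" using rs[of "t k *\<^sub>R w k" "y k"] by (auto simp: good_def x_def R_def)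
    then show ?case unfolding z_def by (rule someI_ex)
  qed
  have "(\<lambda>k. (z k - y k) /\<^sub>R t k) \<longlonglongrightarrow> 0"
  proof (rule Lim_null_comparison)
    show "(\<lambda>k. \<kappa> * (R k / t k)) \<longlonglongrightarrow> 0" using tendsto_mult_right_zero[OF Rq] .
    show "\<forall>\<^sub>F k in sequentially. norm ((z k - y k) /\<^sub>R t k) \<le> \<kappa> * (R k / t k)"
      using good
    proof eventually_elim
      case (elim k)
      then have "norm (z k - y k) / t k \<le> \<kappa> * R k / t k"
        using t(1)[of k] by (intro divide_right_mono) (simp_all add: good_def)
      moreover have "norm ((z k - y k) /\<^sub>R t k) = norm (z k - y k) / t k"
        using t(1)[of k] by (simp only: norm_scaleR) (simp add: divide_inverse)
      ultimately show ?case by simp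
    qed
  qed
  \<comment> \<open>The repaired points are written as \<open>b\<close> plus \<open>t k\<close>
    times a direction that still converges to \<open>v\<close>.\<close>
  then have "(\<lambda>k. v + (z k - y k) /\<^sub>R t k) \<longlonglongrightarrow> v + 0" by (intro tendsto_intros)
  then have dlim': "(\<lambda>k. (w k, v + (z k - y k) /\<^sub>R t k)) \<longlonglongrightarrow> (u, v)" by (intro tendsto_intros w) simp
  have xz: "(a, b) + t k *\<^sub>R (w k, v + (z k - y k) /\<^sub>R t k) = (x k, z k)" for k
    using t(1)[of k] by (simp add: x_def y_def scaleR_add_right)
  have fq: "(\<lambda>k. (f (x k, z k) - f (a, b)) /\<^sub>R t k) \<longlonglongrightarrow> f' (a, b) (u, v)"
    using directional_quotient_tendsto[OF f_der f'_cont t dlim', of "(a, b)"] unfolding xz .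
  show thesis
  proof (rule that[OF fq])
    show "\<forall>\<^sub>F k in sequentially. value_fun f g (a + t k *\<^sub>R w k)
        \<le> ereal (f (a, b) + t k * ((f (x k, z k) - f (a, b)) /\<^sub>R t k))"
      using good
    proof eventually_elim
      case (elim k)
      then have "value_fun f g (x k) \<le> ereal (f (x k, z k))" by (intro value_le) (simp add: good_def)
      also have "f (x k, z k) = f (a, b) + t k * ((f (x k, z k) - f (a, b)) /\<^sub>R t k)"
        using t(1)[of k] by (simp add: field_simps)
      finally show ?case by (simp only: x_def)
    qed
  qed
qed

text \<open>A solution \<open>q\<close> of the mixed system serves as reference: the residual at
  \<open>p\<close> is controlled by the change of \<open>g\<close>. This feeds the error bound with
  Lipschitz estimates.\<close>

lemma constraint_residual_le:
  assumes "\<And>i. g q $ i \<le> 0" "\<And>i. i \<in> J \<Longrightarrow> g q $ i = 0"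
  shows "(\<Sum>i\<in>UNIV. max 0 (g p $ i)) + (\<Sum>i\<in>J. \<bar>g p $ i\<bar>) \<le> 2 * real CARD('p) * norm (g p - g q)"
proof -
  have le: "\<bar>(g p - g q) $ i\<bar> \<le> norm (g p - g q)" for i by (rule component_le_norm_cart)
  have "max 0 (g p $ i) \<le> norm (g p - g q)" for i
    using le[of i] assms(1)[of i] by (auto simp: max_def)
  then have "(\<Sum>i\<in>UNIV. max 0 (g p $ i)) \<le> (\<Sum>i\<in>(UNIV :: 'p set). norm (g p - g q))" by (intro sum_mono)
  moreover have "(\<Sum>i\<in>J. \<bar>g p $ i\<bar>) \<le> (\<Sum>i\<in>J. norm (g p - g q))"
    using le assms(2) by (intro sum_mono) (metis diff_zero vector_minus_component)
  moreover have "(\<Sum>i\<in>J. norm (g p - g q)) \<le> (\<Sum>i\<in>(UNIV :: 'p set). norm (g p - g q))"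
    by (rule sum_mono2) auto
  ultimately show ?thesis by simp
qed

section \<open>Limits of multipliers and the value function\<close>

text \<open>Constraints in the support of \<open>\<mu>\<close> are active at \<open>(a, b)\<close>
  and eventually along the perturbed solutions. The system keeping them active is therefore solvable
  at both parameters, so \<open>error_bound\<close> transfers points either way at cost
  \<open>O(t k)\<close>.\<close>

lemma multiplier_limit:
  assumes rcr: "RCR_regular g a b" and b: "b \<in> solutions f g a"
    and t: "\<And>k. t k > 0" "t \<longlonglongrightarrow> 0" and w: "w \<longlonglongrightarrow> u" and y: "y \<longlonglongrightarrow> b"
    and sol: "\<forall>\<^sub>F k in sequentially. y k \<in> solutions f g (a + t k *\<^sub>R w k)"
    and l: "l \<longlonglongrightarrow> \<mu>"
    and l_nonneg: "\<forall>\<^sub>F k in sequentially. \<forall>i. 0 \<le> l k $ i"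
    and l_compl: "\<forall>\<^sub>F k in sequentially. \<forall>i. i \<notin> active g (a + t k *\<^sub>R w k) (y k) \<longrightarrow> l k $ i = 0"
    and stat: "\<And>e. f' (a, b) (0, e) + \<mu> \<bullet> g' (a, b) (0, e) = 0"
  shows "0 \<le> \<mu> $ i" "i \<notin> active g a b \<Longrightarrow> \<mu> $ i = 0"
    "\<exists>v\<in>lin_cone g a b u. f' (a, b) (u, v) = f' (a, b) (u, 0) + \<mu> \<bullet> g' (a, b) (u, 0)"
    "\<exists>s. s \<longlonglongrightarrow> f' (a, b) (u, 0) + \<mu> \<bullet> g' (a, b) (u, 0) \<and>
       (\<forall>\<^sub>F k in sequentially. ereal (f (a, b) + t k * s k) \<le> value_fun f g (a + t k *\<^sub>R w k))"
proof -
  define x where "x k = a + t k *\<^sub>R w k" for k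
  define J where "J = {i. \<mu> $ i \<noteq> 0}"
  have "(\<lambda>k. a + t k *\<^sub>R w k) \<longlonglongrightarrow> a + 0 *\<^sub>R u" by (intro tendsto_intros t w)
  then have xlim: "x \<longlonglongrightarrow> a" by (simp add: x_def[abs_def])
  have bF: "g (a, b) $ i \<le> 0" for i using b by (auto simp: solutions_def feasible_def)
  have nonneg: "0 \<le> \<mu> $ i" for i
    by (rule tendsto_lowerbound[OF tendsto_vec_nth[OF l]]) (use l_nonneg in \<open>auto elim: eventually_mono\<close>)
  have "\<forall>i\<in>J. \<forall>\<^sub>F k in sequentially. g (x k, y k) $ i = 0"
  proof
    fix i assume "i \<in> J"
    then have "0 < \<mu> $ i" using nonneg[of i] by (simp add: J_def less_le)
    then have "\<forall>\<^sub>F k in sequentially. 0 < l k $ i" by (rule order_tendstoD[OF tendsto_vec_nth[OF l]])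
    with l_compl show "\<forall>\<^sub>F k in sequentially. g (x k, y k) $ i = 0"
      by eventually_elim (auto simp: active_def x_def)
  qed
  then have yJ: "\<forall>\<^sub>F k in sequentially. \<forall>i\<in>J. g (x k, y k) $ i = 0"
    by (simp add: eventually_ball_finite)
  have bJ: "g (a, b) $ i = 0" if "i \<in> J" for i
  proof (rule LIMSEQ_unique)
    show "(\<lambda>k. g (x k, y k) $ i) \<longlonglongrightarrow> g (a, b) $ i"
      by (intro tendsto_g_nth tendsto_Pair xlim y)
    show "(\<lambda>k. g (x k, y k) $ i) \<longlonglongrightarrow> 0"
      by (rule tendsto_eventually) (use yJ that in \<open>auto elim: eventually_mono\<close>)
  qed
  then have J: "J \<subseteq> active g a b" by (auto simp: active_def)
  show "0 \<le> \<mu> $ i" by (rule nonneg)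
  show "i \<notin> active g a b \<Longrightarrow> \<mu> $ i = 0" using J by (auto simp: J_def)
  have inner_J: "\<mu> \<bullet> z = 0" if "\<And>i. i \<in> J \<Longrightarrow> z $ i = 0" for z
    unfolding inner_vec_def using that by (intro sum.neutral) (auto simp: J_def)
  obtain \<kappa> \<epsilon>1 where pos1: "\<kappa> > 0" "\<epsilon>1 > 0"
    and eb: "\<And>x y z. x \<in> ball a \<epsilon>1 \<Longrightarrow> y \<in> ball b \<epsilon>1 \<Longrightarrow> z \<in> ball b \<epsilon>1 \<Longrightarrow>
       y \<in> feasible g x \<Longrightarrow> (\<And>i. i \<in> J \<Longrightarrow> g (x, y) $ i = 0) \<Longrightarrow>
       \<exists>z'\<in>feasible g x. (\<forall>i\<in>J. g (x, z') $ i = 0) \<and>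
         norm (z' - z) \<le> \<kappa> * ((\<Sum>i\<in>UNIV. max 0 (g (x, z) $ i)) + (\<Sum>i\<in>J. \<bar>g (x, z) $ i\<bar>))"
    using error_bound[OF rcr J] by blast
  obtain L \<epsilon>2 where pos2: "L > 0" "\<epsilon>2 > 0" and lip:
    "\<And>p q. p \<in> ball (a, b) \<epsilon>2 \<Longrightarrow> q \<in> ball (a, b) \<epsilon>2 \<Longrightarrow> norm (g p - g q) \<le> L * norm (p - q)"
    by (rule C1_locally_lipschitz[OF g_der g'_cont]) (rule that)
  \<comment> \<open>Composed of the error bound constant, the residual estimate, the Lipschitz
    constant of \<open>g\<close> and a bound for \<open>norm (w k)\<close>.\<close>
  define C where "C = \<kappa> * (2 * real CARD('p) * (L * (norm u + 1)))"
  have "\<forall>\<^sub>F k in sequentially. norm (w k) < norm u + 1"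
    by (rule order_tendstoD[OF tendsto_norm[OF w]]) simp
  then have xa: "\<forall>\<^sub>F k in sequentially. norm (x k - a) \<le> (norm u + 1) * t k"
    by eventually_elim (use t in \<open>simp add: x_def less_imp_le mult.commute\<close>)
  have xball: "\<forall>\<^sub>F k in sequentially. x k \<in> ball a \<epsilon>1"
    by (rule topological_tendstoD[OF xlim open_ball]) (use pos1 in simp)
  have yball: "\<forall>\<^sub>F k in sequentially. y k \<in> ball b \<epsilon>1"
    by (rule topological_tendstoD[OF y open_ball]) (use pos1 in simp)
  have pball: "\<forall>\<^sub>F k in sequentially. p k \<in> ball (a, b) \<epsilon>2" if "p \<longlonglongrightarrow> (a, b)" for p
    by (rule topological_tendstoD[OF that open_ball]) (use pos2 in simp)
  have xy: "(\<lambda>k. (x k, y k)) \<longlonglongrightarrow> (a, b)" "(\<lambda>k. (x k, b)) \<longlonglongrightarrow> (a, b)" "(\<lambda>k. (a, y k)) \<longlonglongrightarrow> (a, b)"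
    by (intro tendsto_intros xlim y)+
  have residual: "\<kappa> * ((\<Sum>i\<in>UNIV. max 0 (g p $ i)) + (\<Sum>i\<in>J. \<bar>g p $ i\<bar>)) \<le> C * t k"
    if "\<And>i. g q $ i \<le> 0" "\<And>i. i \<in> J \<Longrightarrow> g q $ i = 0" "p \<in> ball (a, b) \<epsilon>2" "q \<in> ball (a, b) \<epsilon>2"
      "norm (p - q) \<le> (norm u + 1) * t k" for p q k
  proof -
    have "(\<Sum>i\<in>UNIV. max 0 (g p $ i)) + (\<Sum>i\<in>J. \<bar>g p $ i\<bar>) \<le> 2 * real CARD('p) * norm (g p - g q)"
      by (rule constraint_residual_le) (use that in auto)
    also have "\<dots> \<le> 2 * real CARD('p) * (L * norm (p - q))"
      using lip that(3,4) by (intro mult_left_mono) auto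
    also have "\<dots> \<le> 2 * real CARD('p) * (L * ((norm u + 1) * t k))"
      using that(5) pos2 by (intro mult_left_mono) auto
    finally have "\<kappa> * ((\<Sum>i\<in>UNIV. max 0 (g p $ i)) + (\<Sum>i\<in>J. \<bar>g p $ i\<bar>))
        \<le> \<kappa> * (2 * real CARD('p) * (L * ((norm u + 1) * t k)))"
      using pos1 by (intro mult_left_mono) auto
    then show ?thesis by (simp add: C_def mult_ac)
  qed
  have solF: "\<forall>\<^sub>F k in sequentially. y k \<in> feasible g (x k)"
    using sol by eventually_elim (simp add: solutions_def x_def)

  show "\<exists>v\<in>lin_cone g a b u. f' (a, b) (u, v) = f' (a, b) (u, 0) + \<mu> \<bullet> g' (a, b) (u, 0)"
  proof -
    \<comment> \<open>The system at \<open>x k\<close> is solvable by \<open>y k\<close>; the error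
      bound, started at \<open>b\<close>, gives a solution within \<open>O(t k)\<close> of
      \<open>b\<close>.\<close>
    define good where "good k z \<longleftrightarrow> z \<in> feasible g (x k) \<and> (\<forall>i\<in>J. g (x k, z) $ i = 0) \<and> norm (z - b) \<le> C * t k" for k z
    define z where "z k = (SOME z. good k z)" for k
    have good: "\<forall>\<^sub>F k in sequentially. good k (z k)"
      using xball yball pball[OF xy(2)] xa solF yJ
    proof eventually_elim
      case (elim k)
      have "\<exists>z'\<in>feasible g (x k). (\<forall>i\<in>J. g (x k, z') $ i = 0) \<and>
         norm (z' - b) \<le> \<kappa> * ((\<Sum>i\<in>UNIV. max 0 (g (x k, b) $ i)) + (\<Sum>i\<in>J. \<bar>g (x k, b) $ i\<bar>))"
        using elim pos1 by (intro eb[of "x k" "y k" b]) auto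
      moreover have "\<kappa> * ((\<Sum>i\<in>UNIV. max 0 (g (x k, b) $ i)) + (\<Sum>i\<in>J. \<bar>g (x k, b) $ i\<bar>)) \<le> C * t k"
        using bF bJ elim pos2 by (intro residual[of "(a, b)"]) (auto simp: norm_Pair)
      ultimately have "\<exists>z. good k z" unfolding good_def by (meson order_trans)
      then show ?case unfolding z_def by (rule someI_ex)
    qed
    have "\<forall>\<^sub>F k in sequentially. norm ((z k - b) /\<^sub>R t k) \<le> C"
      using good
    proof eventually_elim
      case (elim k)
      have "norm ((z k - b) /\<^sub>R t k) = norm (z k - b) / t k"
        using t(1)[of k] by (simp only: norm_scaleR) (simp add: divide_inverse)
      then show ?case using elim t(1)[of k] by (simp add: good_def pos_divide_le_eq)
    qed
    \<comment> \<open>The cluster point \<open>v\<close> of the difference quotients inherits the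
      inequalities of the linearised cone and, on the support of \<open>\<mu>\<close>,
      equalities.\<close>
    then obtain r v where r: "strict_mono (r :: nat \<Rightarrow> nat)" and v: "(\<lambda>k. (z (r k) - b) /\<^sub>R t (r k)) \<longlonglongrightarrow> v"
      by (rule eventually_bounded_convergent_subsequence)
    have tr: "\<And>k. t (r k) > 0" "(\<lambda>k. t (r k)) \<longlonglongrightarrow> 0"
      using t LIMSEQ_subseq_LIMSEQ[OF t(2) r] by (simp_all add: o_def)
    have wr: "(\<lambda>k. w (r k)) \<longlonglongrightarrow> u" using LIMSEQ_subseq_LIMSEQ[OF w r] by (simp add: o_def)
    have goodr: "\<forall>\<^sub>F k in sequentially. good (r k) (z (r k))"
      using eventually_subseq[OF r good] .
    have "(\<lambda>k. (w (r k), (z (r k) - b) /\<^sub>R t (r k))) \<longlonglongrightarrow> (u, v)" by (intro tendsto_intros wr v)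
    from directional_quotient_tendsto[OF g_der g'_cont tr this, of "(a, b)"]
    have gq: "(\<lambda>k. (g (x (r k), z (r k)) - g (a, b)) /\<^sub>R t (r k)) \<longlonglongrightarrow> g' (a, b) (u, v)"
      using tr(1) by (simp add: x_def less_imp_neq[symmetric])
    have le: "g' (a, b) (u, v) $ i \<le> 0" if "i \<in> active g a b" for i
    proof (rule tendsto_upperbound[OF tendsto_vec_nth[OF gq]])
      show "\<forall>\<^sub>F k in sequentially. ((g (x (r k), z (r k)) - g (a, b)) /\<^sub>R t (r k)) $ i \<le> 0"
        using goodr
      proof eventually_elim
        case (elim k)
        then have "g (x (r k), z (r k)) $ i \<le> 0" by (auto simp: good_def feasible_def)
        then show ?case using that tr(1)[of k] by (simp add: active_def mult_le_0_iff)
      qed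
    qed simp
    have eq: "g' (a, b) (u, v) $ i = 0" if "i \<in> J" for i
    proof (rule LIMSEQ_unique[OF tendsto_vec_nth[OF gq]], rule tendsto_eventually)
      show "\<forall>\<^sub>F k in sequentially. ((g (x (r k), z (r k)) - g (a, b)) /\<^sub>R t (r k)) $ i = 0"
        using goodr by eventually_elim (use that bJ in \<open>auto simp: good_def\<close>)
    qed
    have split: "f' (a, b) (u, v) = f' (a, b) (u, 0) + f' (a, b) (0, v)"
      "g' (a, b) (u, v) = g' (a, b) (u, 0) + g' (a, b) (0, v)"
      by (simp_all add: blinfun.add_right[symmetric])
    have "\<mu> \<bullet> g' (a, b) (u, v) = 0" by (rule inner_J[OF eq])
    then have "f' (a, b) (u, v) = f' (a, b) (u, 0) + \<mu> \<bullet> g' (a, b) (u, 0)"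
      using stat[of v] unfolding split by (simp add: inner_add_right)
    moreover have "v \<in> lin_cone g a b u" using le by (simp add: lin_cone_def frechet_derivative_g)
    ultimately show ?thesis by blast
  qed

  show "\<exists>s. s \<longlonglongrightarrow> f' (a, b) (u, 0) + \<mu> \<bullet> g' (a, b) (u, 0) \<and>
       (\<forall>\<^sub>F k in sequentially. ereal (f (a, b) + t k * s k) \<le> value_fun f g (a + t k *\<^sub>R w k))"
  proof -
    \<comment> \<open>The reverse transfer: at \<open>a\<close> the system is solvable by
      \<open>b\<close>, and the error bound is started at \<open>y k\<close>.\<close>
    define good where "good k z \<longleftrightarrow> z \<in> feasible g a \<and> (\<forall>i\<in>J. g (a, z) $ i = 0) \<and> norm (z - y k) \<le> C * t k" for k z
    define z where "z k = (SOME z. good k z)" for k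
    have good: "\<forall>\<^sub>F k in sequentially. good k (z k)"
      using yball pball[OF xy(1)] pball[OF xy(3)] xa solF yJ
    proof eventually_elim
      case (elim k)
      have "\<exists>z'\<in>feasible g a. (\<forall>i\<in>J. g (a, z') $ i = 0) \<and>
         norm (z' - y k) \<le> \<kappa> * ((\<Sum>i\<in>UNIV. max 0 (g (a, y k) $ i)) + (\<Sum>i\<in>J. \<bar>g (a, y k) $ i\<bar>))"
        using elim pos1 b bJ by (intro eb[of a b "y k"]) (auto simp: solutions_def)
      moreover have "\<kappa> * ((\<Sum>i\<in>UNIV. max 0 (g (a, y k) $ i)) + (\<Sum>i\<in>J. \<bar>g (a, y k) $ i\<bar>)) \<le> C * t k"
        using elim by (intro residual[of "(x k, y k)"]) (auto simp: norm_Pair feasible_def norm_minus_commute)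
      ultimately have "\<exists>z. good k z" unfolding good_def by (meson order_trans)
      then show ?case unfolding z_def by (rule someI_ex)
    qed
    have "(\<lambda>k. z k - y k) \<longlonglongrightarrow> 0"
    proof (rule Lim_null_comparison)
      show "(\<lambda>k. C * t k) \<longlonglongrightarrow> 0" using tendsto_mult_right_zero[OF t(2)] .
      show "\<forall>\<^sub>F k in sequentially. norm (z k - y k) \<le> C * t k"
        using good by eventually_elim (simp add: good_def)
    qed
    from tendsto_add[OF this y] have "z \<longlonglongrightarrow> b" by simp
    then have az: "(\<lambda>k. (a, z k)) \<longlonglongrightarrow> (a, b)" by (intro tendsto_intros)
    have bound: "\<forall>\<^sub>F k in sequentially. norm ((x k, y k) - (a, z k)) \<le> (norm u + 1 + C) * t k"
      using good xa
    proof eventually_elim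
      case (elim k)
      have "norm ((x k, y k) - (a, z k)) \<le> norm (x k - a) + norm (y k - z k)"
        by (simp add: norm_Pair sqrt_sum_squares_le_sum)
      then show ?case using elim by (simp add: good_def algebra_simps norm_minus_commute)
    qed
    define A where "A k = (f (x k, y k) - f (a, z k) - f' (a, b) ((x k, y k) - (a, z k))) /\<^sub>R t k" for k
    define B where "B k = (g (x k, y k) - g (a, z k) - g' (a, b) ((x k, y k) - (a, z k))) /\<^sub>R t k" for k
    define s where "s k = (f (x k, y k) - f (a, z k)) / t k" for k
    have A: "A \<longlonglongrightarrow> 0" unfolding A_def
      by (rule C1_strict_derivative_seq[OF f_der f'_cont xy(1) az t(1) bound])
    have B: "B \<longlonglongrightarrow> 0" unfolding B_def
      by (rule C1_strict_derivative_seq[OF g_der g'_cont xy(1) az t(1) bound])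
    have lim: "(\<lambda>k. A k + \<mu> \<bullet> B k + (f' (a, b) (w k, 0) + \<mu> \<bullet> g' (a, b) (w k, 0)))
        \<longlonglongrightarrow> 0 + \<mu> \<bullet> 0 + (f' (a, b) (u, 0) + \<mu> \<bullet> g' (a, b) (u, 0))"
      by (intro tendsto_intros A B w)
    \<comment> \<open>Since \<open>\<mu> \<bullet> g\<close> takes the same value at both points,
      the difference of \<open>f\<close> is that of the Lagrangian. Its derivative in
      \<open>y\<close> vanishes by \<open>stat\<close>, leaving the term along \<open>w k\<close>
      and the two remainders.\<close>
    have ev: "\<forall>\<^sub>F k in sequentially. A k + \<mu> \<bullet> B k + (f' (a, b) (w k, 0) + \<mu> \<bullet> g' (a, b) (w k, 0)) = s k"
      using good yJ
    proof eventually_elim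
      case (elim k)
      have \<Delta>g: "\<mu> \<bullet> (g (x k, y k) - g (a, z k)) = 0"
        by (rule inner_J) (use elim in \<open>simp add: good_def\<close>)
      have d: "(x k, y k) - (a, z k) = t k *\<^sub>R (w k, 0) + (0, y k - z k)" by (simp add: x_def)
      have "f' (a, b) ((x k, y k) - (a, z k)) + \<mu> \<bullet> g' (a, b) ((x k, y k) - (a, z k))
          = t k * (f' (a, b) (w k, 0) + \<mu> \<bullet> g' (a, b) (w k, 0))"
        using stat[of "y k - z k"] unfolding d
        by (simp only: blinfun.add_right blinfun.scaleR_right inner_add_right inner_scaleR_right)
          (simp add: algebra_simps)
      moreover have "t k * A k = f (x k, y k) - f (a, z k) - f' (a, b) ((x k, y k) - (a, z k))"
        using t(1)[of k] by (simp add: A_def)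
      moreover have "t k * (\<mu> \<bullet> B k) = - (\<mu> \<bullet> g' (a, b) ((x k, y k) - (a, z k)))"
      proof -
        have "t k * (\<mu> \<bullet> B k) = \<mu> \<bullet> (t k *\<^sub>R B k)" by simp
        also have "t k *\<^sub>R B k = g (x k, y k) - g (a, z k) - g' (a, b) ((x k, y k) - (a, z k))"
          using t(1)[of k] unfolding B_def by (simp only: scaleR_scaleR) simp
        finally show ?thesis using \<Delta>g by (simp only: inner_diff_right)
      qed
      ultimately have "t k * (A k + \<mu> \<bullet> B k) = f (x k, y k) - f (a, z k)
          - t k * (f' (a, b) (w k, 0) + \<mu> \<bullet> g' (a, b) (w k, 0))"
        by (simp only: distrib_left)
      then have "t k * (A k + \<mu> \<bullet> B k + (f' (a, b) (w k, 0) + \<mu> \<bullet> g' (a, b) (w k, 0))) = f (x k, y k) - f (a, z k)"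
        by (simp add: distrib_left)
      then show ?case using t(1)[of k] by (simp add: s_def field_simps)
    qed
    have "s \<longlonglongrightarrow> f' (a, b) (u, 0) + \<mu> \<bullet> g' (a, b) (u, 0)"
      using Lim_transform_eventually[OF lim ev] by simp
    moreover have "\<forall>\<^sub>F k in sequentially. ereal (f (a, b) + t k * s k) \<le> value_fun f g (a + t k *\<^sub>R w k)"
      using good sol
    proof eventually_elim
      case (elim k)
      \<comment> \<open>Optimality of \<open>b\<close> against the feasible point \<open>z k\<close>
        turns the expansion into a lower bound for the perturbed value.\<close>
      have "f (a, b) \<le> f (a, z k)" using b elim by (auto simp: solutions_def good_def)
      then have "f (a, b) + t k * s k \<le> f (x k, y k)" using t(1)[of k] by (simp add: s_def)
      then show ?case using value_eq[OF elim(2)] by (simp add: x_def)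
    qed
    ultimately show ?thesis by blast
  qed
qed

text \<open>Compactness of the multiplier box. The predicate \<open>P\<close> is left open so that
  the extraction serves stationarity both with and without a subgradient.\<close>

lemma bounded_multipliers_convergent_subsequence:
  assumes "\<forall>\<^sub>F k in sequentially. \<exists>l::real^'p. (\<forall>i. 0 \<le> l $ i \<and> l $ i \<le> M) \<and> P k l"
  obtains r l \<mu> where "strict_mono (r :: nat \<Rightarrow> nat)" "l \<longlonglongrightarrow> \<mu>"
    "\<forall>\<^sub>F k in sequentially. \<forall>i. 0 \<le> l k $ i" "\<forall>\<^sub>F k in sequentially. P (r k) (l k)"
proof -
  define m where "m k = (SOME l::real^'p. (\<forall>i. 0 \<le> l $ i \<and> l $ i \<le> M) \<and> P k l)" for k
  have m: "\<forall>\<^sub>F k in sequentially. (\<forall>i. 0 \<le> m k $ i \<and> m k $ i \<le> M) \<and> P k (m k)"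
    using assms unfolding m_def by eventually_elim (rule someI_ex)
  then have "\<forall>\<^sub>F k in sequentially. norm (m k) \<le> real CARD('p) * M"
  proof eventually_elim
    case (elim k)
    have "norm (m k) \<le> (\<Sum>i\<in>UNIV. \<bar>m k $ i\<bar>)" by (rule norm_le_l1_cart)
    also have "\<dots> \<le> (\<Sum>i\<in>(UNIV :: 'p set). M)" by (rule sum_mono) (use elim in simp)
    finally show ?case by simp
  qed
  then obtain r \<mu> where r: "strict_mono (r :: nat \<Rightarrow> nat)" "(\<lambda>k. m (r k)) \<longlonglongrightarrow> \<mu>"
    by (rule eventually_bounded_convergent_subsequence)
  note mr = eventually_subseq[OF r(1) m]
  show thesis
    by (rule that[OF r]) (use mr in \<open>auto elim: eventually_mono\<close>)
qed

lemma tendsto_derivatives: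
  assumes "p \<longlonglongrightarrow> c"
  shows "(\<lambda>k. f' (p k) d) \<longlonglongrightarrow> f' c d" "(\<lambda>k. g' (p k) d) \<longlonglongrightarrow> g' c d"
proof -
  have "isCont f' c" "isCont g' c"
    using f'_cont g'_cont continuous_on_eq_continuous_at[OF open_UNIV] by blast+
  from this[THEN isCont_tendsto_compose, OF assms]
  show "(\<lambda>k. f' (p k) d) \<longlonglongrightarrow> f' c d" "(\<lambda>k. g' (p k) d) \<longlonglongrightarrow> g' c d"
    by (auto intro!: tendsto_intros)
qed

text \<open>Stability bounds the multipliers of the perturbed solutions, so a subsequence converges
  and \<open>multiplier_limit\<close> applies. Unlike in the upper estimate, the direction
  \<open>v\<close> is produced by the argument.\<close>

lemma value_lower_estimate:
  assumes stable: "dir_stable a b u" and rcr: "RCR_regular g a b" and b: "b \<in> solutions f g a"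
    and t: "\<And>k. t k > 0" "t \<longlonglongrightarrow> 0" and w: "w \<longlonglongrightarrow> u" and y: "y \<longlonglongrightarrow> b"
    and sol: "\<forall>\<^sub>F k in sequentially. y k \<in> solutions f g (a + t k *\<^sub>R w k)"
  obtains v r s where "v \<in> lin_cone g a b u" "strict_mono (r :: nat \<Rightarrow> nat)" "s \<longlonglongrightarrow> f' (a, b) (u, v)"
    "\<forall>\<^sub>F k in sequentially. ereal (f (a, b) + t (r k) * s k) \<le> value_fun f g (a + t (r k) *\<^sub>R w (r k))"
proof -
  obtain M \<eta> \<epsilon> where pos: "M > 0" "\<eta> > 0" "\<epsilon> > 0" and kkt:
    "\<And>x y. x - a \<in> cone_nbhd \<eta> u \<Longrightarrow> y \<in> ball b \<epsilon> \<Longrightarrow> y \<in> solutions f g x \<Longrightarrow>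
      \<exists>l::real^'p. (\<forall>i. 0 \<le> l $ i \<and> l $ i \<le> M) \<and> (\<forall>i. i \<notin> active g x y \<longrightarrow> l $ i = 0) \<and>
        (\<forall>e. f' (x, y) (0, e) + l \<bullet> g' (x, y) (0, e) = 0)"
    using KKT_multiplier[OF stable] by blast
  define x where "x k = a + t k *\<^sub>R w k" for k
  have yball: "\<forall>\<^sub>F k in sequentially. y k \<in> ball b \<epsilon>"
    by (rule topological_tendstoD[OF y open_ball]) (use pos in simp)
  have "\<forall>\<^sub>F k in sequentially. \<exists>l::real^'p. (\<forall>i. 0 \<le> l $ i \<and> l $ i \<le> M) \<and>
      ((\<forall>i. i \<notin> active g (x k) (y k) \<longrightarrow> l $ i = 0) \<and>
       (\<forall>e. f' (x k, y k) (0, e) + l \<bullet> g' (x k, y k) (0, e) = 0))"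
    using eventually_in_cone_nbhd[OF t w pos(2)] yball sol
    by eventually_elim (rule kkt, simp_all add: x_def)
  then obtain r l \<mu> where r: "strict_mono (r :: nat \<Rightarrow> nat)" and l: "l \<longlonglongrightarrow> \<mu>"
    and l_nonneg: "\<forall>\<^sub>F k in sequentially. \<forall>i. 0 \<le> l k $ i"
    and P: "\<forall>\<^sub>F k in sequentially. (\<forall>i. i \<notin> active g (x (r k)) (y (r k)) \<longrightarrow> l k $ i = 0) \<and>
       (\<forall>e. f' (x (r k), y (r k)) (0, e) + l k \<bullet> g' (x (r k), y (r k)) (0, e) = 0)"
    by (rule bounded_multipliers_convergent_subsequence)
  note tw = subsequence_direction[where t=t and w=w, OF t w r]
  have yr: "(\<lambda>k. y (r k)) \<longlonglongrightarrow> b" using LIMSEQ_subseq_LIMSEQ[OF y r] by (simp add: o_def)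
  have "(\<lambda>k. a + t (r k) *\<^sub>R w (r k)) \<longlonglongrightarrow> a + 0 *\<^sub>R u" by (intro tendsto_intros tw)
  then have xr: "(\<lambda>k. x (r k)) \<longlonglongrightarrow> a" by (simp add: x_def)
  have xy: "(\<lambda>k. (x (r k), y (r k))) \<longlonglongrightarrow> (a, b)" by (intro tendsto_intros xr yr)
  have stat: "f' (a, b) (0, e) + \<mu> \<bullet> g' (a, b) (0, e) = 0" for e
  proof (rule LIMSEQ_unique)
    show "(\<lambda>k. f' (x (r k), y (r k)) (0, e) + l k \<bullet> g' (x (r k), y (r k)) (0, e))
        \<longlonglongrightarrow> f' (a, b) (0, e) + \<mu> \<bullet> g' (a, b) (0, e)"
      by (intro tendsto_intros l tendsto_derivatives[OF xy])
    show "(\<lambda>k. f' (x (r k), y (r k)) (0, e) + l k \<bullet> g' (x (r k), y (r k)) (0, e)) \<longlonglongrightarrow> 0"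
      by (rule tendsto_eventually) (use P in \<open>auto elim: eventually_mono\<close>)
  qed
  have compl: "\<forall>\<^sub>F k in sequentially. \<forall>i. i \<notin> active g (a + t (r k) *\<^sub>R w (r k)) (y (r k)) \<longrightarrow> l k $ i = 0"
    using P unfolding x_def by (auto elim: eventually_mono)
  note lim = multiplier_limit[OF rcr b tw yr eventually_subseq[OF r sol] l l_nonneg compl stat]
  obtain v where v: "v \<in> lin_cone g a b u" "f' (a, b) (u, v) = f' (a, b) (u, 0) + \<mu> \<bullet> g' (a, b) (u, 0)"
    using lim(3) by blast
  with lim(4) obtain s where "s \<longlonglongrightarrow> f' (a, b) (u, v)"
    "\<forall>\<^sub>F k in sequentially. ereal (f (a, b) + t (r k) * s k) \<le> value_fun f g (a + t (r k) *\<^sub>R w (r k))"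
    by auto
  then show thesis by (rule that[OF v(1) r])
qed

text \<open>With multipliers attached to the subgradients, the limit identity holds in all joint
  directions. Its \<open>y\<close> part is the stationarity needed in
  \<open>multiplier_limit\<close>, its \<open>x\<close> part identifies the slope as
  \<open>\<xi> \<bullet> u\<close>.\<close>

lemma subgradient_limit:
  assumes stable: "dir_stable a b u" and rcr: "RCR_regular g a b" and b: "b \<in> solutions f g a"
    and t: "\<And>k. t k > 0" "t \<longlonglongrightarrow> 0" and w: "w \<longlonglongrightarrow> u" and y: "y \<longlonglongrightarrow> b"
    and sol: "\<forall>\<^sub>F k in sequentially. y k \<in> solutions f g (a + t k *\<^sub>R w k)"
    and sub: "\<And>k. \<xi>' k \<in> regular_subdiff (value_fun f g) (a + t k *\<^sub>R w k)" and \<xi>: "\<xi>' \<longlonglongrightarrow> \<xi>"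
  obtains \<mu> v r s where "\<And>i. 0 \<le> \<mu> $ i" "\<And>i. i \<notin> active g a b \<Longrightarrow> \<mu> $ i = 0"
    "\<And>d e. f' (a, b) (d, e) + \<mu> \<bullet> g' (a, b) (d, e) = \<xi> \<bullet> d"
    "v \<in> lin_cone g a b u" "f' (a, b) (u, v) = \<xi> \<bullet> u"
    "strict_mono (r :: nat \<Rightarrow> nat)" "s \<longlonglongrightarrow> \<xi> \<bullet> u"
    "\<forall>\<^sub>F k in sequentially. ereal (f (a, b) + t (r k) * s k) \<le> value_fun f g (a + t (r k) *\<^sub>R w (r k))"
proof -
  obtain M \<eta> \<epsilon> where pos: "M > 0" "\<eta> > 0" "\<epsilon> > 0" and kkt:
    "\<And>x y \<xi>. x - a \<in> cone_nbhd \<eta> u \<Longrightarrow> y \<in> ball b \<epsilon> \<Longrightarrow> y \<in> solutions f g x \<Longrightarrow>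
      \<xi> \<in> regular_subdiff (value_fun f g) x \<Longrightarrow>
      \<exists>l::real^'p. (\<forall>i. 0 \<le> l $ i \<and> l $ i \<le> M) \<and> (\<forall>i. i \<notin> active g x y \<longrightarrow> l $ i = 0) \<and>
        (\<forall>d e. f' (x, y) (d, e) + l \<bullet> g' (x, y) (d, e) = \<xi> \<bullet> d)"
    using KKT_multiplier_of_subgradient[OF stable] by blast
  define x where "x k = a + t k *\<^sub>R w k" for k
  have yball: "\<forall>\<^sub>F k in sequentially. y k \<in> ball b \<epsilon>"
    by (rule topological_tendstoD[OF y open_ball]) (use pos in simp)
  have "\<forall>\<^sub>F k in sequentially. \<exists>l::real^'p. (\<forall>i. 0 \<le> l $ i \<and> l $ i \<le> M) \<and>
      ((\<forall>i. i \<notin> active g (x k) (y k) \<longrightarrow> l $ i = 0) \<and>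
       (\<forall>d e. f' (x k, y k) (d, e) + l \<bullet> g' (x k, y k) (d, e) = \<xi>' k \<bullet> d))"
    using eventually_in_cone_nbhd[OF t w pos(2)] yball sol
    by eventually_elim (rule kkt, simp_all add: x_def sub)
  then obtain r l \<mu> where r: "strict_mono (r :: nat \<Rightarrow> nat)" and l: "l \<longlonglongrightarrow> \<mu>"
    and l_nonneg: "\<forall>\<^sub>F k in sequentially. \<forall>i. 0 \<le> l k $ i"
    and P: "\<forall>\<^sub>F k in sequentially. (\<forall>i. i \<notin> active g (x (r k)) (y (r k)) \<longrightarrow> l k $ i = 0) \<and>
       (\<forall>d e. f' (x (r k), y (r k)) (d, e) + l k \<bullet> g' (x (r k), y (r k)) (d, e) = \<xi>' (r k) \<bullet> d)"
    by (rule bounded_multipliers_convergent_subsequence)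
  note tw = subsequence_direction[where t=t and w=w, OF t w r]
  have yr: "(\<lambda>k. y (r k)) \<longlonglongrightarrow> b" using LIMSEQ_subseq_LIMSEQ[OF y r] by (simp add: o_def)
  have \<xi>r: "(\<lambda>k. \<xi>' (r k)) \<longlonglongrightarrow> \<xi>" using LIMSEQ_subseq_LIMSEQ[OF \<xi> r] by (simp add: o_def)
  have "(\<lambda>k. a + t (r k) *\<^sub>R w (r k)) \<longlonglongrightarrow> a + 0 *\<^sub>R u" by (intro tendsto_intros tw)
  then have xr: "(\<lambda>k. x (r k)) \<longlonglongrightarrow> a" by (simp add: x_def)
  have xy: "(\<lambda>k. (x (r k), y (r k))) \<longlonglongrightarrow> (a, b)" by (intro tendsto_intros xr yr)
  have stat: "f' (a, b) (d, e) + \<mu> \<bullet> g' (a, b) (d, e) = \<xi> \<bullet> d" for d e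
  proof (rule LIMSEQ_unique)
    show "(\<lambda>k. f' (x (r k), y (r k)) (d, e) + l k \<bullet> g' (x (r k), y (r k)) (d, e))
        \<longlonglongrightarrow> f' (a, b) (d, e) + \<mu> \<bullet> g' (a, b) (d, e)"
      by (intro tendsto_intros l tendsto_derivatives[OF xy])
    have "(\<lambda>k. \<xi>' (r k) \<bullet> d) \<longlonglongrightarrow> \<xi> \<bullet> d" by (intro tendsto_intros \<xi>r)
    moreover have "\<forall>\<^sub>F k in sequentially. \<xi>' (r k) \<bullet> d
        = f' (x (r k), y (r k)) (d, e) + l k \<bullet> g' (x (r k), y (r k)) (d, e)"
      using P by eventually_elim simp
    ultimately show "(\<lambda>k. f' (x (r k), y (r k)) (d, e) + l k \<bullet> g' (x (r k), y (r k)) (d, e)) \<longlonglongrightarrow> \<xi> \<bullet> d"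
      by (rule Lim_transform_eventually)
  qed
  have compl: "\<forall>\<^sub>F k in sequentially. \<forall>i. i \<notin> active g (a + t (r k) *\<^sub>R w (r k)) (y (r k)) \<longrightarrow> l k $ i = 0"
    using P unfolding x_def by (auto elim: eventually_mono)
  have stat0: "f' (a, b) (0, e) + \<mu> \<bullet> g' (a, b) (0, e) = 0" for e using stat[of 0 e] by simp
  note lim = multiplier_limit[OF rcr b tw yr eventually_subseq[OF r sol] l l_nonneg compl stat0]
  obtain v where v: "v \<in> lin_cone g a b u" "f' (a, b) (u, v) = \<xi> \<bullet> u" using lim(3) stat[of u 0] by auto
  obtain s where s: "s \<longlonglongrightarrow> \<xi> \<bullet> u"
    "\<forall>\<^sub>F k in sequentially. ereal (f (a, b) + t (r k) * s k) \<le> value_fun f g (a + t (r k) *\<^sub>R w (r k))"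
    using lim(4) stat[of u 0] by auto
  show thesis
    by (rule that[OF _ _ stat v r s]) (use lim(1,2) in auto)
qed

text \<open>The identity \<open>stat\<close> is tested in three directions: \<open>(0, e)\<close>
  gives the multiplier equation, \<open>(d, 0)\<close> the formula for \<open>\<xi>\<close>, and
  \<open>(u, v)\<close> the orthogonality.\<close>

lemma mem_W_set:
  assumes "\<And>i. 0 \<le> \<mu> $ i" "\<And>i. i \<notin> active g a b \<Longrightarrow> \<mu> $ i = 0"
    and stat: "\<And>d e. f' (a, b) (d, e) + \<mu> \<bullet> g' (a, b) (d, e) = \<xi> \<bullet> d"
    and v: "f' (a, b) (u, v) = \<xi> \<bullet> u"
  shows "\<xi> \<in> W_set f g a b u v"
proof -
  have "e \<bullet> (grad_y f a b + transpose (jac_y g a b) *v \<mu>) = e \<bullet> 0" for e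
    using stat[of 0 e] unfolding inner_add_right grad_y_f_inner jac_y_inner by simp
  then have "grad_y f a b + transpose (jac_y g a b) *v \<mu> = 0" by (metis vector_eq_ldot)
  moreover have "g (a, b) \<bullet> \<mu> = 0"
    unfolding inner_vec_def using assms(2) by (intro sum.neutral) (auto simp: active_def)
  moreover have "\<mu> \<bullet> g' (a, b) (u, v) = 0" using stat[of u v] v by simp
  moreover have "d \<bullet> \<xi> = d \<bullet> (grad_x f a b + transpose (jac_x g a b) *v \<mu>)" for d
    using stat[of d 0] unfolding inner_add_right grad_x_f_inner jac_x_inner by (simp add: inner_commute)
  then have "\<xi> = grad_x f a b + transpose (jac_x g a b) *v \<mu>" by (metis vector_eq_ldot)
  ultimately show ?thesis
    using assms(1) by (auto simp: W_set_def multipliers_def orthogonal_comp_def orthogonal_def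
        frechet_derivative_g inner_commute)
qed

text \<open>Stability at one solution \<open>b0\<close> gives feasible points converging to
  \<open>b0\<close>, so the perturbed values do not exceed the unperturbed one in the limit.
  Inf-compactness then provides solutions in \<open>\<Omega>\<close>, and their cluster points are
  optimal.\<close>

lemma solution_cluster_point:
  assumes inf_compact: "restricted_inf_compact f g a u \<Omega>"
    and stable: "\<forall>b\<in>solutions f g a. dir_stable a b u"
    and t: "\<And>k. t k > 0" "t \<longlonglongrightarrow> 0" and w: "w \<longlonglongrightarrow> u"
  obtains b r y where "b \<in> dir_solutions f g a u \<inter> \<Omega>" "strict_mono (r :: nat \<Rightarrow> nat)" "y \<longlonglongrightarrow> b"
    "\<And>k. y k \<in> solutions f g (a + t (r k) *\<^sub>R w (r k))"
proof -
  obtain \<epsilon> \<delta> where comp: "compact \<Omega>" and fin: "\<bar>value_fun f g a\<bar> \<noteq> \<infinity>" and pos: "\<epsilon> > 0" "\<delta> > 0"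
    and sol: "\<And>x. x - a \<in> dir_nbhd \<epsilon> \<delta> u \<Longrightarrow> value_fun f g x < value_fun f g a + ereal \<epsilon> \<Longrightarrow>
      solutions f g x \<inter> \<Omega> \<noteq> {}"
    using inf_compact by (auto simp: restricted_inf_compact_def)
  \<comment> \<open>Inf-compactness at the unperturbed parameter itself, as \<open>0\<close> belongs
    to every \<open>dir_nbhd\<close>; the strict inequality uses finiteness of the value.\<close>
  have "value_fun f g a < value_fun f g a + ereal \<epsilon>"
    using fin pos(1) by (cases "value_fun f g a") auto
  then obtain b0 where b0: "b0 \<in> solutions f g a"
    using sol[of a] pos by (auto simp: dir_nbhd_def)
  define x where "x k = a + t k *\<^sub>R w k" for k
  have "(\<lambda>k. a + t k *\<^sub>R w k) \<longlonglongrightarrow> a + 0 *\<^sub>R u" by (intro tendsto_intros t w)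
  then have xlim: "x \<longlonglongrightarrow> a" by (simp add: x_def[abs_def])
  obtain \<kappa> \<eta> \<epsilon>' where pos': "\<kappa> > 0" "\<eta> > 0" "\<epsilon>' > 0" and rs: "\<And>d y. d \<in> cone_nbhd \<eta> u \<Longrightarrow> y \<in> ball b0 \<epsilon>' \<Longrightarrow>
     \<exists>z\<in>feasible g (a + d). norm (z - y) \<le> \<kappa> * (\<Sum>i\<in>UNIV. max 0 (g (a + d, y) $ i))"
    using stable[rule_format, OF b0] by (auto simp: dir_stable_def)
  define R where "R k = (\<Sum>i\<in>UNIV. max 0 (g (x k, b0) $ i))" for k
  have "R \<longlonglongrightarrow> (\<Sum>i\<in>UNIV. max 0 (g (a, b0) $ i))"
    unfolding R_def by (intro tendsto_intros tendsto_g_nth xlim)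
  moreover have "max 0 (g (a, b0) $ i) = 0" for i
    using b0 by (auto simp: solutions_def feasible_def)
  ultimately have Rlim: "R \<longlonglongrightarrow> 0" by simp
  define good where "good k z \<longleftrightarrow> z \<in> feasible g (x k) \<and> norm (z - b0) \<le> \<kappa> * R k" for k z
  define z where "z k = (SOME z. good k z)" for k
  have good: "\<forall>\<^sub>F k in sequentially. good k (z k)"
    using eventually_in_cone_nbhd[OF t w pos'(2)]
  proof eventually_elim
    case (elim k)
    then have "\<exists>z. good k z" using rs[of "t k *\<^sub>R w k" b0] pos'(3) by (auto simp: good_def x_def R_def)
    then show ?case unfolding z_def by (rule someI_ex)
  qed
  have "(\<lambda>k. z k - b0) \<longlonglongrightarrow> 0"
  proof (rule Lim_null_comparison)
    show "(\<lambda>k. \<kappa> * R k) \<longlonglongrightarrow> 0" using tendsto_mult_right_zero[OF Rlim] .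
    show "\<forall>\<^sub>F k in sequentially. norm (z k - b0) \<le> \<kappa> * R k"
      using good by eventually_elim (simp add: good_def)
  qed
  then have zlim: "z \<longlonglongrightarrow> b0" by (simp add: LIM_zero_iff)
  have fz: "(\<lambda>k. f (x k, z k)) \<longlonglongrightarrow> f (a, b0)" by (intro tendsto_f tendsto_intros xlim zlim)
  have Vz: "\<forall>\<^sub>F k in sequentially. value_fun f g (x k) \<le> ereal (f (x k, z k))"
    using good by eventually_elim (auto simp: good_def intro: value_le)
  have "\<forall>\<^sub>F k in sequentially. f (x k, z k) < f (a, b0) + \<epsilon>"
    by (rule order_tendstoD[OF fz]) (use pos in simp)
  with Vz eventually_in_dir_nbhd[OF t w pos]
  have "\<forall>\<^sub>F k in sequentially. solutions f g (x k) \<inter> \<Omega> \<noteq> {}"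
  proof eventually_elim
    case (elim k)
    have "value_fun f g (x k) < ereal (f (a, b0) + \<epsilon>)"
      using elim(1) by (rule le_less_trans) (use elim(3) in simp)
    then show ?case using elim(2) by (intro sol) (simp_all add: value_eq[OF b0] x_def)
  qed
  then obtain N where N: "\<And>k. k \<ge> N \<Longrightarrow> \<exists>y. y \<in> solutions f g (x k) \<inter> \<Omega>"
    unfolding eventually_sequentially by blast
  then have "\<forall>k. \<exists>y. y \<in> solutions f g (x (k + N)) \<inter> \<Omega>" by simp
  then obtain y0 where y0: "\<And>k. y0 k \<in> solutions f g (x (k + N)) \<inter> \<Omega>" by metis
  have "seq_compact \<Omega>" using comp compact_imp_seq_compact by blast
  then obtain b r0 where b: "b \<in> \<Omega>" and r0: "strict_mono r0" "(y0 \<circ> r0) \<longlonglongrightarrow> b"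
    using y0 unfolding seq_compact_def by (metis IntD2)
  define r where "r k = r0 k + N" for k
  define y where "y k = y0 (r0 k)" for k
  have r: "strict_mono r" using r0(1) by (simp add: r_def strict_mono_def)
  have ysol: "y k \<in> solutions f g (x (r k))" for k using y0[of "r0 k"] by (simp add: y_def r_def)
  have ylim: "y \<longlonglongrightarrow> b" using r0(2) by (simp add: y_def[abs_def] o_def)
  have xr: "(\<lambda>k. x (r k)) \<longlonglongrightarrow> a" using LIMSEQ_subseq_LIMSEQ[OF xlim r] by (simp add: o_def)
  have "g (a, b) $ i \<le> 0" for i
  proof (rule LIMSEQ_le_const2)
    show "(\<lambda>k. g (x (r k), y k) $ i) \<longlonglongrightarrow> g (a, b) $ i" by (intro tendsto_g_nth tendsto_intros xr ylim)
    show "\<exists>N. \<forall>k\<ge>N. g (x (r k), y k) $ i \<le> 0" using ysol by (auto simp: solutions_def feasible_def)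
  qed
  then have bF: "b \<in> feasible g a" by (simp add: feasible_def)
  \<comment> \<open>The solutions \<open>y k\<close> are compared with the repaired points, which
    are feasible at the same parameters, and both sides pass to the limit.\<close>
  have "f (a, b) \<le> f (a, b0)"
  proof (rule tendsto_le[OF sequentially_bot])
    show "(\<lambda>k. f (x (r k), y k)) \<longlonglongrightarrow> f (a, b)" by (intro tendsto_f tendsto_intros xr ylim)
    show "(\<lambda>k. f (x (r k), z (r k))) \<longlonglongrightarrow> f (a, b0)" using LIMSEQ_subseq_LIMSEQ[OF fz r] by (simp add: o_def)
    show "\<forall>\<^sub>F k in sequentially. f (x (r k), y k) \<le> f (x (r k), z (r k))"
      using eventually_subseq[OF r Vz] by eventually_elim (simp add: value_eq[OF ysol])
  qed
  then have bS: "b \<in> solutions f g a" using b0 bF by (force simp: solutions_def)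
  note tw = subsequence_direction[where t=t and w=w, OF t w r]
  have "b \<in> dir_solutions f g a u"
    unfolding dir_solutions_def mem_Collect_eq
    by (intro conjI bS exI[of _ "\<lambda>k. t (r k)"] exI[of _ "\<lambda>k. w (r k)"] exI[of _ y] allI tw ylim)
      (use ysol in \<open>simp add: x_def\<close>)
  then show thesis using that[of b r y] b r ylim ysol by (simp add: x_def)
qed

section \<open>The directional derivative of the value function\<close>

lemma value_estimates_subsequence:
  assumes inf_compact: "restricted_inf_compact f g a u \<Omega>"
    and rcr: "\<forall>b\<in>solutions f g a. RCR_regular g a b"
    and stable: "\<forall>b\<in>solutions f g a. dir_stable a b u"
    and t: "\<And>k. t k > 0" "t \<longlonglongrightarrow> 0" and w: "w \<longlonglongrightarrow> u"
  obtains b v r s where "b \<in> solutions f g a" "v \<in> lin_cone g a b u" "strict_mono (r :: nat \<Rightarrow> nat)"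
    "s \<longlonglongrightarrow> f' (a, b) (u, v)"
    "\<forall>\<^sub>F k in sequentially. ereal (f (a, b) + t (r k) * s k) \<le> value_fun f g (a + t (r k) *\<^sub>R w (r k))"
proof -
  obtain b r1 y where b: "b \<in> dir_solutions f g a u \<inter> \<Omega>" and r1: "strict_mono (r1 :: nat \<Rightarrow> nat)"
    and y: "y \<longlonglongrightarrow> b" and sol: "\<And>k. y k \<in> solutions f g (a + t (r1 k) *\<^sub>R w (r1 k))"
    by (rule solution_cluster_point[OF inf_compact stable t w]) (rule that)
  have bS: "b \<in> solutions f g a" using b by (simp add: dir_solutions_def)
  note tw = subsequence_direction[where t=t and w=w, OF t w r1]
  obtain v r2 s where v: "v \<in> lin_cone g a b u" and r2: "strict_mono (r2 :: nat \<Rightarrow> nat)"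
    and s: "s \<longlonglongrightarrow> f' (a, b) (u, v)"
      "\<forall>\<^sub>F k in sequentially. ereal (f (a, b) + t (r1 (r2 k)) * s k)
        \<le> value_fun f g (a + t (r1 (r2 k)) *\<^sub>R w (r1 (r2 k)))"
    by (rule value_lower_estimate[OF stable[rule_format, OF bS] rcr[rule_format, OF bS] bS tw y always_eventually[OF allI[OF sol]]])
  have "strict_mono (\<lambda>k. r1 (r2 k))" using strict_mono_o[OF r1 r2] by (simp add: o_def)
  from that[OF bS v this s] show thesis .
qed

text \<open>The pair from one sequence of steps has minimal slope among all solutions and linearised
  directions. Any other sequence yields a pair of the same minimal slope, so lower and upper
  estimates squeeze the quotient.\<close>

lemma value_directional_derivative:
  assumes inf_compact: "restricted_inf_compact f g a u \<Omega>"
    and rcr: "\<forall>b\<in>solutions f g a. RCR_regular g a b"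
    and stable: "\<forall>b\<in>solutions f g a. dir_stable a b u"
  obtains b v where "b \<in> solutions f g a" "v \<in> lin_cone g a b u"
    "has_dir_deriv (value_fun f g) a u (ereal (f' (a, b) (u, v)))"
    "\<And>b' v'. b' \<in> solutions f g a \<Longrightarrow> v' \<in> lin_cone g a b' u \<Longrightarrow> f' (a, b) (u, v) \<le> f' (a, b') (u, v')"
proof -
  note low = value_estimates_subsequence[OF inf_compact rcr stable]
  have f_eq: "f (a, b) = f (a, b')" if "b \<in> solutions f g a" "b' \<in> solutions f g a" for b b'
    using that by (force simp: solutions_def intro: antisym)
  \<comment> \<open>The upper estimate for \<open>(b', v')\<close> is available along every
    sequence, in particular along the one carrying the lower estimate for
    \<open>(b, v)\<close>.\<close>
  have le: "f' (a, b) (u, v) \<le> f' (a, b') (u, v')"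
    if b: "b \<in> solutions f g a" and b': "b' \<in> solutions f g a" and v': "v' \<in> lin_cone g a b' u"
      and t: "\<And>k. t k > 0" "t \<longlonglongrightarrow> 0" and s: "s \<longlonglongrightarrow> f' (a, b) (u, v)"
      and lower: "\<forall>\<^sub>F k in sequentially. ereal (f (a, b) + t k * s k) \<le> value_fun f g (a + t k *\<^sub>R u)"
    for b v b' v' t s
  proof -
    have "b' \<in> feasible g a" using b' by (simp add: solutions_def)
    then obtain s' where s': "s' \<longlonglongrightarrow> f' (a, b') (u, v')"
      "\<forall>\<^sub>F k in sequentially. value_fun f g (a + t k *\<^sub>R u) \<le> ereal (f (a, b') + t k * s' k)"
      by (rule value_upper_estimate[OF stable[rule_format, OF b'] _ v' t tendsto_const])
    have "\<forall>\<^sub>F k in sequentially. s k \<le> s' k"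
      using lower s'(2)
    proof eventually_elim
      case (elim k)
      then have "ereal (f (a, b) + t k * s k) \<le> ereal (f (a, b') + t k * s' k)" by (rule order_trans)
      then show ?case using f_eq[OF b b'] t(1)[of k] by simp
    qed
    then show ?thesis by (rule tendsto_le[OF sequentially_bot s'(1) s])
  qed
  have t0: "1 / real (Suc k) > 0" "(\<lambda>k. 1 / real (Suc k)) \<longlonglongrightarrow> 0" for k
    using LIMSEQ_inverse_real_of_nat by (simp_all add: inverse_eq_divide del: of_nat_Suc)
  obtain b v r s where b: "b \<in> solutions f g a" and v: "v \<in> lin_cone g a b u" and r: "strict_mono (r :: nat \<Rightarrow> nat)"
    and s: "s \<longlonglongrightarrow> f' (a, b) (u, v)"
      "\<forall>\<^sub>F k in sequentially. ereal (f (a, b) + 1 / real (Suc (r k)) * s k) \<le> value_fun f g (a + (1 / real (Suc (r k))) *\<^sub>R u)"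
    by (rule low[OF t0 tendsto_const])
  have min: "f' (a, b) (u, v) \<le> f' (a, b') (u, v')" if "b' \<in> solutions f g a" "v' \<in> lin_cone g a b' u" for b' v'
    by (rule le[OF b that _ _ s])
      (use t0(1) LIMSEQ_subseq_LIMSEQ[OF t0(2) r] in \<open>simp_all add: o_def\<close>)
  have "has_dir_deriv (value_fun f g) a u (ereal (f' (a, b) (u, v)))"
    unfolding has_dir_deriv_def tendsto_at_iff_sequentially
  proof (intro allI impI, rule topological_tendstoI)
    fix X :: "nat \<Rightarrow> real" and S :: "ereal set"
    assume X0: "\<forall>i. X i \<in> {0<..} - {0}" and Xlim: "X \<longlonglongrightarrow> 0" and S: "open S" "ereal (f' (a, b) (u, v)) \<in> S"
    define Q where "Q t = (value_fun f g (a + t *\<^sub>R u) - value_fun f g a) / ereal t" for t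
    have "\<forall>\<^sub>F k in sequentially. Q (X k) \<in> S"
    proof (rule ccontr)
      assume "\<not> (\<forall>\<^sub>F k in sequentially. Q (X k) \<in> S)"
      then obtain r1 where r1: "strict_mono (r1 :: nat \<Rightarrow> nat)" "\<And>k. Q (X (r1 k)) \<notin> S"
        using not_eventually_sequentiallyD[of "\<lambda>k. Q (X k) \<in> S"] by blast
      have X: "X k > 0" for k using X0 by auto
      note X1 = subsequence_direction[where t=X, OF X Xlim tendsto_const r1(1)]
      obtain b1 v1 r2 s1 where b1: "b1 \<in> solutions f g a" and v1: "v1 \<in> lin_cone g a b1 u"
        and r2: "strict_mono (r2 :: nat \<Rightarrow> nat)" and s1: "s1 \<longlonglongrightarrow> f' (a, b1) (u, v1)"
        and lower: "\<forall>\<^sub>F k in sequentially. ereal (f (a, b1) + X (r1 (r2 k)) * s1 k) \<le> value_fun f g (a + X (r1 (r2 k)) *\<^sub>R u)"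
        by (rule low[OF X1(1,2) tendsto_const])
      note X2 = subsequence_direction[where t="\<lambda>k. X (r1 k)", OF X1(1,2) tendsto_const r2]
      \<comment> \<open>Both pairs carry a lower estimate along some sequence and hence have minimal
        slope, so the limits of the two bounds coincide.\<close>
      have eq: "f' (a, b1) (u, v1) = f' (a, b) (u, v)"
        using le[OF b1 b v X2(1,2) s1 lower] min[OF b1 v1] by simp
      have "b \<in> feasible g a" using b by (simp add: solutions_def)
      then obtain s2 where s2: "s2 \<longlonglongrightarrow> f' (a, b) (u, v)"
        and upper: "\<forall>\<^sub>F k in sequentially. value_fun f g (a + X (r1 (r2 k)) *\<^sub>R u) \<le> ereal (f (a, b) + X (r1 (r2 k)) * s2 k)"
        by (rule value_upper_estimate[OF stable[rule_format, OF b] _ v X2(1,2) tendsto_const])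
      have between: "\<forall>\<^sub>F k in sequentially. ereal (s1 k) \<le> Q (X (r1 (r2 k))) \<and> Q (X (r1 (r2 k))) \<le> ereal (s2 k)"
        using lower upper
      proof eventually_elim
        case (elim k)
        define h where "h = X (r1 (r2 k))"
        have "h > 0" using X by (simp add: h_def)
        obtain c where c: "value_fun f g (a + h *\<^sub>R u) = ereal c"
          using elim by (cases "value_fun f g (a + h *\<^sub>R u)") (auto simp: h_def)
        have "Q h = ereal ((c - f (a, b)) / h)"
          using \<open>h > 0\<close> by (simp add: Q_def c value_eq[OF b])
        moreover have "s1 k \<le> (c - f (a, b)) / h" "(c - f (a, b)) / h \<le> s2 k"
          using elim f_eq[OF b b1] \<open>h > 0\<close> unfolding h_def[symmetric] c by (simp_all add: field_simps)
        ultimately show ?case by (simp add: h_def)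
      qed
      have "(\<lambda>k. Q (X (r1 (r2 k)))) \<longlonglongrightarrow> ereal (f' (a, b) (u, v))"
      proof (rule tendsto_sandwich)
        show "(\<lambda>k. ereal (s1 k)) \<longlonglongrightarrow> ereal (f' (a, b) (u, v))" using s1 by (simp add: eq)
        show "(\<lambda>k. ereal (s2 k)) \<longlonglongrightarrow> ereal (f' (a, b) (u, v))" using s2 by simp
      qed (use between in \<open>auto elim: eventually_mono\<close>)
      then have "\<forall>\<^sub>F k in sequentially. Q (X (r1 (r2 k))) \<in> S" using S by (rule topological_tendstoD)
      then show False using r1(2) by simp
    qed
    then show "\<forall>\<^sub>F k in sequentially. ((\<lambda>t. (value_fun f g (a + t *\<^sub>R u) - value_fun f g a) / ereal t) \<circ> X) k \<in> S"
      by (simp add: Q_def)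
  qed
  then show thesis by (rule that[OF b v _ min])
qed

text \<open>The identity \<open>\<xi> \<bullet> u = V'(a; u)\<close> comes from two comparisons:
  minimality of the derivative among the slopes bounds it by \<open>\<xi> \<bullet> u\<close>, and
  the lower estimate along the subgradient sequence gives the converse.\<close>

lemma limiting_subgradient_mem_W_set:
  assumes inf_compact: "restricted_inf_compact f g a u \<Omega>"
    and rcr: "\<forall>b\<in>solutions f g a. RCR_regular g a b"
    and stable: "\<forall>b\<in>solutions f g a. dir_stable a b u"
    and \<xi>: "\<xi> \<in> dir_limiting_subdiff (value_fun f g) a u"
  obtains b where "b \<in> dir_solutions f g a u \<inter> \<Omega>" "Sigma_set f g a b u \<noteq> {}"
    "\<And>v. v \<in> Sigma_set f g a b u \<Longrightarrow> \<xi> \<in> W_set f g a b u v"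
proof -
  obtain t w \<xi>' where t: "\<And>k. t k > 0" "t \<longlonglongrightarrow> 0" and w: "w \<longlonglongrightarrow> u" and \<xi>': "\<xi>' \<longlonglongrightarrow> \<xi>"
    and sub: "\<And>k. \<xi>' k \<in> regular_subdiff (value_fun f g) (a + t k *\<^sub>R w k)"
    using \<xi> by (auto simp: dir_limiting_subdiff_def)
  obtain b r y where b: "b \<in> dir_solutions f g a u \<inter> \<Omega>" and r: "strict_mono (r :: nat \<Rightarrow> nat)"
    and y: "y \<longlonglongrightarrow> b" and sol: "\<And>k. y k \<in> solutions f g (a + t (r k) *\<^sub>R w (r k))"
    by (rule solution_cluster_point[OF inf_compact stable t w]) (rule that)
  have bS: "b \<in> solutions f g a" using b by (simp add: dir_solutions_def)
  note tw = subsequence_direction[where t=t and w=w, OF t w r]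
  have \<xi>r: "(\<lambda>k. \<xi>' (r k)) \<longlonglongrightarrow> \<xi>" using LIMSEQ_subseq_LIMSEQ[OF \<xi>' r] by (simp add: o_def)
  obtain \<mu> v r2 s where \<mu>: "\<And>i. 0 \<le> \<mu> $ i" "\<And>i. i \<notin> active g a b \<Longrightarrow> \<mu> $ i = 0"
    "\<And>d e. f' (a, b) (d, e) + \<mu> \<bullet> g' (a, b) (d, e) = \<xi> \<bullet> d"
    and v: "v \<in> lin_cone g a b u" "f' (a, b) (u, v) = \<xi> \<bullet> u"
    and r2: "strict_mono (r2 :: nat \<Rightarrow> nat)" and s: "s \<longlonglongrightarrow> \<xi> \<bullet> u"
      "\<forall>\<^sub>F k in sequentially. ereal (f (a, b) + t (r (r2 k)) * s k) \<le> value_fun f g (a + t (r (r2 k)) *\<^sub>R w (r (r2 k)))"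
    by (rule subgradient_limit[OF stable[rule_format, OF bS] rcr[rule_format, OF bS] bS tw y always_eventually[OF allI[OF sol]] sub \<xi>r]) (rule that)
  obtain b0 v0 where b0: "b0 \<in> solutions f g a" and v0: "v0 \<in> lin_cone g a b0 u"
    and deriv: "has_dir_deriv (value_fun f g) a u (ereal (f' (a, b0) (u, v0)))"
    and min: "\<And>b' v'. b' \<in> solutions f g a \<Longrightarrow> v' \<in> lin_cone g a b' u \<Longrightarrow> f' (a, b0) (u, v0) \<le> f' (a, b') (u, v')"
    by (rule value_directional_derivative[OF inf_compact rcr stable]) (rule that)
  have "\<xi> \<bullet> u \<le> f' (a, b0) (u, v0)"
  proof -
    note tw2 = subsequence_direction[where t="\<lambda>k. t (r k)" and w="\<lambda>k. w (r k)", OF tw r2]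
    have "b0 \<in> feasible g a" using b0 by (simp add: solutions_def)
    then obtain s' where s': "s' \<longlonglongrightarrow> f' (a, b0) (u, v0)"
      "\<forall>\<^sub>F k in sequentially. value_fun f g (a + t (r (r2 k)) *\<^sub>R w (r (r2 k))) \<le> ereal (f (a, b0) + t (r (r2 k)) * s' k)"
      by (rule value_upper_estimate[OF stable[rule_format, OF b0] _ v0 tw2])
    have "f (a, b) = f (a, b0)" using bS b0 by (force simp: solutions_def intro: antisym)
    have "\<forall>\<^sub>F k in sequentially. s k \<le> s' k"
      using s(2) s'(2)
    proof eventually_elim
      case (elim k)
      then have "ereal (f (a, b) + t (r (r2 k)) * s k) \<le> ereal (f (a, b0) + t (r (r2 k)) * s' k)"
        by (rule order_trans)
      then show ?case using \<open>f (a, b) = f (a, b0)\<close> tw2(1)[of k] by simp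
    qed
    then show ?thesis by (rule tendsto_le[OF sequentially_bot s'(1) s(1)])
  qed
  then have eq: "f' (a, b0) (u, v0) = \<xi> \<bullet> u" using min[OF bS v(1)] v(2) by simp
  show thesis
  proof (rule that[OF b])
    show "Sigma_set f g a b u \<noteq> {}"
      using deriv v eq by (auto simp: Sigma_set_def frechet_derivative_f)
    fix v' assume "v' \<in> Sigma_set f g a b u"
    then have "has_dir_deriv (value_fun f g) a u (ereal (f' (a, b) (u, v')))"
      by (simp add: Sigma_set_def frechet_derivative_f)
    \<comment> \<open>The set \<open>Sigma_set\<close> constrains \<open>v'\<close> only through the
      value of the directional derivative, so uniqueness of that value covers every choice.\<close>
    then have "ereal (f' (a, b) (u, v')) = ereal (f' (a, b0) (u, v0))"
      using deriv unfolding has_dir_deriv_def by (rule tendsto_unique[OF trivial_limit_at_right_real])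
    then have "f' (a, b) (u, v') = \<xi> \<bullet> u" using eq by simp
    with \<mu> show "\<xi> \<in> W_set f g a b u v'" by (rule mem_W_set)
  qed
qed

text \<open>The slope along \<open>v\<close> is the directional derivative, which the upper estimate
  along \<open>v1\<close> bounds by \<open>\<xi> \<bullet> u\<close>. Conversely,
  \<open>\<mu>\<close> pairs nonpositively with the linearised constraints at \<open>v\<close>, so
  the limit identity makes the slope at least \<open>\<xi> \<bullet> u\<close>.\<close>

lemma limiting_subgradient_mem_W_set_inner_semicont:
  assumes b: "b \<in> solutions f g a" and isc: "dir_inner_semicont f g a b u" and rcr: "RCR_regular g a b"
    and v: "v \<in> Sigma_set f g a b u" and \<xi>: "\<xi> \<in> dir_limiting_subdiff (value_fun f g) a u"
  shows "\<xi> \<in> W_set f g a b u v"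
proof -
  have stable: "dir_stable a b u" by (rule dir_inner_semicont_imp_dir_stable[OF isc rcr])
  obtain t w \<xi>' where t: "\<And>k. t k > 0" "t \<longlonglongrightarrow> 0" and w: "w \<longlonglongrightarrow> u" and \<xi>': "\<xi>' \<longlonglongrightarrow> \<xi>"
    and sub: "\<And>k. \<xi>' k \<in> regular_subdiff (value_fun f g) (a + t k *\<^sub>R w k)"
    using \<xi> by (auto simp: dir_limiting_subdiff_def)
  obtain y where sol: "\<forall>\<^sub>F k in sequentially. y k \<in> solutions f g (a + t k *\<^sub>R w k)" and y: "y \<longlonglongrightarrow> b"
    using isc t w unfolding dir_inner_semicont_def by blast
  obtain \<mu> v1 where \<mu>: "\<And>i. 0 \<le> \<mu> $ i" "\<And>i. i \<notin> active g a b \<Longrightarrow> \<mu> $ i = 0"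
    "\<And>d e. f' (a, b) (d, e) + \<mu> \<bullet> g' (a, b) (d, e) = \<xi> \<bullet> d"
    and v1: "v1 \<in> lin_cone g a b u" "f' (a, b) (u, v1) = \<xi> \<bullet> u"
    by (rule subgradient_limit[OF stable rcr b t w y sol sub \<xi>']) (rule that)
  have lin: "v \<in> lin_cone g a b u" and deriv: "has_dir_deriv (value_fun f g) a u (ereal (f' (a, b) (u, v)))"
    using v by (simp_all add: Sigma_set_def frechet_derivative_f)
  have "f' (a, b) (u, v) \<le> \<xi> \<bullet> u"
  proof -
    have "b \<in> feasible g a" using b by (simp add: solutions_def)
    then obtain s where s: "s \<longlonglongrightarrow> f' (a, b) (u, v1)"
      "\<forall>\<^sub>F k in sequentially. value_fun f g (a + t k *\<^sub>R u) \<le> ereal (f (a, b) + t k * s k)"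
      by (rule value_upper_estimate[OF stable _ v1(1) t tendsto_const])
    have t_right: "filterlim t (at_right 0) sequentially"
      using t by (simp add: filterlim_at order.strict_implies_not_eq[symmetric])
    have "(\<lambda>k. (value_fun f g (a + t k *\<^sub>R u) - value_fun f g a) / ereal (t k)) \<longlonglongrightarrow> ereal (f' (a, b) (u, v))"
      by (rule filterlim_compose[OF deriv[unfolded has_dir_deriv_def] t_right])
    moreover have "(\<lambda>k. ereal (s k)) \<longlonglongrightarrow> ereal (f' (a, b) (u, v1))" using s(1) by simp
    moreover have "\<forall>\<^sub>F k in sequentially.
        (value_fun f g (a + t k *\<^sub>R u) - value_fun f g a) / ereal (t k) \<le> ereal (s k)"
      using s(2)
    proof eventually_elim
      case (elim k)
      then show ?case
        using t(1)[of k] by (cases "value_fun f g (a + t k *\<^sub>R u)") (simp_all add: value_eq[OF b] field_simps)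
    qed
    ultimately have "ereal (f' (a, b) (u, v)) \<le> ereal (f' (a, b) (u, v1))"
      using tendsto_le[OF sequentially_bot] by blast
    then show ?thesis using v1(2) by simp
  qed
  moreover have "\<mu> \<bullet> g' (a, b) (u, v) \<le> 0"
    unfolding inner_vec_def
  proof (rule sum_nonpos)
    fix i
    show "\<mu> $ i \<bullet> g' (a, b) (u, v) $ i \<le> 0"
      using \<mu>(1,2)[of i] lin by (cases "i \<in> active g a b") (auto simp: lin_cone_def frechet_derivative_g mult_le_0_iff)
  qed
  ultimately have "f' (a, b) (u, v) = \<xi> \<bullet> u" using \<mu>(3)[of u v] by simp
  with \<mu> show ?thesis by (rule mem_W_set)
qed

end

text \<open>An affine image of convex multipliers cut by a subspace. Convexity allows the convex
  hull in the Clarke subdifferential to stay inside a single set.\<close>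

lemma convex_W_set: "convex (W_set f g x y u v)"
proof -
  define C where "C = multipliers f g x y \<inter> orthogonal_comp {frechet_derivative g (at (x, y)) (u, v)}"
  define A where "A = grad_y f x y"
  define T where "T = transpose (jac_y g x y)"
  have "convex (multipliers f g x y)"
  proof (rule convexI)
    fix l m and p q :: real
    assume lm: "l \<in> multipliers f g x y" "m \<in> multipliers f g x y" and pq: "0 \<le> p" "0 \<le> q" "p + q = 1"
    have l: "A + T *v l = 0" and m: "A + T *v m = 0" using lm by (auto simp: multipliers_def A_def T_def)
    have "A + T *v (p *\<^sub>R l + q *\<^sub>R m) = (p + q) *\<^sub>R A + T *v (p *\<^sub>R l + q *\<^sub>R m)" using pq by simp
    also have "\<dots> = p *\<^sub>R (A + T *v l) + q *\<^sub>R (A + T *v m)"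
      by (simp add: matrix_vector_right_distrib matrix_vector_mult_scaleR algebra_simps del: transpose_matrix_vector)
    also have "\<dots> = 0" unfolding l m by simp
    finally show "p *\<^sub>R l + q *\<^sub>R m \<in> multipliers f g x y"
      using lm pq unfolding multipliers_def A_def T_def by (auto simp: inner_add_right)
  qed
  then have "convex C"
    unfolding C_def by (intro convex_Int subspace_imp_convex[OF subspace_orthogonal_comp])
  then have "convex ((+) (grad_x f x y) ` ((*v) (transpose (jac_x g x y)) ` C))"
    by (intro convex_translation convex_linear_image matrix_vector_mul_linear)
  moreover have "W_set f g x y u v = (+) (grad_x f x y) ` ((*v) (transpose (jac_x g x y)) ` C)"
    by (auto simp: W_set_def C_def image_iff)
  ultimately show ?thesis by simp
qed

section \<open>Passage from limiting to Clarke subgradients\<close>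

theorem theorem4p3:
  fixes f :: "(real^'n) \<times> (real^'m) \<Rightarrow> real"
    and g :: "(real^'n) \<times> (real^'m) \<Rightarrow> real^'p"
    and xbar u :: "real^'n"
  assumes "cont_differentiable f" and "cont_differentiable g"
  shows
    "(\<forall>\<Omega> :: (real^'m) set.
        restricted_inf_compact f g xbar u \<Omega> \<and>
        (\<forall>y\<in>solutions f g xbar. RCR_regular g xbar y) \<and>
        (\<forall>y\<in>solutions f g xbar. Robinson_stable g xbar y u) \<longrightarrow>
        (\<forall>v :: real^'m \<Rightarrow> real^'m.
           (\<forall>y\<in>dir_solutions f g xbar u \<inter> \<Omega>.
              Sigma_set f g xbar y u \<noteq> {} \<longrightarrow> v y \<in> Sigma_set f g xbar y u) \<longrightarrow>
           dir_clarke_subdiff (value_fun f g) xbar u \<subseteq>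
             convex hull (\<Union>y\<in>{y \<in> dir_solutions f g xbar u \<inter> \<Omega>. Sigma_set f g xbar y u \<noteq> {}}.
               W_set f g xbar y u (v y)))) \<and>
     (\<forall>ybar\<in>solutions f g xbar.
        dir_inner_semicont f g xbar ybar u \<and> RCR_regular g xbar ybar \<longrightarrow>
        (\<forall>v\<in>Sigma_set f g xbar ybar u.
           dir_clarke_subdiff (value_fun f g) xbar u \<subseteq> W_set f g xbar ybar u v))"
proof -
  obtain f' where f': "\<And>z. (f has_derivative blinfun_apply (f' z)) (at z)" "continuous_on UNIV f'"
    using assms(1) by (auto simp: cont_differentiable_def)
  obtain g' where g': "\<And>z. (g has_derivative blinfun_apply (g' z)) (at z)" "continuous_on UNIV g'"
    using assms(2) by (auto simp: cont_differentiable_def)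
  interpret c1_program f g f' g' by unfold_locales (fact f' g')+
  show ?thesis
    unfolding dir_clarke_subdiff_def
  proof (intro conjI allI ballI impI, goal_cases)
    case (1 \<Omega> v)
    have "\<forall>y\<in>solutions f g xbar. dir_stable xbar y u"
      using 1(1) Robinson_stable_imp_dir_stable by blast
    show ?case
    \<comment> \<open>By monotonicity of the hull it suffices to place each limiting subgradient in
      the union; the solution found there admits every element of its \<open>Sigma_set\<close>,
      hence the prescribed \<open>v y\<close>.\<close>
    proof (intro hull_mono subsetI)
      fix \<xi> assume "\<xi> \<in> dir_limiting_subdiff (value_fun f g) xbar u"
      with \<open>\<forall>y\<in>solutions f g xbar. dir_stable xbar y u\<close>
      obtain y where y: "y \<in> dir_solutions f g xbar u \<inter> \<Omega>" "Sigma_set f g xbar y u \<noteq> {}"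
        "\<And>v. v \<in> Sigma_set f g xbar y u \<Longrightarrow> \<xi> \<in> W_set f g xbar y u v"
        using limiting_subgradient_mem_W_set[of xbar u \<Omega> \<xi>] 1(1) by metis
      then show "\<xi> \<in> (\<Union>y\<in>{y \<in> dir_solutions f g xbar u \<inter> \<Omega>. Sigma_set f g xbar y u \<noteq> {}}.
               W_set f g xbar y u (v y))"
        using 1(2) by blast
    qed
  next
    case (2 ybar v)
    then show ?case
      by (intro hull_minimal convex_W_set subsetI limiting_subgradient_mem_W_set_inner_semicont) auto
  qed
qed

end
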